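(* Let $d:=p\cdot n$ satisfy $\log n\ll d\ll n$. Let $i=i(n)\in\mathbb{N}$ be the largest integer $i$ such that $d^i\ll n\log\log n$, and suppose that $d^{i+1}/n - 2\log n\to\infty$. Then asymptotically almost surely $G\in\mathcal{G}(n,p)$ satisfies \[ \zeta(G)\ge \left(\log d - 3\log\log n\right)\frac{n}{d^i}. \]
   Context: $\mathcal{G}(n,p)$ is the binomial random graph on vertex set $[n]$ where each pair is an edge independently with probability $p=p(n)$. A property holds asymptotically almost surely (a.a.s.) if its probability tends to $1$ as $n\to\infty$. Notation: $f\ll g$ means $f/g\to 0$; $\log$ is the natural logarithm. Localization game with $k$ sensors on a connected graph $G$: in round $1$ the cops choose a set $S_1\subseteq V(G)$ with $|S_1|=k$, then the (invisible) robber chooses a vertex $v_1$; in each round $t\ge 2$ the cops choose a new set $S_t$ of size $k$ (based on all previous information), then the robber moves to a vertex $v_t$ at distance at most $1$ from $v_{t-1}$. After each round the cops learn the vector of graph distances from the robber's current vertex to the vertices of $S_t$. The cops win in round $t$ if every two walks $(w_1,\dots,w_t)$, $(x_1,\dots,x_t)$ (consecutive vertices equal or adjacent) which produce the same sequence of distance vectors with respect to $(S_1,\dots,S_t)$ satisfy $w_t=x_t$. The localization number $\zeta(G)$ is the least $k$ such that the cops can win in finite time against every robber strategy. *)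

theory Defs
  imports "HOL-Probability.Probability" "HOL-Library.Landau_Symbols"
    "HOL-Library.Extended_Nat" "HOL-Library.FuncSet"
begin

section \<open>Finite simple graphs\<close>

text \<open>A graph is a pair of a vertex set and an edge set, the edges being two-element
  sets of vertices.\<close>

type_synonym 'a ugraph = "'a set \<times> 'a set set"

definition arcs :: "'a ugraph \<Rightarrow> ('a \<times> 'a) set" where
  "arcs G = {(u, v). u \<in> fst G \<and> v \<in> fst G \<and> u \<noteq> v \<and> {u, v} \<in> snd G}"

definition graph_connected :: "'a ugraph \<Rightarrow> bool" where
  "graph_connected G \<longleftrightarrow> fst G \<noteq> {} \<and> (\<forall>u\<in>fst G. \<forall>v\<in>fst G. (u, v) \<in> (arcs G)\<^sup>*)"

text \<open>The infimum runs over the lengths of all walks from \<open>u\<close> to \<open>v\<close>; it is \<open>\<infinity>\<close> if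
  there is none.\<close>

definition graph_dist :: "'a ugraph \<Rightarrow> 'a \<Rightarrow> 'a \<Rightarrow> enat" where
  "graph_dist G u v = (INF l\<in>{l. (u, v) \<in> arcs G ^^ l}. enat l)"

section \<open>The localization game\<close>

definition robber_move :: "'a ugraph \<Rightarrow> 'a \<Rightarrow> 'a \<Rightarrow> bool" where
  "robber_move G u v \<longleftrightarrow> u \<in> fst G \<and> v \<in> fst G \<and> (u = v \<or> (u, v) \<in> arcs G)"

definition robber_walk :: "'a ugraph \<Rightarrow> 'a list \<Rightarrow> bool" where
  "robber_walk G w \<longleftrightarrow> set w \<subseteq> fst G \<and> (\<forall>t. Suc t < length w \<longrightarrow> robber_move G (w ! t) (w ! Suc t))"

text \<open>The information gained in one round: the sensor set, together with the distances
  from the robber to its members. The \<open>history\<close> of the game is the list of these,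
  oldest first.\<close>

type_synonym 'a observation = "'a set \<times> ('a \<Rightarrow> enat)"

definition observe :: "'a ugraph \<Rightarrow> 'a set \<Rightarrow> 'a \<Rightarrow> 'a observation" where
  "observe G S v = (S, \<lambda>s\<in>S. graph_dist G v s)"

text \<open>A cop strategy maps the history so far to the next sensor set. A robber strategy
  maps the sensor sets \<open>[S\<^sub>1, \<dots>, S\<^sub>t]\<close>, including the current one, to the vertex \<open>v\<^sub>t\<close>; the
  robber's own earlier positions need not be an argument, since they are determined by the
  strategy and the earlier sensor sets.\<close>

definition cop_strategy :: "'a ugraph \<Rightarrow> nat \<Rightarrow> ('a observation list \<Rightarrow> 'a set) \<Rightarrow> bool" where
  "cop_strategy G k \<sigma> \<longleftrightarrow> (\<forall>h. \<sigma> h \<subseteq> fst G \<and> finite (\<sigma> h) \<and> card (\<sigma> h) = k)"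

definition robber_strategy :: "'a ugraph \<Rightarrow> ('a set list \<Rightarrow> 'a) \<Rightarrow> bool" where
  "robber_strategy G \<rho> \<longleftrightarrow>
     (\<forall>S. \<rho> [S] \<in> fst G) \<and>
     (\<forall>Ss S. Ss \<noteq> [] \<longrightarrow> robber_move G (\<rho> Ss) (\<rho> (Ss @ [S])))"

primrec history ::
  "'a ugraph \<Rightarrow> ('a observation list \<Rightarrow> 'a set) \<Rightarrow> ('a set list \<Rightarrow> 'a) \<Rightarrow> nat \<Rightarrow> 'a observation list"
where
  "history G \<sigma> \<rho> 0 = []"
| "history G \<sigma> \<rho> (Suc t) =
     (let h = history G \<sigma> \<rho> t; S = \<sigma> h
      in h @ [observe G S (\<rho> (map fst h @ [S]))])"

definition consistent_walk :: "'a ugraph \<Rightarrow> 'a observation list \<Rightarrow> 'a list \<Rightarrow> bool" where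
  "consistent_walk G h w \<longleftrightarrow>
     robber_walk G w \<and> length w = length h \<and> map2 (observe G) (map fst h) w = h"

text \<open>The cops win once all walks producing the sequence of distance vectors that they have
  learned end at the same vertex. Asking this also of pairs of walks that agree with each
  other but not with the observations would make winning harder, hence the localization
  number no smaller.\<close>

definition robber_located :: "'a ugraph \<Rightarrow> 'a observation list \<Rightarrow> bool" where
  "robber_located G h \<longleftrightarrow>
     (\<forall>w x. consistent_walk G h w \<and> consistent_walk G h x \<longrightarrow> last w = last x)"

definition cops_can_win :: "'a ugraph \<Rightarrow> nat \<Rightarrow> bool" where
  "cops_can_win G k \<longleftrightarrow>
     (\<exists>\<sigma>. cop_strategy G k \<sigma> \<and>
       (\<forall>\<rho>. robber_strategy G \<rho> \<longrightarrow> (\<exists>t\<ge>1. robber_located G (history G \<sigma> \<rho> t))))"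

definition localization_number :: "'a ugraph \<Rightarrow> nat" where
  "localization_number G = (LEAST k. cops_can_win G k)"

text \<open>On a finite graph the minimum is attained: sensors on all vertices win at once.\<close>

lemma graph_dist_eq_0_iff: "graph_dist G u v = 0 \<longleftrightarrow> u = v"
proof
  assume *: "graph_dist G u v = 0"
  define A where "A = enat ` {l. (u, v) \<in> arcs G ^^ l}"
  have "Inf A = 0" using * by (simp add: graph_dist_def A_def)
  moreover from this have "A \<noteq> {}" by (auto simp: Inf_enat_def)
  ultimately have "0 \<in> A" using wellorder_InfI[of _ A] by (metis ex_in_conv)
  then show "u = v" by (auto simp: A_def zero_enat_def)
next
  assume "u = v"
  then have "graph_dist G u v \<le> enat 0"
    unfolding graph_dist_def by (intro INF_lower) auto
  then show "graph_dist G u v = 0" by (simp add: zero_enat_def [symmetric])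
qed

lemma cops_can_win_card:
  assumes "finite (fst G)"
  shows "cops_can_win G (card (fst G))"
  unfolding cops_can_win_def
proof (intro exI[of _ "\<lambda>_. fst G"] conjI allI impI)
  show "cop_strategy G (card (fst G)) (\<lambda>_. fst G)"
    using assms by (simp add: cop_strategy_def)
  fix \<rho> :: "'a set list \<Rightarrow> 'a"
  assume \<rho>: "robber_strategy G \<rho>"
  let ?v = "\<rho> [fst G]"
  have v: "?v \<in> fst G" using \<rho> by (simp add: robber_strategy_def)
  have h: "history G (\<lambda>_. fst G) \<rho> 1 = [observe G (fst G) ?v]" by (simp add: Let_def)
  have "w = [?v]" if cw: "consistent_walk G [observe G (fst G) ?v] w" for w
  proof -
    obtain x where w: "w = [x]"
      using cw by (cases w) (auto simp: consistent_walk_def)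
    have eq: "(\<lambda>s\<in>fst G. graph_dist G x s) = (\<lambda>s\<in>fst G. graph_dist G ?v s)"
      using cw by (simp add: w consistent_walk_def observe_def)
    have "graph_dist G x ?v = graph_dist G ?v ?v"
      using fun_cong[OF eq, of ?v] v by simp
    also have "\<dots> = 0" by (simp add: graph_dist_eq_0_iff)
    finally show ?thesis by (simp add: w graph_dist_eq_0_iff)
  qed
  then have "robber_located G (history G (\<lambda>_. fst G) \<rho> 1)"
    unfolding h robber_located_def by blast
  then show "\<exists>t\<ge>1. robber_located G (history G (\<lambda>_. fst G) \<rho> t)" by blast
qed

section \<open>The binomial random graph\<close>

definition vertex_pairs :: "nat \<Rightarrow> nat set set" where
  "vertex_pairs n = {e. e \<subseteq> {1..n} \<and> card e = 2}"

definition binomial_random_graph :: "nat \<Rightarrow> real \<Rightarrow> nat ugraph pmf" where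
  "binomial_random_graph n p =
     map_pmf (\<lambda>b. ({1..n}, {e \<in> vertex_pairs n. b e}))
       (Pi_pmf (vertex_pairs n) False (\<lambda>_. bernoulli_pmf p))"

definition asymptotically_almost_surely :: "(nat \<Rightarrow> 'b pmf) \<Rightarrow> (nat \<Rightarrow> 'b \<Rightarrow> bool) \<Rightarrow> bool" where
  "asymptotically_almost_surely M P \<longleftrightarrow>
     (\<lambda>n. measure_pmf.prob (M n) {G. P n G}) \<longlonglongrightarrow> 1"

section \<open>The distance exponent\<close>

text \<open>``The largest \<open>i = i(n)\<close> such that \<open>d\<^sup>i \<lless> g\<close>'': the condition concerns the whole
  function \<open>i\<close> and is insensitive to finitely many values, so maximality among the functions
  satisfying it can only be asked for eventually. Since \<open>d\<close> is eventually larger than \<open>1\<close>,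
  negative exponents are irrelevant.\<close>

definition largest_exponent ::
  "(nat \<Rightarrow> real) \<Rightarrow> (nat \<Rightarrow> real) \<Rightarrow> (nat \<Rightarrow> nat) \<Rightarrow> bool" where
  "largest_exponent d g i \<longleftrightarrow>
     (\<lambda>n. d n ^ i n) \<in> o(g) \<and>
     (\<forall>j. (\<lambda>n. d n ^ j n) \<in> o(g) \<longrightarrow> (\<forall>\<^sub>F n in sequentially. j n \<le> i n))"

end

(*
Sparse case (p <= 20 / log n). The robber stays at distance more than i from all sensors; since almost
all distances are at most i + 1, he then looks the same everywhere. The balls of radius i - 1 around
the sensors have together at most (n/d)(log d - 3 loglog n + O(1)) vertices, and a first moment bound
over all sets A of that size leaves at least 20 (n/d)(log n)^2 vertices outside the closed
neighbourhood of A. As any two sets of size 6(n/d) log n are joined by an edge, the set of possible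
positions of the robber never becomes small; by compactness he can follow one infinite walk through
these sets.

Dense case (p >= 20 / log n, so i = 1 and the diameter is 2). Here (1-p)^k is too small compared
with exp(-pk) for the previous argument. Instead, in every neighbourhood two vertices have the same
adjacencies to the sensors: the expected number of such pairs is about (pn)^2 (p^2 + (1-p)^2)^k,
where p^2 + (1-p)^2 >= exp(-2p).

The assumption d^(i+1)/n - 2 log n -> infinity bounds the number of pairs at distance more than
i + 1: the ball of radius i around x in G - y is determined without the edges at y.
*)
theory Submission
  imports Defs "HOL-Real_Asymp.Real_Asymp"
begin

subsection \<open>Independent coin flips\<close>

text \<open>Write L = ln n and N = n/d = 1/p. The regimes split at p of order 1/L because (1-p)^m is
  about exp(-pm - p^2 m/2), and pm can be as large as L: the correction is under control as long as
  pL is bounded. In the dense regime the probability p^2 + (1-p)^2 that two vertices agree on a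
  sensor takes the place of 1-p, and exp(-2p) <= p^2 + (1-p)^2 needs no correction.

  The cops play adaptively and balls depend on the graph, so the events are required for all vertex
  sets of a given size at once. This costs about L per element in the exponent, and the 3 ln L in
  the bound pays for it. Sparse: pm close to ln d - 3 ln L leaves, up to constants, N L^3 uncovered
  vertices, against a cost of order N L^2. Dense: L^6 colliding pairs are expected; fixing the
  number of common neighbours keeps L^4 of them up to a constant, against a cost of order L^3.

  If d < L^3, the claimed bound is not positive and only connectedness remains to be shown.\<close>

lemma prob_mono: "(\<And>b. P b \<Longrightarrow> Q b) \<Longrightarrow> measure_pmf.prob M {b. P b} \<le> measure_pmf.prob M {b. Q b}"
  by (rule measure_pmf.finite_measure_mono) auto

lemma prob_not: "measure_pmf.prob M {b. \<not> Q b} = 1 - measure_pmf.prob M {b. Q b}"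
proof -
  have "{b. \<not> Q b} = UNIV - {b. Q b}" by auto
  then show ?thesis using measure_pmf.prob_compl[of "{b. Q b}" M] by simp
qed

lemma prob_disj_le:
  "measure_pmf.prob M {b. P b} \<le> x \<Longrightarrow> measure_pmf.prob M {b. Q b} \<le> y \<Longrightarrow>
    measure_pmf.prob M {b. P b \<or> Q b} \<le> x + y"
  using measure_Un_le[of "{b. P b}" "measure_pmf M" "{b. Q b}"]
  by (simp add: Collect_disj_eq)

text \<open>The Lagrange remainder of order three has the sign of \<open>(- x) ^ 3\<close>.\<close>

lemma exp_minus_le_quadratic:
  fixes x :: real
  assumes "0 \<le> x"
  shows "exp (- x) \<le> 1 - x + x\<^sup>2 / 2"
proof -
  obtain s where "exp (- x) = (\<Sum>m<3. (- x) ^ m / fact m) + exp s / fact 3 * (- x) ^ 3"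
    using Maclaurin_exp_le[of "- x" 3] by blast
  moreover have "exp s / fact 3 * (- x) ^ 3 \<le> 0"
    using assms by (simp add: mult_nonneg_nonpos)
  ultimately show ?thesis
    by (simp add: eval_nat_numeral lessThan_Suc)
qed

lemma expectation_pair_pmf:
  fixes F :: "'a \<times> 'b \<Rightarrow> real"
  assumes "finite (set_pmf M)" "finite (set_pmf N)"
  shows "measure_pmf.expectation (pair_pmf M N) F =
    measure_pmf.expectation M (\<lambda>x. measure_pmf.expectation N (\<lambda>y. F (x, y)))"
proof -
  have "measure_pmf.expectation (pair_pmf M N) F =
      (\<Sum>z\<in>set_pmf M \<times> set_pmf N. pmf (pair_pmf M N) z * F z)"
    using assms by (subst integral_measure_pmf[of "set_pmf M \<times> set_pmf N"]) auto
  also have "\<dots> = (\<Sum>x\<in>set_pmf M. \<Sum>y\<in>set_pmf N. pmf M x * (pmf N y * F (x, y)))"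
    unfolding sum.cartesian_product by (intro sum.cong) (auto simp: pmf_pair)
  also have "\<dots> = (\<Sum>x\<in>set_pmf M. pmf M x * measure_pmf.expectation N (\<lambda>y. F (x, y)))"
    using assms by (subst integral_measure_pmf[of "set_pmf N"]) (auto simp: sum_distrib_left)
  also have "\<dots> = measure_pmf.expectation M (\<lambda>x. measure_pmf.expectation N (\<lambda>y. F (x, y)))"
    using assms by (subst integral_measure_pmf[of "set_pmf M"]) auto
  finally show ?thesis .
qed


abbreviation bern :: "'e set \<Rightarrow> real \<Rightarrow> ('e \<Rightarrow> bool) pmf" where
  "bern E p \<equiv> Pi_pmf E False (\<lambda>_. bernoulli_pmf p)"

text \<open>Measurability with respect to the coordinates in \<open>F\<close>, phrased for any
  target type. Disjoint coordinate sets give independence, see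
  \<open>expectation_bern_mult\<close>.\<close>

definition depends_on :: "'e set \<Rightarrow> (('e \<Rightarrow> bool) \<Rightarrow> 'b) \<Rightarrow> bool" where
  "depends_on F f \<longleftrightarrow> (\<forall>b b'. (\<forall>e\<in>F. b e = b' e) \<longrightarrow> f b = f b')"

lemma depends_onI: "(\<And>b b'. (\<And>e. e \<in> F \<Longrightarrow> b e = b' e) \<Longrightarrow> f b = f b') \<Longrightarrow> depends_on F f"
  unfolding depends_on_def by blast

lemma depends_onD: "depends_on F f \<Longrightarrow> (\<And>e. e \<in> F \<Longrightarrow> b e = b' e) \<Longrightarrow> f b = f b'"
  unfolding depends_on_def by blast

lemma finite_set_bern [simp]:
  assumes "finite E"
  shows "finite (set_pmf (bern E p))"
  unfolding set_Pi_pmf[OF assms] by (rule finite_PiE_dflt[OF assms]) (rule finite)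

lemma integrable_bern [simp]:
  fixes f :: "_ \<Rightarrow> real"
  shows "finite E \<Longrightarrow> integrable (bern E p) f"
  by (simp add: integrable_measure_pmf_finite)

text \<open>The form in which conditioning is done throughout: with \<open>b\<close> fixed, the law
  of the mixture over \<open>b'\<close> is the conditional law given the coordinates in
  \<open>F\<close>.\<close>

lemma bern_resample:
  assumes "finite E"
  shows "bern E p = map_pmf (\<lambda>(b, b') e. if e \<in> F then b e else b' e) (pair_pmf (bern E p) (bern E p))"
proof -
  let ?r = "\<lambda>A f x. if x \<in> A then f x else False"
  have "bern E p = map_pmf (\<lambda>(f, g) x. if x \<in> E \<inter> F then f x else g x)
      (pair_pmf (bern (E \<inter> F) p) (bern (E - F) p))"
    using Pi_pmf_union[of "E \<inter> F" "E - F" False "\<lambda>_. bernoulli_pmf p"] assms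
    by (simp add: Int_Diff_Un Int_Diff_disjoint)
  also have "bern (E \<inter> F) p = map_pmf (?r (E \<inter> F)) (bern E p)"
    using assms by (intro Pi_pmf_subset) auto
  also have "bern (E - F) p = map_pmf (?r (E - F)) (bern E p)"
    using assms by (intro Pi_pmf_subset) auto
  \<comment> \<open>Outside \<open>E\<close> both copies are \<open>False\<close> on the support, so
    testing membership in \<open>F\<close> gives the same as testing it in
    \<open>E \<inter> F\<close>.\<close>
  also have "map_pmf (\<lambda>(f, g) x. if x \<in> E \<inter> F then f x else g x)
      (pair_pmf (map_pmf (?r (E \<inter> F)) (bern E p)) (map_pmf (?r (E - F)) (bern E p))) =
    map_pmf (\<lambda>(b, b') e. if e \<in> F then b e else b' e) (pair_pmf (bern E p) (bern E p))"
    unfolding map_pair [symmetric] map_pmf_comp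
    using assms by (intro map_pmf_cong refl) (auto simp: set_Pi_pmf PiE_dflt_def fun_eq_iff split: prod.splits)
  finally show ?thesis .
qed

lemma expectation_bern_resample:
  fixes f :: "_ \<Rightarrow> real"
  assumes "finite E"
  shows "measure_pmf.expectation (bern E p) f = measure_pmf.expectation (bern E p)
    (\<lambda>b. measure_pmf.expectation (bern E p) (\<lambda>b'. f (\<lambda>e. if e \<in> F then b e else b' e)))"
  by (subst bern_resample[OF assms, of p F]) (simp add: expectation_pair_pmf assms)

text \<open>After resampling off \<open>F\<close>, the first factor sees only \<open>b\<close> and
  the second only \<open>b'\<close>, so the double integral splits.\<close>

lemma expectation_bern_mult:
  fixes f g :: "_ \<Rightarrow> real"
  assumes E: "finite E" and f: "depends_on F f" and g: "depends_on H g" and disj: "F \<inter> H = {}"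
  shows "measure_pmf.expectation (bern E p) (\<lambda>b. f b * g b) =
    measure_pmf.expectation (bern E p) f * measure_pmf.expectation (bern E p) g"
proof -
  have 1: "f (\<lambda>e. if e \<in> F then b e else b' e) = f b" for b b'
    by (rule depends_onD[OF f]) auto
  have 2: "g (\<lambda>e. if e \<in> F then b e else b' e) = g b'" for b b'
    using disj by (intro depends_onD[OF g]) auto
  show ?thesis
    by (subst expectation_bern_resample[OF E, of _ _ F]) (simp add: 1 2)
qed

lemma expectation_bern_prod:
  fixes f :: "'w \<Rightarrow> _ \<Rightarrow> real"
  assumes E: "finite E" and "finite W" and "\<And>w. w \<in> W \<Longrightarrow> depends_on (B w) (f w)"
    and "disjoint_family_on B W"
  shows "measure_pmf.expectation (bern E p) (\<lambda>b. \<Prod>w\<in>W. f w b) =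
    (\<Prod>w\<in>W. measure_pmf.expectation (bern E p) (f w))"
  using assms(2-4)
proof (induction W rule: finite_induct)
  case (insert w W)
  have dep: "depends_on (\<Union>v\<in>W. B v) (\<lambda>b. \<Prod>v\<in>W. f v b)"
    unfolding depends_on_def
  proof (intro allI impI)
    fix b b' :: "'b \<Rightarrow> bool"
    assume eq: "\<forall>e\<in>(\<Union>v\<in>W. B v). b e = b' e"
    have "f v b = f v b'" if "v \<in> W" for v
      using insert.prems(1)[of v] that eq unfolding depends_on_def by blast
    then show "(\<Prod>v\<in>W. f v b) = (\<Prod>v\<in>W. f v b')" by simp
  qed
  have disj: "B w \<inter> (\<Union>v\<in>W. B v) = {}"
    using insert.prems(2) insert.hyps by (auto simp: disjoint_family_on_def)
  have IH: "measure_pmf.expectation (bern E p) (\<lambda>b. \<Prod>v\<in>W. f v b) =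
      (\<Prod>w\<in>W. measure_pmf.expectation (bern E p) (f w))"
    using insert.prems by (intro insert.IH) (auto simp: disjoint_family_on_def)
  have "measure_pmf.expectation (bern E p) (\<lambda>b. f w b * (\<Prod>v\<in>W. f v b)) =
      measure_pmf.expectation (bern E p) (f w) *
      measure_pmf.expectation (bern E p) (\<lambda>b. \<Prod>v\<in>W. f v b)"
    using insert.prems(1) by (intro expectation_bern_mult[where f = "f w", OF E _ dep disj]) simp
  moreover have "(\<lambda>b. \<Prod>v\<in>insert w W. f v b) = (\<lambda>b. f w b * (\<Prod>v\<in>W. f v b))"
    by (rule ext, rule prod.insert[OF insert.hyps])
  moreover have "(\<Prod>v\<in>insert w W. measure_pmf.expectation (bern E p) (f v)) =
      measure_pmf.expectation (bern E p) (f w) * (\<Prod>v\<in>W. measure_pmf.expectation (bern E p) (f v))"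
    by (rule prod.insert[OF insert.hyps])
  ultimately show ?case using IH by metis
next
  case empty
  show ?case by simp
qed

text \<open>Law of total probability: \<open>g b\<close> bounds the conditional probability of
  \<open>Q\<close> given the values of \<open>b\<close> on \<open>F\<close>.\<close>

lemma prob_resample_le_expectation:
  assumes E: "finite E"
    and g: "\<And>b. measure_pmf.prob (bern E p) {b'. Q (\<lambda>e. if e \<in> F then b e else b' e)} \<le> g b"
  shows "measure_pmf.prob (bern E p) {b. Q b} \<le> measure_pmf.expectation (bern E p) g"
proof -
  have "measure_pmf.prob (bern E p) {b. Q b} = measure_pmf.expectation (bern E p) (indicator {b. Q b})"
    by simp
  also have "\<dots> = measure_pmf.expectation (bern E p) (\<lambda>b. measure_pmf.expectation (bern E p)
      (\<lambda>b'. indicator {b. Q b} (\<lambda>e. if e \<in> F then b e else b' e)))"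
    by (rule expectation_bern_resample[OF E])
  also have "\<dots> = measure_pmf.expectation (bern E p)
      (\<lambda>b. measure_pmf.prob (bern E p) {b'. Q (\<lambda>e. if e \<in> F then b e else b' e)})"
  proof (rule arg_cong[where f = "measure_pmf.expectation (bern E p)"], rule ext)
    fix b
    have "(\<lambda>b'. indicator {b. Q b} (\<lambda>e. if e \<in> F then b e else b' e) :: real) =
       indicator {b'. Q (\<lambda>e. if e \<in> F then b e else b' e)}"
      by (simp add: indicator_def fun_eq_iff)
    then show "measure_pmf.expectation (bern E p) (\<lambda>b'. indicator {b. Q b} (\<lambda>e. if e \<in> F then b e else b' e)) =
       measure_pmf.prob (bern E p) {b'. Q (\<lambda>e. if e \<in> F then b e else b' e)}"
      by simp
  qed
  also have "\<dots> \<le> measure_pmf.expectation (bern E p) g"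
    using E g by (intro integral_mono) auto
  finally show ?thesis .
qed

corollary prob_resample_le:
  assumes "finite E" and "\<And>b. measure_pmf.prob (bern E p) {b'. Q (\<lambda>e. if e \<in> F then b e else b' e)} \<le> c"
  shows "measure_pmf.prob (bern E p) {b. Q b} \<le> c"
  using prob_resample_le_expectation[where g = "\<lambda>_. c", OF assms] by simp

lemma prob_all_indep:
  assumes E: "finite E" and W: "finite W" and dep: "\<And>w. w \<in> W \<Longrightarrow> depends_on (B w) (R w)"
    and disj: "disjoint_family_on B W"
  shows "measure_pmf.prob (bern E p) {b. \<forall>w\<in>W. R w b} = (\<Prod>w\<in>W. measure_pmf.prob (bern E p) {b. R w b})"
proof -
  have "indicator {b. \<forall>w\<in>W. R w b} = (\<lambda>b. \<Prod>w\<in>W. indicator {b. R w b} b :: real)"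
    using W by (auto simp: fun_eq_iff indicator_def prod_zero_iff)
  then have "measure_pmf.expectation (bern E p) (indicator {b. \<forall>w\<in>W. R w b}) =
     measure_pmf.expectation (bern E p) (\<lambda>b. \<Prod>w\<in>W. indicator {b. R w b} b :: real)"
    by simp
  also have "\<dots> = (\<Prod>w\<in>W. measure_pmf.expectation (bern E p) (indicator {b. R w b}))"
  proof (rule expectation_bern_prod[OF E W _ disj])
    fix w assume w: "w \<in> W"
    show "depends_on (B w) (indicator {b. R w b} :: _ \<Rightarrow> real)"
    proof (rule depends_onI)
      fix b b' :: "'a \<Rightarrow> bool" assume "\<And>e. e \<in> B w \<Longrightarrow> b e = b' e"
      then have "R w b = R w b'" by (rule depends_onD[OF dep[OF w]])
      then show "indicator {b. R w b} b = (indicator {b. R w b} b' :: real)" by (simp add: indicator_def)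
    qed
  qed
  finally show ?thesis by simp
qed

lemma prob_bern_pattern:
  assumes E: "finite E" and F: "F \<subseteq> E" "F' \<subseteq> E" "F \<inter> F' = {}" and p: "0 \<le> p" "p \<le> 1"
  shows "measure_pmf.prob (bern E p) {b. (\<forall>e\<in>F. b e) \<and> (\<forall>e\<in>F'. \<not> b e)} =
    p ^ card F * (1 - p) ^ card F'"
proof -
  let ?B = "\<lambda>e. if e \<in> F then {True} else if e \<in> F' then {False} else UNIV"
  have fin1: "finite F" using F(1) E by (rule finite_subset)
  have fin2: "finite F'" using F(2) E by (rule finite_subset)
  have "{b. (\<forall>e\<in>F. b e) \<and> (\<forall>e\<in>F'. \<not> b e)} = Pi E ?B"
    using F by (auto simp: Pi_def split: if_splits)
  then have "measure_pmf.prob (bern E p) {b. (\<forall>e\<in>F. b e) \<and> (\<forall>e\<in>F'. \<not> b e)} =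
     (\<Prod>e\<in>E. measure_pmf.prob (bernoulli_pmf p) (?B e))"
    using E by (simp add: measure_Pi_pmf_Pi)
  also have "\<dots> = (\<Prod>e\<in>E. (if e \<in> F then p else 1) * (if e \<in> F' then 1 - p else 1))"
    using F p by (intro prod.cong refl) (auto simp: measure_pmf_single)
  also have "\<dots> = p ^ card F * (1 - p) ^ card F'"
    using F E fin1 fin2 by (simp add: prod.distrib prod.If_cases Int_absorb1)
  finally show ?thesis .
qed

section \<open>Exponential moments and tail bounds\<close>

lemma expectation_exp_indicator:
  fixes M :: "'a pmf" and t :: real
  assumes "finite (set_pmf M)"
  shows "measure_pmf.expectation M (\<lambda>b. exp (t * of_bool (Q b))) =
     1 + measure_pmf.prob M {b. Q b} * (exp t - 1)"
proof -
  have "(\<lambda>b. exp (t * of_bool (Q b))) = (\<lambda>b. 1 + indicator {b. Q b} b * (exp t - 1))"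
    by (auto simp: fun_eq_iff)
  then show ?thesis
    using assms by (simp add: integrable_measure_pmf_finite)
qed

lemma expectation_exp_card:
  fixes t q :: real
  assumes E: "finite E" and W: "finite W" and dep: "\<And>w. w \<in> W \<Longrightarrow> depends_on (B w) (Q w)"
    and disj: "disjoint_family_on B W"
    and q: "\<And>w. w \<in> W \<Longrightarrow> measure_pmf.prob (bern E p) {b. Q w b} = q"
  shows "measure_pmf.expectation (bern E p) (\<lambda>b. exp (t * card {w\<in>W. Q w b})) \<le>
    exp (card W * q * (exp t - 1))"
proof -
  have "exp (t * card {w\<in>W. Q w b}) = (\<Prod>w\<in>W. exp (t * of_bool (Q w b)))" for b
    using W by (simp add: exp_sum [symmetric] sum_distrib_left [symmetric] Collect_conj_eq Int_commute)
  then have "measure_pmf.expectation (bern E p) (\<lambda>b. exp (t * card {w\<in>W. Q w b})) =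
    measure_pmf.expectation (bern E p) (\<lambda>b. \<Prod>w\<in>W. exp (t * of_bool (Q w b)))"
    by simp
  also have "\<dots> = (\<Prod>w\<in>W. measure_pmf.expectation (bern E p) (\<lambda>b. exp (t * of_bool (Q w b))))"
    using dep disj by (intro expectation_bern_prod[OF E W, where B = B]) (auto simp: depends_on_def)
  also have "\<dots> = (\<Prod>w\<in>W. 1 + q * (exp t - 1))"
    using E q by (intro prod.cong refl) (simp add: expectation_exp_indicator)
  also have "\<dots> = (1 + q * (exp t - 1)) ^ card W"
    by simp
  also have "\<dots> \<le> exp (q * (exp t - 1)) ^ card W"
  \<comment> \<open>Only an element of \<open>W\<close> reveals that \<open>q\<close> is a
    probability, which makes the base \<open>1 + q * (exp t - 1)\<close> nonnegative.\<close>
  proof (cases "W = {}")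
    case False
    then obtain w where "w \<in> W" by auto
    then have "q \<ge> 0" "q \<le> 1" using q by force+
    then have "q * (exp t - 1) \<ge> q * (- 1)" by (intro mult_left_mono) auto
    then have "0 \<le> 1 + q * (exp t - 1)" using \<open>q \<le> 1\<close> by linarith
    then show ?thesis by (intro power_mono) auto
  qed auto
  also have "\<dots> = exp (card W * q * (exp t - 1))"
    by (simp add: exp_of_nat_mult [symmetric] mult_ac)
  finally show ?thesis .
qed

lemma prob_le_expectation:
  fixes f :: "_ \<Rightarrow> real"
  assumes "finite (set_pmf M)" "\<And>b. f b \<ge> 0" "\<And>b. Q b \<Longrightarrow> f b \<ge> 1"
  shows "measure_pmf.prob M {b. Q b} \<le> measure_pmf.expectation M f"
proof -
  have "measure_pmf.prob M {b. Q b} = measure_pmf.expectation M (indicator {b. Q b})"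
    by simp
  also have "\<dots> \<le> measure_pmf.expectation M f"
    using assms by (intro integral_mono integrable_measure_pmf_finite) (auto simp: indicator_def)
  finally show ?thesis .
qed

text \<open>Markov's inequality for the number of events that occur.\<close>

lemma prob_many_le:
  fixes s c :: real
  assumes "finite (set_pmf M)" "finite Z" "s > 0" and c: "\<And>z. z \<in> Z \<Longrightarrow> measure_pmf.prob M {b. Q z b} \<le> c"
  shows "measure_pmf.prob M {b. real (card {z\<in>Z. Q z b}) \<ge> s} \<le> card Z * c / s"
proof -
  have int: "integrable M f" for f :: "_ \<Rightarrow> real"
    using assms(1) by (rule integrable_measure_pmf_finite)
  have "measure_pmf.prob M {b. real (card {z\<in>Z. Q z b}) \<ge> s} \<le>
     measure_pmf.expectation M (\<lambda>b. real (card {z\<in>Z. Q z b}) / s)"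
    using assms by (intro prob_le_expectation) auto
  also have "(\<lambda>b. real (card {z\<in>Z. Q z b}) / s) = (\<lambda>b. (\<Sum>z\<in>Z. indicator {b. Q z b} b) / s)"
    using assms(2) by (simp add: indicator_def Int_def)
  also have "measure_pmf.expectation M \<dots> = (\<Sum>z\<in>Z. measure_pmf.prob M {b. Q z b}) / s"
    by (simp add: int)
  also have "\<dots> \<le> (\<Sum>z\<in>Z. c) / s"
    using assms(3) by (intro divide_right_mono sum_mono c) auto
  finally show ?thesis by simp
qed

text \<open>Keeping the factor \<open>t\<close> on both sides of the event covers both tails:
  positive \<open>t\<close> gives the upper one, negative \<open>t\<close> the lower one.\<close>

lemma chernoff_generic:
  fixes t x q :: real
  assumes E: "finite E" and W: "finite W" and dep: "\<And>w. w \<in> W \<Longrightarrow> depends_on (B w) (Q w)"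
    and disj: "disjoint_family_on B W"
    and q: "\<And>w. w \<in> W \<Longrightarrow> measure_pmf.prob (bern E p) {b. Q w b} = q"
  shows "measure_pmf.prob (bern E p) {b. t * card {w\<in>W. Q w b} \<ge> t * x} \<le>
    exp (card W * q * (exp t - 1) - t * x)"
proof -
  have "measure_pmf.prob (bern E p) {b. t * card {w\<in>W. Q w b} \<ge> t * x} \<le>
     measure_pmf.expectation (bern E p) (\<lambda>b. exp (t * card {w\<in>W. Q w b}) * exp (- (t * x)))"
    using E by (intro prob_le_expectation) (auto simp flip: exp_add)
  also have "\<dots> = measure_pmf.expectation (bern E p) (\<lambda>b. exp (t * card {w\<in>W. Q w b})) * exp (- (t * x))"
    by simp
  also have "\<dots> \<le> exp (card W * q * (exp t - 1)) * exp (- (t * x))"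
    by (intro mult_right_mono expectation_exp_card[OF assms]) auto
  finally show ?thesis by (simp flip: exp_add)
qed

lemma chernoff_upper:
  fixes \<epsilon> \<mu> q :: real
  assumes E: "finite E" and W: "finite W" and dep: "\<And>w. w \<in> W \<Longrightarrow> depends_on (B w) (Q w)"
    and disj: "disjoint_family_on B W"
    and q: "\<And>w. w \<in> W \<Longrightarrow> measure_pmf.prob (bern E p) {b. Q w b} = q"
    and \<mu>: "card W * q \<le> \<mu>" and \<epsilon>: "0 < \<epsilon>" "\<epsilon> \<le> 1"
  shows "measure_pmf.prob (bern E p) {b. card {w\<in>W. Q w b} \<ge> (1 + \<epsilon>) * \<mu>} \<le> exp (- \<epsilon>\<^sup>2 * \<mu> / 4)"
proof -
  have q0: "card W * q \<ge> 0"
  proof (cases "W = {}")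
    case False
    then obtain w where "w \<in> W" by auto
    then have "q \<ge> 0" using q by force
    then show ?thesis by simp
  qed simp
  \<comment> \<open>With exp t - 1 <= t + t^2 the exponent is \<mu> (t^2 - t \<epsilon>), which is
    least at t = \<epsilon>/2.\<close>
  have "measure_pmf.prob (bern E p) {b. card {w\<in>W. Q w b} \<ge> (1 + \<epsilon>) * \<mu>} =
     measure_pmf.prob (bern E p) {b. \<epsilon> / 2 * card {w\<in>W. Q w b} \<ge> \<epsilon> / 2 * ((1 + \<epsilon>) * \<mu>)}"
    using \<epsilon> by (subst mult_le_cancel_left_pos) auto
  also have "\<dots> \<le> exp (card W * q * (exp (\<epsilon> / 2) - 1) - \<epsilon> / 2 * ((1 + \<epsilon>) * \<mu>))"
    by (rule chernoff_generic[OF E W dep disj q])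
  also have "\<dots> \<le> exp (\<mu> * (\<epsilon> / 2 + (\<epsilon> / 2)\<^sup>2) - \<epsilon> / 2 * ((1 + \<epsilon>) * \<mu>))"
  proof -
    have "exp (\<epsilon> / 2) - 1 \<le> \<epsilon> / 2 + (\<epsilon> / 2)\<^sup>2"
      using exp_bound[of "\<epsilon> / 2"] \<epsilon> by simp
    then have "card W * q * (exp (\<epsilon> / 2) - 1) \<le> \<mu> * (\<epsilon> / 2 + (\<epsilon> / 2)\<^sup>2)"
      using \<mu> q0 \<epsilon> by (intro mult_mono) auto
    then show ?thesis by simp
  qed
  also have "\<mu> * (\<epsilon> / 2 + (\<epsilon> / 2)\<^sup>2) - \<epsilon> / 2 * ((1 + \<epsilon>) * \<mu>) = - \<epsilon>\<^sup>2 * \<mu> / 4"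
    by (simp add: field_simps power2_eq_square)
  finally show ?thesis .
qed

lemma chernoff_lower:
  fixes \<epsilon> q :: real
  assumes E: "finite E" and W: "finite W" and dep: "\<And>w. w \<in> W \<Longrightarrow> depends_on (B w) (Q w)"
    and disj: "disjoint_family_on B W"
    and q: "\<And>w. w \<in> W \<Longrightarrow> measure_pmf.prob (bern E p) {b. Q w b} = q"
    and \<epsilon>: "0 < \<epsilon>"
  shows "measure_pmf.prob (bern E p) {b. card {w\<in>W. Q w b} \<le> (1 - \<epsilon>) * (card W * q)} \<le>
    exp (- \<epsilon>\<^sup>2 * (card W * q) / 2)"
proof -
  let ?\<mu> = "card W * q"
  have q0: "?\<mu> \<ge> 0"
  proof (cases "W = {}")
    case False
    then obtain w where "w \<in> W" by auto
    then have "q \<ge> 0" using q by force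
    then show ?thesis by simp
  qed simp
  \<comment> \<open>With exp(-s) - 1 <= -s + s^2/2 the exponent is the mean times s^2/2 - s
    \<epsilon>, which is least at s = \<epsilon>.\<close>
  have "measure_pmf.prob (bern E p) {b. card {w\<in>W. Q w b} \<le> (1 - \<epsilon>) * ?\<mu>} =
     measure_pmf.prob (bern E p) {b. (- \<epsilon>) * card {w\<in>W. Q w b} \<ge> (- \<epsilon>) * ((1 - \<epsilon>) * ?\<mu>)}"
    using \<epsilon> by (subst mult_le_cancel_left_neg) auto
  also have "\<dots> \<le> exp (?\<mu> * (exp (- \<epsilon>) - 1) - (- \<epsilon>) * ((1 - \<epsilon>) * ?\<mu>))"
    by (rule chernoff_generic[OF E W dep disj q])
  also have "\<dots> \<le> exp (?\<mu> * (- \<epsilon> + \<epsilon>\<^sup>2 / 2) - (- \<epsilon>) * ((1 - \<epsilon>) * ?\<mu>))"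
  proof -
    have "exp (- \<epsilon>) - 1 \<le> - \<epsilon> + \<epsilon>\<^sup>2 / 2"
      using exp_minus_le_quadratic[of \<epsilon>] \<epsilon> by simp
    then have "?\<mu> * (exp (- \<epsilon>) - 1) \<le> ?\<mu> * (- \<epsilon> + \<epsilon>\<^sup>2 / 2)"
      using q0 by (intro mult_left_mono) auto
    then show ?thesis by simp
  qed
  also have "?\<mu> * (- \<epsilon> + \<epsilon>\<^sup>2 / 2) - (- \<epsilon>) * ((1 - \<epsilon>) * ?\<mu>) = - \<epsilon>\<^sup>2 * ?\<mu> / 2"
    by (simp add: field_simps power2_eq_square)
  finally show ?thesis .
qed

subsection \<open>Distances and connectivity\<close>

lemma arcs_sym: "(u, v) \<in> arcs G \<longleftrightarrow> (v, u) \<in> arcs G"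
  by (auto simp: arcs_def insert_commute)

lemma arcs_relpow_sym: "(u, v) \<in> arcs G ^^ l \<Longrightarrow> (v, u) \<in> arcs G ^^ l"
proof (induction l arbitrary: v)
  case (Suc l)
  then obtain w where "(u, w) \<in> arcs G ^^ l" "(w, v) \<in> arcs G" by auto
  then show ?case using Suc.IH arcs_sym relpow_Suc_I2 by metis
qed simp

lemma graph_dist_sym: "graph_dist G u v = graph_dist G v u"
  unfolding graph_dist_def by (rule arg_cong[where f = Inf]) (auto dest: arcs_relpow_sym)

lemma graph_dist_le_iff: "graph_dist G u v \<le> enat l \<longleftrightarrow> (\<exists>l'\<le>l. (u, v) \<in> arcs G ^^ l')"
proof
  assume le: "graph_dist G u v \<le> enat l"
  define A where "A = enat ` {l. (u, v) \<in> arcs G ^^ l}"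
  have Inf: "Inf A \<le> enat l" using le by (simp add: graph_dist_def A_def)
  then have "A \<noteq> {}" by (auto simp: Inf_enat_def)
  then have "Inf A \<in> A" using wellorder_InfI[of _ A] by (metis ex_in_conv)
  then show "\<exists>l'\<le>l. (u, v) \<in> arcs G ^^ l'" using Inf by (auto simp: A_def)
next
  assume "\<exists>l'\<le>l. (u, v) \<in> arcs G ^^ l'"
  then obtain l' where l': "l' \<le> l" "(u, v) \<in> arcs G ^^ l'" by blast
  then have "graph_dist G u v \<le> enat l'"
    unfolding graph_dist_def by (intro INF_lower) auto
  then show "graph_dist G u v \<le> enat l" using l'(1) order_trans enat_ord_simps(1) by blast
qed

text \<open>Built layer by layer, so that sizes can be estimated by induction on the radius;
  \<open>in_dist_ball_iff\<close> is the link to distances.\<close>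

primrec dist_ball :: "'a ugraph \<Rightarrow> 'a set \<Rightarrow> nat \<Rightarrow> 'a set" where
  "dist_ball G A 0 = A"
| "dist_ball G A (Suc j) = dist_ball G A j \<union> arcs G `` dist_ball G A j"

lemma in_dist_ball_iff: "v \<in> dist_ball G A j \<longleftrightarrow> (\<exists>a\<in>A. graph_dist G a v \<le> enat j)"
proof -
  have "v \<in> dist_ball G A j \<longleftrightarrow> (\<exists>a\<in>A. \<exists>l\<le>j. (a, v) \<in> arcs G ^^ l)"
  proof (induction j arbitrary: v)
    case (Suc j)
    have rel: "(\<exists>l\<le>j. (a, v) \<in> arcs G ^^ l) \<or> (\<exists>u. (\<exists>l\<le>j. (a, u) \<in> arcs G ^^ l) \<and> (u, v) \<in> arcs G) \<longleftrightarrow>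
       (\<exists>l\<le>Suc j. (a, v) \<in> arcs G ^^ l)" (is "?L \<longleftrightarrow> ?R") for a
    proof
      assume ?L
      then show ?R
      proof
        assume "\<exists>l\<le>j. (a, v) \<in> arcs G ^^ l"
        then show ?R using le_SucI by blast
      next
        assume "\<exists>u. (\<exists>l\<le>j. (a, u) \<in> arcs G ^^ l) \<and> (u, v) \<in> arcs G"
        then obtain u l where "l \<le> j" "(a, u) \<in> arcs G ^^ l" "(u, v) \<in> arcs G" by blast
        then show ?R by (intro exI[of _ "Suc l"]) auto
      qed
    next
      assume ?R
      then obtain l where l: "l \<le> Suc j" "(a, v) \<in> arcs G ^^ l" by blast
      show ?L
      proof (cases "l \<le> j")
        case False
        then have "(a, v) \<in> arcs G ^^ Suc j" using l by (simp add: le_Suc_eq)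
        then obtain u where "(a, u) \<in> arcs G ^^ j" "(u, v) \<in> arcs G" by auto
        then show ?L by blast
      qed (use l in blast)
    qed
    have "v \<in> dist_ball G A (Suc j) \<longleftrightarrow> v \<in> dist_ball G A j \<or> (\<exists>u\<in>dist_ball G A j. (u, v) \<in> arcs G)"
      by (simp add: Image_iff)
    also have "\<dots> \<longleftrightarrow> (\<exists>a\<in>A. (\<exists>l\<le>j. (a, v) \<in> arcs G ^^ l) \<or>
        (\<exists>u. (\<exists>l\<le>j. (a, u) \<in> arcs G ^^ l) \<and> (u, v) \<in> arcs G))"
      unfolding Suc.IH Bex_def by blast
    finally show ?case unfolding rel .
  qed simp
  then show ?thesis by (simp add: graph_dist_le_iff)
qed

lemma dist_ball_subset: "A \<subseteq> fst G \<Longrightarrow> dist_ball G A j \<subseteq> fst G"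
  by (induction j) (auto simp: arcs_def)

lemma dist_ball_mono_arcs: "arcs H \<subseteq> arcs G \<Longrightarrow> dist_ball H A j \<subseteq> dist_ball G A j"
  by (induction j) auto

lemma dist_ball_incr: "A \<subseteq> dist_ball G A j"
  by (induction j) auto

text \<open>Neither the component \<open>R\<close> of \<open>u\<close> nor its complement has an
  edge leaving it, and one of the two contains at most half of the vertices. Restricting
  \<open>cut\<close> to such sets keeps at least n/2 vertices on the other side in the union
  bound.\<close>

lemma graph_connectedI:
  assumes fin: "finite (fst G)" and ne: "fst G \<noteq> {}"
    and cut: "\<And>A. A \<subseteq> fst G \<Longrightarrow> A \<noteq> {} \<Longrightarrow> 2 * card A \<le> card (fst G) \<Longrightarrow>
      \<exists>a\<in>A. \<exists>w\<in>fst G - A. (a, w) \<in> arcs G"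
  shows "graph_connected G"
  unfolding graph_connected_def
proof (intro conjI ne ballI)
  fix u v assume u: "u \<in> fst G" and v: "v \<in> fst G"
  define R where "R = {v\<in>fst G. (u, v) \<in> (arcs G)\<^sup>*}"
  define C where "C = fst G - R"
  have uR: "u \<in> R" using u by (auto simp: R_def)
  have RV: "R \<subseteq> fst G" by (auto simp: R_def)
  have closed: "w \<in> R" if "a \<in> R" "(a, w) \<in> arcs G" for a w
    using that unfolding R_def by (auto simp: arcs_def intro: rtrancl_into_rtrancl)
  have card: "card R + card C = card (fst G)"
    unfolding C_def using RV fin by (metis card_Diff_subset card_mono finite_subset le_add_diff_inverse)
  have "C = {}"
  proof (rule ccontr)
    assume C: "C \<noteq> {}"
    consider "2 * card R \<le> card (fst G)" | "2 * card C \<le> card (fst G)" using card by linarith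
    then show False
    proof cases
      case 1
      then show False using cut[of R] uR RV closed by blast
    next
      case 2
      then obtain a w where "a \<in> C" "w \<in> fst G - C" "(a, w) \<in> arcs G"
        using cut[of C] C by (auto simp: C_def)
      then show False using closed[of w a] arcs_sym[of a w] by (auto simp: C_def)
    qed
  qed
  then show "(u, v) \<in> (arcs G)\<^sup>*" using v by (auto simp: C_def R_def)
qed

subsection \<open>Evading the cops\<close>

text \<open>A point of a level has a predecessor but perhaps no successor, so a greedy construction
  forwards may get stuck. Walks up to any given time exist, built backwards from the last level;
  since \<open>V\<close> is finite, they yield an infinite one as in Koenig's lemma.\<close>

lemma koenig_walk:
  fixes R :: "nat \<Rightarrow> 'a set" and E :: "'a \<Rightarrow> 'a \<Rightarrow> bool"
  assumes fin: "finite V" and RV: "\<And>t. R t \<subseteq> V" and ne: "\<And>t. R t \<noteq> {}"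
    and pred: "\<And>t y. y \<in> R (Suc t) \<Longrightarrow> \<exists>x\<in>R t. E x y"
  shows "\<exists>w. (\<forall>t. w t \<in> R t) \<and> (\<forall>t. E (w t) (w (Suc t)))"
proof -
  define walk where "walk t T f \<longleftrightarrow> (\<forall>j\<in>{t..T}. f j \<in> R j) \<and> (\<forall>j\<in>{t..<T}. E (f j) (f (Suc j)))"
    for t T :: nat and f :: "nat \<Rightarrow> 'a"
  have ex: "\<exists>f. walk 0 T f \<and> f T = y" if "y \<in> R T" for T y
    using that
  proof (induction T arbitrary: y)
    case 0
    then show ?case by (intro exI[of _ "\<lambda>_. y"]) (auto simp: walk_def)
  next
    case (Suc T)
    then obtain x where x: "x \<in> R T" "E x y" using pred by blast
    then obtain f where f: "walk 0 T f" "f T = x" using Suc.IH by blast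
    then show ?case using x Suc.prems
      by (intro exI[of _ "f(Suc T := y)"]) (auto simp: walk_def less_Suc_eq le_Suc_eq)
  qed
  \<comment> \<open>\<open>P t v\<close> says that walks through \<open>v\<close> at time
    \<open>t\<close> last arbitrarily long; this property, unlike mere membership in
    \<open>R t\<close>, passes to a suitable successor.\<close>
  define P where "P t v \<longleftrightarrow> (\<forall>T. \<exists>T'\<ge>T. \<exists>f. walk t T' f \<and> f t = v)" for t v
  have pigeon: "\<exists>v\<in>V. \<forall>T. \<exists>T'\<ge>T. Q T' v"
    if Q: "\<And>T. \<exists>T'\<ge>T. \<exists>v\<in>V. Q T' v" for Q :: "nat \<Rightarrow> 'a \<Rightarrow> bool"
  proof (rule ccontr)
    assume "\<not> ?thesis"
    then have "\<forall>v\<in>V. \<exists>T. \<forall>T'\<ge>T. \<not> Q T' v" by auto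
    then obtain B where B: "\<And>v T'. v \<in> V \<Longrightarrow> T' \<ge> B v \<Longrightarrow> \<not> Q T' v" by metis
    obtain T' v where T': "T' \<ge> Max (insert 0 (B ` V))" "v \<in> V" "Q T' v" using Q by blast
    have "B v \<le> Max (insert 0 (B ` V))" using fin T'(2) by (intro Max_ge) auto
    then show False using B[of v T'] T' by linarith
  qed
  have P0: "\<exists>v. P 0 v"
  proof -
    have "\<exists>T'\<ge>T. \<exists>v\<in>V. \<exists>f. walk 0 T' f \<and> f 0 = v" for T
    proof -
      obtain y where "y \<in> R T" using ne by blast
      then obtain f where f: "walk 0 T f" using ex by blast
      moreover have "f 0 \<in> R 0" using f by (simp add: walk_def)
      then have "f 0 \<in> V" using RV by blast
      ultimately show ?thesis by blast
    qed
    from pigeon[OF this] show ?thesis unfolding P_def by blast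
  qed
  have step: "\<exists>v'. P (Suc t) v' \<and> E v v'" if "P t v" for t v
  proof -
    have "\<exists>T'\<ge>T. \<exists>v'\<in>V. E v v' \<and> (\<exists>f. walk (Suc t) T' f \<and> f (Suc t) = v')" for T
    proof -
      obtain T' f where T': "T' \<ge> max T (Suc t)" and f: "walk t T' f" "f t = v"
        using \<open>P t v\<close> unfolding P_def by blast
      have "E v (f (Suc t))" using f T' by (auto simp: walk_def)
      moreover have "f (Suc t) \<in> R (Suc t)" using f T' by (simp add: walk_def)
      then have "f (Suc t) \<in> V" using RV by blast
      moreover have "walk (Suc t) T' f" using f by (auto simp: walk_def)
      ultimately show ?thesis using T' by (intro exI[of _ T']) auto
    qed
    from pigeon[OF this] show ?thesis unfolding P_def by blast
  qed
  obtain w where w: "\<And>t. P t (w t)" "\<And>t. E (w t) (w (Suc t))"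
    using dependent_nat_choice[of P "\<lambda>_. E"] P0 step by blast
  have "w t \<in> R t" for t
  proof -
    obtain T' f where "T' \<ge> t" "walk t T' f" "f t = w t" using w(1)[of t] unfolding P_def by blast
    then show ?thesis by (metis walk_def atLeastAtMost_iff order_refl)
  qed
  then show ?thesis using w(2) by blast
qed

text \<open>The observations that the robber will cause are known in advance, because all vertices of
  the next set give the same distances; so the robber's walk can be fixed before the game starts.\<close>

lemma evasion:
  fixes G :: "'a ugraph"
  assumes fin: "finite (fst G)"
    and good: "\<And>R. good R \<Longrightarrow> R \<subseteq> fst G \<and> (\<exists>x\<in>R. \<exists>y\<in>R. x \<noteq> y)"
    and start: "good R0"
    and step: "\<And>R S. good R \<Longrightarrow> S \<subseteq> fst G \<Longrightarrow> card S = k \<Longrightarrow>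
      \<exists>R'. good R' \<and> R' \<subseteq> R \<union> arcs G `` R \<and>
        (\<forall>x\<in>R'. \<forall>y\<in>R'. \<forall>s\<in>S. graph_dist G x s = graph_dist G y s)"
  shows "\<not> cops_can_win G k"
proof
  assume "cops_can_win G k"
  then obtain \<sigma> where \<sigma>: "cop_strategy G k \<sigma>"
    and win: "\<And>\<rho>. robber_strategy G \<rho> \<Longrightarrow> \<exists>t\<ge>1. robber_located G (history G \<sigma> \<rho> t)"
    unfolding cops_can_win_def by blast
  have S: "\<sigma> h \<subseteq> fst G" "card (\<sigma> h) = k" for h
    using \<sigma> by (auto simp: cop_strategy_def)
  obtain nxt where nxt: "\<And>R S. good R \<Longrightarrow> S \<subseteq> fst G \<Longrightarrow> card S = k \<Longrightarrow>
      good (nxt R S) \<and> nxt R S \<subseteq> R \<union> arcs G `` R \<and>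
        (\<forall>x\<in>nxt R S. \<forall>y\<in>nxt R S. \<forall>s\<in>S. graph_dist G x s = graph_dist G y s)"
    using step by metis
  \<comment> \<open>The history is generated without a robber: all candidates give the same
    observation, so \<open>SOME\<close> may pick any of them.\<close>
  define st where "st = rec_nat ([], R0) (\<lambda>_ (h, R).
      (h @ [observe G (\<sigma> h) (SOME x. x \<in> nxt R (\<sigma> h))], nxt R (\<sigma> h)))"
  define h where "h t = fst (st t)" for t
  define R where "R t = snd (st t)" for t
  have R0: "R 0 = R0" and h0: "h 0 = []" by (simp_all add: R_def h_def st_def)
  have RSuc: "R (Suc t) = nxt (R t) (\<sigma> (h t))"
    and hSuc: "h (Suc t) = h t @ [observe G (\<sigma> (h t)) (SOME x. x \<in> nxt (R t) (\<sigma> (h t)))]" for t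
    by (simp_all add: R_def h_def st_def case_prod_unfold)
  have goodR: "good (R t)" for t
  proof (induction t)
    case (Suc t)
    then show ?case using nxt[OF Suc S] unfolding RSuc by blast
  qed (use start R0 in simp)
  have Rne: "R t \<noteq> {}" for t using good[OF goodR[of t]] by auto
  have RV: "R t \<subseteq> fst G" for t using good[OF goodR[of t]] by auto
  have h_eq: "h (Suc t) = h t @ [observe G (\<sigma> (h t)) x]" if "x \<in> R (Suc t)" for t x
  proof -
    have "(SOME x. x \<in> R (Suc t)) \<in> R (Suc t)" using that by (rule someI)
    then have "graph_dist G (SOME x. x \<in> R (Suc t)) s = graph_dist G x s" if "s \<in> \<sigma> (h t)" for s
      using nxt[OF goodR[of t] S, of "h t"] that \<open>x \<in> R (Suc t)\<close> unfolding RSuc by blast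
    then have "observe G (\<sigma> (h t)) (SOME x. x \<in> R (Suc t)) = observe G (\<sigma> (h t)) x"
      unfolding observe_def by (simp cong: restrict_cong)
    then show ?thesis unfolding hSuc RSuc by simp
  qed
  have len: "length (h t) = t" for t by (induction t) (auto simp: h0 hSuc)
  have pred: "\<exists>x\<in>R t. robber_move G x y" if "y \<in> R (Suc t)" for t y
  proof -
    have "y \<in> R t \<union> arcs G `` R t" using that nxt[OF goodR[of t] S] RSuc by blast
    then show ?thesis using RV[of t] by (auto simp: robber_move_def arcs_def)
  qed
  obtain w where w: "\<And>t. w t \<in> R t" "\<And>t. robber_move G (w t) (w (Suc t))"
    using koenig_walk[where V = "fst G" and R = R and E = "robber_move G"] fin RV Rne pred by blast
  \<comment> \<open>At time 0 the list is empty; prefixing \<open>y\<close> gives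
    \<open>last\<close> a meaning there and changes nothing later.\<close>
  have walk: "\<exists>xs. consistent_walk G (h t) xs \<and> last (y # xs) = y \<and> length xs = t" if "y \<in> R t" for t y
    using that
  proof (induction t arbitrary: y)
    case 0
    then show ?case by (auto simp: consistent_walk_def h0 robber_walk_def)
  next
    case (Suc t)
    obtain x where x: "x \<in> R t" "robber_move G x y" using pred Suc.prems by blast
    obtain xs where xs: "consistent_walk G (h t) xs" "last (x # xs) = x" "length xs = t"
      using Suc.IH[OF x(1)] by blast
    have "robber_walk G (xs @ [y])"
      unfolding robber_walk_def
    proof (intro conjI allI impI)
      show "set (xs @ [y]) \<subseteq> fst G"
        using xs(1) x(2) by (auto simp: consistent_walk_def robber_walk_def robber_move_def)
      fix j assume j: "Suc j < length (xs @ [y])"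
      show "robber_move G ((xs @ [y]) ! j) ((xs @ [y]) ! Suc j)"
      proof (cases "Suc j < length xs")
        case True
        then show ?thesis using xs(1) by (auto simp: consistent_walk_def robber_walk_def nth_append)
      next
        case False
        then have j: "j = length xs - 1" "xs \<noteq> []" using j by auto
        then have "xs ! j = x" using xs(2) by (simp add: last_conv_nth)
        then show ?thesis using j x(2) by (simp add: nth_append)
      qed
    qed
    then have "consistent_walk G (h (Suc t)) (xs @ [y])"
      using xs unfolding consistent_walk_def h_eq[OF Suc.prems] by (simp add: len observe_def)
    then show ?case using xs(3) by (intro exI[of _ "xs @ [y]"]) auto
  qed
  \<comment> \<open>This strategy ignores where the sensors are. In round t it stands at
    \<open>w t\<close>; the point \<open>w 0\<close> of \<open>R0\<close> only precedes the game and
    is never occupied in a round.\<close>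
  define \<rho> where "\<rho> Ss = w (length Ss)" for Ss :: "'a set list"
  have "robber_strategy G \<rho>"
    using w RV unfolding robber_strategy_def \<rho>_def by auto
  then obtain t where t: "t \<ge> 1" "robber_located G (history G \<sigma> \<rho> t)" using win by blast
  have "history G \<sigma> \<rho> t = h t" for t
  proof (induction t)
    case (Suc t)
    then show ?case using h_eq[OF w(1)[of "Suc t"]] by (simp add: Let_def \<rho>_def len)
  qed (simp add: h0)
  then have loc: "robber_located G (h t)" using t(2) by simp
  obtain x y where xy: "x \<in> R t" "y \<in> R t" "x \<noteq> y" using good[OF goodR[of t]] by blast
  obtain xs where xs: "consistent_walk G (h t) xs" "last (x # xs) = x" "length xs = t"
    using walk[OF xy(1)] by blast
  obtain ys where ys: "consistent_walk G (h t) ys" "last (y # ys) = y" "length ys = t"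
    using walk[OF xy(2)] by blast
  have "last xs = last ys" using loc xs(1) ys(1) unfolding robber_located_def by blast
  then show False using xs ys xy(3) t(1) by (auto split: if_splits)
qed

text \<open>\<open>cops_can_win\<close> is about exactly k sensors, so every k below the bound is
  excluded and not only the largest.\<close>

lemma le_localization_number:
  assumes "finite (fst G)" and "\<And>k. real k < x \<Longrightarrow> \<not> cops_can_win G k"
  shows "x \<le> real (localization_number G)"
proof -
  have "cops_can_win G (localization_number G)"
    unfolding localization_number_def using cops_can_win_card[OF assms(1)] by (rule LeastI)
  then show ?thesis using assms(2) not_le by blast
qed

subsection \<open>The random graph as a product measure\<close>

text \<open>Events are stated for the coin flips rather than for the graph, so that independence is
  that of coordinates.\<close>

definition graph_of :: "nat \<Rightarrow> (nat set \<Rightarrow> bool) \<Rightarrow> nat ugraph" where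
  "graph_of n b = ({1..n}, {e \<in> vertex_pairs n. b e})"

lemma fst_graph_of [simp]: "fst (graph_of n b) = {1..n}"
  by (simp add: graph_of_def)

lemma finite_vertex_pairs [simp]: "finite (vertex_pairs n)"
  unfolding vertex_pairs_def by (rule finite_subset[of _ "Pow {1..n}"]) auto

lemma pair_in_vertex_pairs: "{u, v} \<in> vertex_pairs n \<longleftrightarrow> u \<in> {1..n} \<and> v \<in> {1..n} \<and> u \<noteq> v"
  by (auto simp: vertex_pairs_def card_insert_if)

lemma arcs_graph_of: "(u, v) \<in> arcs (graph_of n b) \<longleftrightarrow> u \<in> {1..n} \<and> v \<in> {1..n} \<and> u \<noteq> v \<and> b {u, v}"
  by (auto simp: arcs_def graph_of_def pair_in_vertex_pairs)

abbreviation gnp :: "nat \<Rightarrow> real \<Rightarrow> (nat set \<Rightarrow> bool) pmf" where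
  "gnp n p \<equiv> bern (vertex_pairs n) p"

lemma prob_binomial_random_graph:
  "measure_pmf.prob (binomial_random_graph n p) {G. Q G} = measure_pmf.prob (gnp n p) {b. Q (graph_of n b)}"
  by (simp add: binomial_random_graph_def graph_of_def vimage_def)

section \<open>Union bounds over vertex sets\<close>

lemma sum_pow_card:
  fixes x :: real
  assumes "finite V"
  shows "(\<Sum>A\<in>Pow V. x ^ card A) = (1 + x) ^ card V"
  using prod_add[of V "\<lambda>_. x" "\<lambda>_. 1"] assms by (simp add: add.commute)

text \<open>The sum of n^(-3|A|) over nonempty A is (1 + n^(-3))^n - 1, which is about n^(-2).
  Failure probability n^(-3) per element of A is therefore the target of the first moment bounds
  below, and explains the factors 3 in them.\<close>

lemma union_over_sets:
  assumes n: "n \<ge> 1"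
    and Q: "\<And>A. A \<subseteq> {1..n} \<Longrightarrow> A \<noteq> {} \<Longrightarrow>
      measure_pmf.prob M {b. Q A b} \<le> exp (- 3 * real (card A) * ln (real n))"
  shows "measure_pmf.prob M {b. \<exists>A. A \<subseteq> {1..n} \<and> A \<noteq> {} \<and> Q A b} \<le> 1 / real n"
proof (cases "n = 1")
  case False
  then have n2: "real n \<ge> 2" using n by simp
  let ?x = "1 / real n ^ 3" and ?F = "Pow {1..n} - {{}}"
  have "{b. \<exists>A. A \<subseteq> {1..n} \<and> A \<noteq> {} \<and> Q A b} = (\<Union>A\<in>?F. {b. Q A b})" by auto
  then have "measure_pmf.prob M {b. \<exists>A. A \<subseteq> {1..n} \<and> A \<noteq> {} \<and> Q A b} \<le>
      (\<Sum>A\<in>?F. measure_pmf.prob M {b. Q A b})"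
    using measure_pmf.finite_measure_subadditive_finite[of ?F "\<lambda>A. {b. Q A b}" M] by simp
  also have "\<dots> \<le> (\<Sum>A\<in>?F. ?x ^ card A)"
  proof (intro sum_mono)
    fix A assume A: "A \<in> ?F"
    have "exp (- 3 * real (card A) * ln (real n)) = exp (- 3 * ln (real n)) ^ card A"
      by (simp flip: exp_of_nat_mult)
    also have "exp (- 3 * ln (real n)) = ?x"
      using n by (simp add: exp_minus exp_of_nat_mult[of 3 "ln (real n)", simplified] field_simps)
    finally show "measure_pmf.prob M {b. Q A b} \<le> ?x ^ card A"
      using Q[of A] A by auto
  qed
  also have "\<dots> = (1 + ?x) ^ n - 1"
    using sum_pow_card[of "{1..n}" ?x] by (simp add: sum_diff1)
  also have "\<dots> \<le> exp ?x ^ n - 1"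
    by (intro diff_right_mono power_mono exp_ge_add_one_self) auto
  also have "\<dots> = exp (1 / real n ^ 2) - 1"
    using n by (simp flip: exp_of_nat_mult add: power2_eq_square power3_eq_cube)
  also have "\<dots> \<le> 1 / real n ^ 2 + (1 / real n ^ 2)\<^sup>2"
  proof -
    have "1 / real n ^ 2 \<le> 1" using n by simp
    then show ?thesis using exp_bound[of "1 / real n ^ 2"] by simp
  qed
  also have "\<dots> \<le> 1 / real n"
  proof -
    have "1 / real n ^ 2 \<le> 1 / real n * (1 / 2)"
      using n2 by (simp add: power2_eq_square divide_simps)
    moreover have "(1 / real n ^ 2)\<^sup>2 \<le> 1 / real n ^ 2"
      using n mult_left_le[of "1 / real n ^ 2" "1 / real n ^ 2"]
      by (simp add: power2_eq_square[of "1 / real n ^ 2"])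
    ultimately show ?thesis by simp
  qed
  finally show ?thesis .
qed simp

lemma union_over_sets_card:
  assumes n: "n \<ge> 1" and m: "m \<ge> 1"
    and Q: "\<And>A. A \<subseteq> {1..n} \<Longrightarrow> card A = m \<Longrightarrow>
      measure_pmf.prob M {b. Q A b} \<le> exp (- 3 * real m * ln (real n))"
  shows "measure_pmf.prob M {b. \<exists>A\<subseteq>{1..n}. card A = m \<and> Q A b} \<le> 1 / real n"
proof -
  have "measure_pmf.prob M {b. \<exists>A\<subseteq>{1..n}. card A = m \<and> Q A b} \<le>
     measure_pmf.prob M {b. \<exists>A. A \<subseteq> {1..n} \<and> A \<noteq> {} \<and> (card A = m \<and> Q A b)}"
  proof (rule prob_mono)
    fix b assume "\<exists>A\<subseteq>{1..n}. card A = m \<and> Q A b"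
    then obtain A where "A \<subseteq> {1..n}" "card A = m" "Q A b" by blast
    moreover from this have "A \<noteq> {}" using m by force
    ultimately show "\<exists>A. A \<subseteq> {1..n} \<and> A \<noteq> {} \<and> (card A = m \<and> Q A b)" by blast
  qed
  also have "\<dots> \<le> 1 / real n"
  proof (rule union_over_sets[OF n])
    fix A assume "A \<subseteq> {1..n}" "A \<noteq> {}"
    then show "measure_pmf.prob M {b. card A = m \<and> Q A b} \<le> exp (- 3 * real (card A) * ln (real n))"
      using Q[of A] by (cases "card A = m") simp_all
  qed
  finally show ?thesis .
qed

text \<open>The coins that decide which neighbours \<open>w\<close> has in \<open>A\<close>. For
  different \<open>w\<close> outside \<open>A\<close> they are disjoint, so they serve as the blocks
  \<open>B\<close> in the independence lemmas.\<close>

definition star :: "nat set \<Rightarrow> nat \<Rightarrow> nat set set" where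
  "star A w = (\<lambda>a. {a, w}) ` A"

lemma card_star: "w \<notin> A \<Longrightarrow> card (star A w) = card A"
  unfolding star_def by (rule card_image) (auto simp: inj_on_def doubleton_eq_iff)

lemma disjoint_star: "A \<inter> W = {} \<Longrightarrow> disjoint_family_on (star A) W"
  by (auto simp: disjoint_family_on_def star_def doubleton_eq_iff)

lemma star_subset: "A \<subseteq> {1..n} \<Longrightarrow> w \<in> {1..n} \<Longrightarrow> w \<notin> A \<Longrightarrow> star A w \<subseteq> vertex_pairs n"
  unfolding star_def by (auto simp: pair_in_vertex_pairs)

lemma prob_no_edge_to:
  assumes "A \<subseteq> {1..n}" "w \<in> {1..n}" "w \<notin> A" "0 \<le> p" "p \<le> 1"
  shows "measure_pmf.prob (gnp n p) {b. \<forall>a\<in>A. \<not> b {a, w}} = (1 - p) ^ card A"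
  using prob_bern_pattern[of "vertex_pairs n" "{}" "star A w" p] star_subset[of A n w] card_star[of w A] assms
  by (simp add: star_def)

lemma depends_on_no_edge_to: "depends_on (star A w) (\<lambda>b. \<forall>a\<in>A. \<not> b {a, w})"
  by (rule depends_onI) (auto simp: star_def)

lemma nbhd_graph_of_iff:
  assumes "A \<subseteq> {1..n}" "w \<in> {1..n}" "w \<notin> A"
  shows "w \<in> arcs (graph_of n b) `` A \<longleftrightarrow> (\<exists>a\<in>A. b {a, w})"
  using assms unfolding Image_iff arcs_graph_of by blast

lemma nbhd_subset: "arcs (graph_of n b) `` A \<subseteq> {1..n}"
  unfolding Image_def by (auto simp: arcs_graph_of)

lemma outer_nbhd_eq:
  assumes "A \<subseteq> {1..n}"
  shows "arcs (graph_of n b) `` A - A = {w \<in> {1..n} - A. \<not> (\<forall>a\<in>A. \<not> b {a, w})}"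
  using nbhd_graph_of_iff[OF assms] nbhd_subset[of n b A] by blast

lemma non_nbhd_eq:
  assumes "A \<subseteq> {1..n}"
  shows "{1..n} - A - arcs (graph_of n b) `` A = {w \<in> {1..n} - A. \<forall>a\<in>A. \<not> b {a, w}}"
  using nbhd_graph_of_iff[OF assms] by blast

subsection \<open>Typical properties of the random graph\<close>

text \<open>A set A of at most n/2 vertices has at least |A| n/2 pairs leaving it, so it is isolated
  with probability at most exp(-pn|A|/2); the 6 is twice the 3 of
  \<open>union_over_sets\<close>.\<close>

lemma prob_disconnected:
  assumes n: "n \<ge> 1" and p: "0 \<le> p" "p \<le> 1" and d: "p * n \<ge> 6 * ln n"
  shows "measure_pmf.prob (gnp n p) {b. \<not> graph_connected (graph_of n b)} \<le> 1 / n"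
proof -
  let ?Q = "\<lambda>A b. 2 * card A \<le> n \<and> (\<forall>e\<in>(\<lambda>(a, w). {a, w}) ` (A \<times> ({1..n} - A)). \<not> b e)"
  have "measure_pmf.prob (gnp n p) {b. \<not> graph_connected (graph_of n b)} \<le>
     measure_pmf.prob (gnp n p) {b. \<exists>A. A \<subseteq> {1..n} \<and> A \<noteq> {} \<and> ?Q A b}"
  proof (rule prob_mono, rule ccontr)
    fix b assume b: "\<not> graph_connected (graph_of n b)"
      and no: "\<not> (\<exists>A. A \<subseteq> {1..n} \<and> A \<noteq> {} \<and> ?Q A b)"
    have "graph_connected (graph_of n b)"
    proof (rule graph_connectedI)
      fix A assume A: "A \<subseteq> fst (graph_of n b)" "A \<noteq> {}" "2 * card A \<le> card (fst (graph_of n b))"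
      have "\<not> ?Q A b" using no A(1,2) unfolding fst_graph_of by blast
      moreover have "2 * card A \<le> n" using A(3) by simp
      ultimately obtain e where "e \<in> (\<lambda>(a, w). {a, w}) ` (A \<times> ({1..n} - A))" "b e" by blast
      then obtain a w where "a \<in> A" "w \<in> {1..n} - A" "b {a, w}" by auto
      then show "\<exists>a\<in>A. \<exists>w\<in>fst (graph_of n b) - A. (a, w) \<in> arcs (graph_of n b)"
        using A(1) by (intro bexI[of _ a] bexI[of _ w]) (auto simp: arcs_graph_of)
    qed (use n in auto)
    then show False using b by blast
  qed
  also have "\<dots> \<le> 1 / n"
  proof (rule union_over_sets[OF n])
    fix A assume A: "A \<subseteq> {1..n}" "A \<noteq> {}"
    have finA: "finite A" using A finite_subset by blast
    show "measure_pmf.prob (gnp n p) {b. ?Q A b} \<le> exp (- 3 * real (card A) * ln n)"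
    proof (cases "2 * card A \<le> n")
      case True
      let ?F = "(\<lambda>(a, w). {a, w}) ` (A \<times> ({1..n} - A))"
      have "card ?F = card (A \<times> ({1..n} - A))"
        by (rule card_image) (auto simp: inj_on_def doubleton_eq_iff)
      also have "\<dots> = card A * (n - card A)"
        using A finA by (simp add: card_cartesian_product card_Diff_subset)
      finally have cF: "card ?F = card A * (n - card A)" .
      have "?F \<subseteq> vertex_pairs n" using A by (auto simp: pair_in_vertex_pairs)
      then have "measure_pmf.prob (gnp n p) {b. ?Q A b} = (1 - p) ^ (card A * (n - card A))"
        using prob_bern_pattern[of "vertex_pairs n" "{}" ?F p] p True cF by simp
      also have "\<dots> \<le> exp (- p) ^ (card A * (n - card A))"
        using p exp_ge_add_one_self[of "- p"] by (intro power_mono) auto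
      also have "\<dots> = exp (- (card A * (p * (real n - card A))))"
        using True by (simp flip: exp_of_nat_mult add: of_nat_diff mult_ac)
      also have "\<dots> \<le> exp (- (card A * (3 * ln n)))"
      proof -
        have "p * (real n - card A) \<ge> p * (n / 2)"
          using True p by (intro mult_left_mono) auto
        then have "p * (real n - card A) \<ge> 3 * ln n" using d by simp
        then show ?thesis by (simp add: mult_left_mono)
      qed
      finally show ?thesis by (simp add: mult_ac)
    qed simp
  qed
  finally show ?thesis .
qed

text \<open>Vertices are treated as singletons to reuse \<open>union_over_sets\<close>; 12 is 3
  times the 4 in the exponent of \<open>chernoff_upper\<close>.\<close>

lemma prob_large_degree:
  fixes \<epsilon> p :: real
  assumes n: "n \<ge> 1" and p: "0 \<le> p" "p \<le> 1" and \<epsilon>: "0 < \<epsilon>" "\<epsilon> \<le> 1"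
    and d: "\<epsilon>\<^sup>2 * (p * n) \<ge> 12 * ln n"
  shows "measure_pmf.prob (gnp n p) {b. \<exists>v\<in>{1..n}. card (arcs (graph_of n b) `` {v}) \<ge> (1 + \<epsilon>) * (p * n)} \<le> 1 / n"
proof -
  let ?Q = "\<lambda>A b. \<exists>v. A = {v} \<and> card (arcs (graph_of n b) `` {v}) \<ge> (1 + \<epsilon>) * (p * n)"
  have "measure_pmf.prob (gnp n p) {b. \<exists>v\<in>{1..n}. card (arcs (graph_of n b) `` {v}) \<ge> (1 + \<epsilon>) * (p * n)} \<le>
     measure_pmf.prob (gnp n p) {b. \<exists>A. A \<subseteq> {1..n} \<and> A \<noteq> {} \<and> ?Q A b}"
    by (rule prob_mono) blast
  also have "\<dots> \<le> 1 / n"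
  proof (rule union_over_sets[OF n])
    fix A assume A: "A \<subseteq> {1..n}" "A \<noteq> {}"
    show "measure_pmf.prob (gnp n p) {b. ?Q A b} \<le> exp (- 3 * real (card A) * ln n)"
    proof (cases "\<exists>v. A = {v}")
      case True
      then obtain v where v: "A = {v}" by blast
      have "arcs (graph_of n b) `` {v} = {w \<in> {1..n} - {v}. b {v, w}}" for b
        using A v by (auto simp: arcs_graph_of)
      then have "measure_pmf.prob (gnp n p) {b. ?Q A b} =
         measure_pmf.prob (gnp n p) {b. card {w \<in> {1..n} - {v}. b {v, w}} \<ge> (1 + \<epsilon>) * (p * n)}"
        using v by simp
      also have "\<dots> \<le> exp (- \<epsilon>\<^sup>2 * (p * n) / 4)"
      proof (rule chernoff_upper[where B = "star {v}" and q = p])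
        show "depends_on (star {v} w) (\<lambda>b. b {v, w})" for w
          by (rule depends_onI) (auto simp: star_def)
        show "disjoint_family_on (star {v}) ({1..n} - {v})" by (rule disjoint_star) auto
        show "measure_pmf.prob (gnp n p) {b. b {v, w}} = p" if "w \<in> {1..n} - {v}" for w
          using prob_bern_pattern[of "vertex_pairs n" "{{v, w}}" "{}" p] p that A v
          by (simp add: pair_in_vertex_pairs)
        show "real (card ({1..n} - {v})) * p \<le> p * n"
        proof -
          have "real (card ({1..n} - {v})) \<le> n" using card_mono[of "{1..n}" "{1..n} - {v}"] by simp
          then show ?thesis unfolding mult.commute[of p] using p(1) by (rule mult_right_mono)
        qed
      qed (use \<epsilon> in auto)
      also have "\<dots> \<le> exp (- 3 * real (card A) * ln n)" using d v by simp
      finally show ?thesis .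
    qed simp
  qed
  finally show ?thesis .
qed

text \<open>The mean number of uncovered vertices is at least 100 (n/d) L^2. The lower tail with t =
  -1 gives exponent at most (-50 + 20)(n/d) L^2, while the union bound requires only 3 m L <= 6
  (n/d) L^2.\<close>

lemma prob_few_uncovered:
  fixes p d L :: real and m :: nat
  assumes n: "n \<ge> 1" and p: "0 \<le> p" "p \<le> 1" and d: "d > 0"
    and L: "L = ln n" and m: "m \<le> 2 * (n / d) * L" "2 * m \<le> n" and q: "(1 - p) ^ m \<ge> 200 * L\<^sup>2 / d"
    and m1: "m \<ge> 1"
  shows "measure_pmf.prob (gnp n p) {b. \<exists>A\<subseteq>{1..n}. card A = m \<and>
      card ({1..n} - A - arcs (graph_of n b) `` A) \<le> 20 * (n / d) * L\<^sup>2} \<le> 1 / n"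
proof (rule union_over_sets_card[OF n m1])
  fix A assume A: "A \<subseteq> {1..n}" and True: "card A = m"
  let ?Q = "\<lambda>b. card ({1..n} - A - arcs (graph_of n b) `` A) \<le> 20 * (n / d) * L\<^sup>2"
  let ?W = "{1..n} - A" and ?q = "(1 - p) ^ m" and ?x = "20 * (n / d) * L\<^sup>2"
  have cW: "card ?W = n - m" using A True by (simp add: card_Diff_subset finite_subset)
  have "measure_pmf.prob (gnp n p) {b. ?Q b} =
     measure_pmf.prob (gnp n p) {b. (- 1) * real (card {w \<in> ?W. \<forall>a\<in>A. \<not> b {a, w}}) \<ge> (- 1) * ?x}"
    using True unfolding non_nbhd_eq[OF A] by simp
  also have "\<dots> \<le> exp (card ?W * ?q * (exp (- 1) - 1) - (- 1) * ?x)"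
  proof (rule chernoff_generic[where B = "star A"])
    show "disjoint_family_on (star A) ?W" by (rule disjoint_star) auto
    show "measure_pmf.prob (gnp n p) {b. \<forall>a\<in>A. \<not> b {a, w}} = ?q" if "w \<in> ?W" for w
      using prob_no_edge_to[of A n w p] that A p True by simp
  qed (auto intro: depends_on_no_edge_to)
  also have "\<dots> \<le> exp (- 3 * real m * ln n)"
  proof -
    have e: "exp (- 1) - 1 \<le> (- 1 / 2 :: real)" using exp_minus_le_quadratic[of 1] by simp
    have "real (card ?W) \<ge> n / 2" using cW m(2) by (simp add: of_nat_diff)
    moreover have q0: "0 \<le> ?q" using p by simp
    ultimately have "card ?W * ?q \<ge> n / 2 * (200 * L\<^sup>2 / d)"
      using q n d by (intro mult_mono) auto
    then have "card ?W * ?q * (exp (- 1) - 1) \<le> card ?W * ?q * (- 1 / 2)"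
      using e q0 by (intro mult_left_mono) auto
    then have 1: "card ?W * ?q * (exp (- 1) - 1) \<le> - (50 * (n / d * L\<^sup>2))"
      using \<open>card ?W * ?q \<ge> n / 2 * (200 * L\<^sup>2 / d)\<close> by simp
    have "m * L \<le> 2 * (n / d) * L * L"
      using m(1) L n by (intro mult_right_mono) auto
    then have "m * L \<le> 2 * (n / d * L\<^sup>2)" by (simp add: power2_eq_square)
    then have "card ?W * ?q * (exp (- 1) - 1) - (- 1) * ?x \<le> - 3 * (m * L)"
    proof -
      have "?x = 20 * (n / d * L\<^sup>2)" by (simp only: mult.assoc)
      moreover have "n / d * L\<^sup>2 \<ge> 0" using d by simp
      ultimately show ?thesis using 1 \<open>m * L \<le> 2 * (n / d * L\<^sup>2)\<close> by linarith
    qed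
    then show ?thesis using True L by (simp add: mult_ac)
  qed
  finally show "measure_pmf.prob (gnp n p) {b. ?Q b} \<le> exp (- 3 * real m * ln n)" .
qed

text \<open>Counting the vertices not joined to A turns a statement about pairs of sets into a union
  over A alone.\<close>

lemma prob_large_empty_pair:
  fixes p :: real and r :: nat
  assumes n: "n \<ge> 1" and p: "0 \<le> p" "p \<le> 1" and L: "ln n \<ge> 1" and r: "p * r \<ge> 6 * ln n"
  shows "measure_pmf.prob (gnp n p) {b. \<exists>A\<subseteq>{1..n}. card A = r \<and>
      card ({1..n} - A - arcs (graph_of n b) `` A) \<ge> r} \<le> 1 / n"
proof -
  have r1: "r \<ge> 1" using r L by (cases "r = 0") auto
  show ?thesis
  proof (rule union_over_sets_card[OF n r1])
    fix A assume A: "A \<subseteq> {1..n}" and True: "card A = r"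
    let ?Q = "\<lambda>b. card ({1..n} - A - arcs (graph_of n b) `` A) \<ge> r"
    \<comment> \<open>A vertex misses A with probability at most n^(-6). The weight t = 4 ln n
      leaves the exponential moment harmless, as n * n^(-6) * n^4 = 1/n, and still exceeds the
      required 3 ln n per element.\<close>
    let ?W = "{1..n} - A" and ?q = "(1 - p) ^ r" and ?t = "4 * ln n"
    have "measure_pmf.prob (gnp n p) {b. ?Q b} =
       measure_pmf.prob (gnp n p) {b. ?t * card {w \<in> ?W. \<forall>a\<in>A. \<not> b {a, w}} \<ge> ?t * r}"
      using True L unfolding non_nbhd_eq[OF A] by simp
    also have "\<dots> \<le> exp (card ?W * ?q * (exp ?t - 1) - ?t * r)"
    proof (rule chernoff_generic[where B = "star A"])
      show "disjoint_family_on (star A) ?W" by (rule disjoint_star) auto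
      show "measure_pmf.prob (gnp n p) {b. \<forall>a\<in>A. \<not> b {a, w}} = ?q" if "w \<in> ?W" for w
        using prob_no_edge_to[of A n w p] that A p True by simp
    qed (auto intro: depends_on_no_edge_to)
    also have "\<dots> \<le> exp (- 3 * real r * ln n)"
    proof -
      have "?q \<le> exp (- p) ^ r"
        using p exp_ge_add_one_self[of "- p"] by (intro power_mono) auto
      also have "\<dots> \<le> exp (- 6 * ln n)"
        using r by (simp flip: exp_of_nat_mult add: mult.commute)
      finally have q: "?q \<le> exp (- 6 * ln n)" .
      have "real (card ?W) \<le> n" using card_mono[of "{1..n}" ?W] by simp
      also have "real n = exp (ln n)" using n by simp
      finally have W: "real (card ?W) \<le> exp (ln n)" .
      have "card ?W * ?q * (exp ?t - 1) \<le> exp (ln n) * exp (- 6 * ln n) * exp ?t"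
        using q W p L by (intro mult_mono) auto
      also have "\<dots> = exp (- ln n)" by (simp flip: exp_add)
      also have "\<dots> \<le> ln n * r"
      proof -
        have "exp (- ln n) \<le> 1" using L by simp
        also have "1 \<le> ln n * r" using L r1 by (simp add: mult_ge1_I)
        finally show ?thesis .
      qed
      finally show ?thesis using True by (simp add: mult.commute[of "real r"])
    qed
    finally show "measure_pmf.prob (gnp n p) {b. ?Q b} \<le> exp (- 3 * real r * ln n)" .
  qed
qed

text \<open>The 14 is 10 + 1 + 3: at most 10/L is lost to overlapping neighbourhoods, as |A| p <=
  20/L; 1/L to the vertices of A itself; and 3/L is the deviation \<epsilon>. With d >= L^3 the tail
  exponent \<epsilon>^2 |A| d / 2 is about (9/2) |A| L, enough for the required 3 |A| L.\<close>

lemma prob_not_expanding: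
  fixes p d L a0 :: real
  assumes n: "n \<ge> 1" and p: "0 \<le> p" "p \<le> 1" and d: "d = p * n" and L: "L = ln n" "L \<ge> 40"
    and dL: "d \<ge> L ^ 3" and a0: "a0 * p \<le> 20 / L"
  shows "measure_pmf.prob (gnp n p) {b. \<exists>A. A \<subseteq> {1..n} \<and> A \<noteq> {} \<and> card A \<le> a0 \<and>
      card (arcs (graph_of n b) `` A - A) < card A * (d * (1 - 14 / L))} \<le> 1 / n"
proof (rule union_over_sets[OF n])
  fix A assume A: "A \<subseteq> {1..n}" "A \<noteq> {}"
  let ?a = "real (card A)"
  let ?Q = "\<lambda>b. ?a \<le> a0 \<and> card (arcs (graph_of n b) `` A - A) < ?a * (d * (1 - 14 / L))"
  show "measure_pmf.prob (gnp n p) {b. ?Q b} \<le> exp (- 3 * real (card A) * ln n)"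
  proof (cases "?a \<le> a0")
    case True
    let ?W = "{1..n} - A" and ?q = "1 - (1 - p) ^ card A" and ?\<epsilon> = "3 / L"
    have fin: "finite A" using A finite_subset by blast
    have a1: "?a \<ge> 1" using A fin by (simp add: Suc_leI card_gt_0_iff)
    have n0: "real n > 0" using n by simp
    have L0: "L > 0" using L by simp
    have d0: "d > 0" using dL zero_less_power[OF L0, of 3] by linarith
    have p0: "p > 0" using d0 d n0 p by (cases "p = 0") auto
    have ap: "?a * p \<le> 20 / L" using True a0 p by (meson mult_right_mono order_trans)
    have "(1 - p) ^ card A \<le> exp (- p) ^ card A"
      using p exp_ge_add_one_self[of "- p"] by (intro power_mono) auto
    also have "\<dots> = exp (- (?a * p))" by (simp flip: exp_of_nat_mult)
    also have "\<dots> \<le> 1 - ?a * p + (?a * p)\<^sup>2 / 2"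
      using p by (intro exp_minus_le_quadratic) auto
    finally have "?q \<ge> ?a * p * (1 - ?a * p / 2)" by (simp add: power2_eq_square algebra_simps)
    also have "?a * p * (1 - ?a * p / 2) \<ge> ?a * p * (1 - 10 / L)"
      using ap p by (intro mult_left_mono) auto
    finally have q: "?q \<ge> ?a * p * (1 - 10 / L)" .
    have "?a \<le> n / L"
    proof -
      have "L\<^sup>2 * 20 \<le> L\<^sup>2 * L" using L by (intro mult_left_mono) auto
      then have "20 * L\<^sup>2 \<le> d" using dL by (simp add: power2_eq_square power3_eq_cube)
      have "?a * d \<le> 20 * n / L" using mult_right_mono[OF ap, of n] d by (simp add: mult_ac)
      then have "?a * (20 * L\<^sup>2) \<le> 20 * n / L"
        using mult_left_mono[OF \<open>20 * L\<^sup>2 \<le> d\<close>, of ?a] by simp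
      then have "?a * L\<^sup>2 \<le> n / L" by simp
      moreover have "?a * 1 \<le> ?a * L\<^sup>2" using L by (intro mult_left_mono) auto
      ultimately show ?thesis by simp
    qed
    then have W: "real (card ?W) \<ge> n * (1 - 1 / L)"
      using A fin card_mono[OF _ A(1)] by (simp add: card_Diff_subset of_nat_diff algebra_simps)
    have t10: "0 \<le> 1 - 10 / L" "0 \<le> 1 - 1 / L" using L by auto
    have "card ?W * ?q \<ge> n * (1 - 1 / L) * (?a * p * (1 - 10 / L))"
      using W q t10 p by (intro mult_mono) auto
    also have "n * (1 - 1 / L) * (?a * p * (1 - 10 / L)) = ?a * d * ((1 - 1 / L) * (1 - 10 / L))"
      by (simp add: d mult_ac)
    also have "\<dots> \<ge> ?a * d * (1 - 11 / L)"
      using L0 d0 by (intro mult_left_mono) (auto simp: field_simps)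
    finally have \<mu>: "card ?W * ?q \<ge> ?a * d * (1 - 11 / L)" .
    have Q_imp: "card {w \<in> ?W. \<not> (\<forall>a\<in>A. \<not> b {a, w})} \<le> (1 - ?\<epsilon>) * (card ?W * ?q)" if "?Q b" for b
    proof -
      have "card {w \<in> ?W. \<not> (\<forall>a\<in>A. \<not> b {a, w})} \<le> ?a * d * (1 - 14 / L)"
        using that unfolding outer_nbhd_eq[OF A(1)] by (simp add: mult_ac)
      also have "\<dots> \<le> ?a * d * ((1 - 3 / L) * (1 - 11 / L))"
        using L0 d0 by (intro mult_left_mono) (auto simp: field_simps)
      also have "\<dots> = (1 - ?\<epsilon>) * (?a * d * (1 - 11 / L))" by simp
      also have "\<dots> \<le> (1 - ?\<epsilon>) * (card ?W * ?q)"
        using \<mu> L by (intro mult_left_mono) auto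
      finally show ?thesis .
    qed
    have "measure_pmf.prob (gnp n p) {b. ?Q b} \<le>
       measure_pmf.prob (gnp n p) {b. card {w \<in> ?W. \<not> (\<forall>a\<in>A. \<not> b {a, w})} \<le> (1 - ?\<epsilon>) * (card ?W * ?q)}"
      by (rule prob_mono) (rule Q_imp)
    also have "\<dots> \<le> exp (- ?\<epsilon>\<^sup>2 * (card ?W * ?q) / 2)"
    proof (rule chernoff_lower[where B = "star A"])
      show "disjoint_family_on (star A) ?W" by (rule disjoint_star) auto
      show "depends_on (star A w) (\<lambda>b. \<not> (\<forall>a\<in>A. \<not> b {a, w}))" for w
        by (rule depends_onI) (auto simp: star_def)
      show "measure_pmf.prob (gnp n p) {b. \<not> (\<forall>a\<in>A. \<not> b {a, w})} = ?q" if "w \<in> ?W" for w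
        unfolding prob_not using prob_no_edge_to[of A n w p] that A p by simp
    qed (use L in auto)
    also have "\<dots> \<le> exp (- 3 * real (card A) * ln n)"
    proof -
      have "3 * ?a * L \<le> ?\<epsilon>\<^sup>2 / 2 * (?a * L ^ 3 * (1 - 11 / L))"
      proof -
        have "?\<epsilon>\<^sup>2 / 2 * (?a * L ^ 3 * (1 - 11 / L)) = ?a * (9 / 2 * (L - 11))"
          using L0 by (simp add: field_simps power2_eq_square power3_eq_cube)
        also have "\<dots> \<ge> ?a * (3 * L)" using L by (intro mult_left_mono) auto
        finally show ?thesis by (simp add: mult_ac)
      qed
      also have "\<dots> \<le> ?\<epsilon>\<^sup>2 / 2 * (card ?W * ?q)"
      proof (intro mult_left_mono)
        have "?a * L ^ 3 * (1 - 11 / L) \<le> ?a * d * (1 - 11 / L)"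
          using dL L by (intro mult_right_mono mult_left_mono) auto
        then show "?a * L ^ 3 * (1 - 11 / L) \<le> card ?W * ?q" using \<mu> by simp
      qed auto
      finally show ?thesis using L by (simp add: mult_ac)
    qed
    finally show ?thesis .
  qed simp
qed

subsection \<open>Distant pairs\<close>

text \<open>\<open>y\<close> becomes isolated but stays a vertex, so the vertex set remains {1..n}.
  The resulting graph is a function of the coins at pairs avoiding \<open>y\<close>.\<close>

definition remove_vertex :: "nat \<Rightarrow> (nat set \<Rightarrow> bool) \<Rightarrow> nat set \<Rightarrow> bool" where
  "remove_vertex y b = (\<lambda>e. b e \<and> y \<notin> e)"

lemma dist_ball_remove_vertex:
  assumes "x \<in> {1..n}" "x \<noteq> y"
  shows "dist_ball (graph_of n (remove_vertex y b)) {x} i \<subseteq> {1..n} - {y}"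
  using assms by (induction i) (auto simp: arcs_graph_of remove_vertex_def)

text \<open>Keeping the coins at pairs avoiding \<open>y\<close> turns the ball into a fixed set
  \<open>Z\<close>, while the coins between \<open>Z\<close> and \<open>y\<close> are still fresh.
  The size of the ball is random, so the threshold \<beta> is part of the event.\<close>

lemma prob_ball_avoids:
  fixes \<beta> p :: real
  assumes p: "0 \<le> p" "p \<le> 1" and xy: "x \<in> {1..n}" "y \<in> {1..n}" "x \<noteq> y"
  shows "measure_pmf.prob (gnp n p)
    {b. \<beta> \<le> card (dist_ball (graph_of n (remove_vertex y b)) {x} i) \<and>
        (\<forall>z\<in>dist_ball (graph_of n (remove_vertex y b)) {x} i. \<not> b {z, y})} \<le> exp (- (p * \<beta>))"
proof (rule prob_resample_le[where F = "{e. y \<notin> e}"])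
  fix b :: "nat set \<Rightarrow> bool"
  let ?m = "\<lambda>b' e. if e \<in> {e. y \<notin> e} then b e else b' e"
  define Z where "Z = dist_ball (graph_of n (remove_vertex y b)) {x} i"
  have Z: "Z \<subseteq> {1..n}" "y \<notin> Z" using dist_ball_remove_vertex[OF xy(1,3)] by (auto simp: Z_def)
  have "remove_vertex y (?m b') = remove_vertex y b" for b'
    by (auto simp: remove_vertex_def)
  then have "measure_pmf.prob (gnp n p) {b'. \<beta> \<le> card (dist_ball (graph_of n (remove_vertex y (?m b'))) {x} i) \<and>
        (\<forall>z\<in>dist_ball (graph_of n (remove_vertex y (?m b'))) {x} i. \<not> ?m b' {z, y})} =
     measure_pmf.prob (gnp n p) {b'. \<beta> \<le> card Z \<and> (\<forall>z\<in>Z. \<not> b' {z, y})}"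
    by (simp add: Z_def)
  also have "\<dots> \<le> exp (- (p * \<beta>))"
  proof (cases "\<beta> \<le> card Z")
    case True
    then have "measure_pmf.prob (gnp n p) {b'. \<beta> \<le> card Z \<and> (\<forall>z\<in>Z. \<not> b' {z, y})} = (1 - p) ^ card Z"
      using prob_no_edge_to[of Z n y p] Z xy p by simp
    also have "\<dots> \<le> exp (- p) ^ card Z"
      using p exp_ge_add_one_self[of "- p"] by (intro power_mono) auto
    also have "\<dots> = exp (- (p * card Z))" by (simp flip: exp_of_nat_mult add: mult.commute)
    also have "\<dots> \<le> exp (- (p * \<beta>))" using True p by (simp add: mult_left_mono)
    finally show ?thesis .
  qed simp
  finally show "measure_pmf.prob (gnp n p) {b'. \<beta> \<le> card (dist_ball (graph_of n (remove_vertex y (?m b'))) {x} i) \<and>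
        (\<forall>z\<in>dist_ball (graph_of n (remove_vertex y (?m b'))) {x} i. \<not> ?m b' {z, y})} \<le> exp (- (p * \<beta>))" .
qed simp

definition expanding :: "nat \<Rightarrow> nat \<Rightarrow> real \<Rightarrow> (nat set \<Rightarrow> bool) \<Rightarrow> bool" where
  "expanding n k c b \<longleftrightarrow> (\<forall>A. A \<subseteq> {1..n} \<and> A \<noteq> {} \<and> card A \<le> k \<longrightarrow>
    real (card A) * c \<le> real (card (arcs (graph_of n b) `` A - A)))"

text \<open>Losing the vertex \<open>y\<close> is compensated by counting \<open>B\<close> itself.\<close>

lemma expanding_remove_vertex:
  fixes c :: real
  assumes exp: "expanding n k c b" and B: "B \<subseteq> {1..n} - {y}" "B \<noteq> {}" and k: "k \<ge> 1"
  shows "c * min (card B) k \<le> card (B \<union> arcs (graph_of n (remove_vertex y b)) `` B)"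
proof -
  let ?H = "graph_of n (remove_vertex y b)" and ?G = "graph_of n b"
  have finB: "finite B" using B(1) finite_subset by blast
  then obtain A where A: "A \<subseteq> B" "card A = min (card B) k"
    by (meson min.cobounded1 obtain_subset_with_card_n)
  have finA: "finite A" using A(1) finB finite_subset by blast
  have cA: "card A \<ge> 1" using A(2) B(2) finB k by (simp add: Suc_le_eq card_gt_0_iff)
  let ?N = "arcs ?G `` A - A"
  have finN: "finite ?N" using nbhd_subset[of n b A] finite_subset by blast
  have sub: "A \<union> (?N - {y}) \<subseteq> B \<union> arcs ?H `` B"
  proof
    fix w assume "w \<in> A \<union> (?N - {y})"
    then consider "w \<in> A" | a where "a \<in> A" "(a, w) \<in> arcs ?G" "w \<noteq> y" by blast
    then show "w \<in> B \<union> arcs ?H `` B"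
    proof cases
      case 2
      then have "(a, w) \<in> arcs ?H" using A(1) B(1) by (auto simp: arcs_graph_of remove_vertex_def)
      then show ?thesis using 2 A(1) by blast
    qed (use A in blast)
  qed
  have fin: "finite (B \<union> arcs ?H `` B)"
    using finB nbhd_subset[of n "remove_vertex y b" B] finite_subset by blast
  have "card ?N \<le> card (insert y (?N - {y}))" using finN by (intro card_mono) auto
  also have "\<dots> = Suc (card (?N - {y}))" using finN by (intro card_insert_disjoint) auto
  also have "\<dots> \<le> card A + card (?N - {y})" using cA by simp
  also have "\<dots> = card (A \<union> (?N - {y}))" using finA finN by (subst card_Un_disjoint) auto
  also have "\<dots> \<le> card (B \<union> arcs ?H `` B)" using sub fin by (rule card_mono[rotated])
  finally have "card ?N \<le> card (B \<union> arcs ?H `` B)" .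
  moreover have "real (card A) * c \<le> card ?N"
    using exp A B(1) cA unfolding expanding_def by (metis Diff_subset card.empty min.cobounded2 not_one_le_zero subset_trans)
  ultimately show ?thesis using A(2) by (simp add: mult.commute)
qed

text \<open>Growth is geometric as long as the ball has at most \<open>k\<close> vertices. Beyond
  that only subsets of size \<open>k\<close> are known to expand, hence the cap
  \<open>c * k\<close>.\<close>

lemma expanding_ball:
  fixes c :: real
  assumes exp: "expanding n k c b" and xy: "x \<in> {1..n}" "x \<noteq> y" and k: "k \<ge> 1" and c: "c \<ge> 1"
  shows "min (c ^ i) (c * k) \<le> card (dist_ball (graph_of n (remove_vertex y b)) {x} i)"
proof (induction i)
  case 0
  then show ?case by simp
next
  case (Suc i)
  let ?B = "dist_ball (graph_of n (remove_vertex y b)) {x} i"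
  have B: "?B \<subseteq> {1..n} - {y}" "?B \<noteq> {}"
    using dist_ball_remove_vertex[OF xy] dist_ball_incr[of "{x}" "graph_of n (remove_vertex y b)" i] by blast+
  have "min (c ^ Suc i) (c * k) \<le> c * min (card ?B) k"
  proof (cases "card ?B \<le> k")
    case True
    have "min (c ^ Suc i) (c * k) \<le> c * min (c ^ i) (c * k)"
    proof (cases "c ^ i \<le> c * k")
      case False
      have "1 * (c * k) \<le> c * (c * k)" using c by (intro mult_right_mono) auto
      then show ?thesis using False by (simp add: min_def)
    qed simp
    also have "\<dots> \<le> c * card ?B" using Suc.IH c by (intro mult_left_mono) auto
    finally show ?thesis using True by (simp add: min_def)
  qed (auto simp: min_def)
  also have "\<dots> \<le> card (dist_ball (graph_of n (remove_vertex y b)) {x} (Suc i))"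
    using expanding_remove_vertex[OF exp B k] by simp
  finally show ?case .
qed

text \<open>It is enough to discard one end of each distant pair: from a vertex that is left, every
  sensor is within distance \<open>j\<close>, wherever it is placed.\<close>

definition far :: "nat \<Rightarrow> (nat set \<Rightarrow> bool) \<Rightarrow> nat \<Rightarrow> nat set" where
  "far n b j = {y \<in> {1..n}. \<exists>x\<in>{1..n}. \<not> graph_dist (graph_of n b) x y \<le> enat j}"

text \<open>Each far \<open>y\<close> is the second entry of a pair (x, y) for which
  \<open>y\<close> has no edge to the ball of radius \<open>i\<close> around \<open>x\<close> in the
  graph without \<open>y\<close>, so Markov's inequality over ordered pairs applies.\<close>

lemma prob_many_far:
  fixes s c p :: real
  assumes p: "0 \<le> p" "p \<le> 1" and k: "k \<ge> 1" and c: "c \<ge> 1" and s: "s > 0"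
  shows "measure_pmf.prob (gnp n p) {b. expanding n k c b \<and> card (far n b (Suc i)) \<ge> s} \<le>
    (real n)\<^sup>2 * exp (- (p * min (c ^ i) (c * k))) / s"
proof -
  let ?\<beta> = "min (c ^ i) (c * k)"
  let ?Z = "{(x, y). x \<in> {1..n} \<and> y \<in> {1..n} \<and> x \<noteq> y}"
  let ?Q = "\<lambda>(x, y) b. ?\<beta> \<le> card (dist_ball (graph_of n (remove_vertex y b)) {x} i) \<and>
        (\<forall>z\<in>dist_ball (graph_of n (remove_vertex y b)) {x} i. \<not> b {z, y})"
  have sub: "?Z \<subseteq> {1..n} \<times> {1..n}" by auto
  then have finZ: "finite ?Z" by (rule finite_subset) auto
  have "card ?Z \<le> card ({1..n} \<times> {1..n})" using sub by (rule card_mono[rotated]) auto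
  then have cZ: "real (card ?Z) \<le> real n ^ 2"
    by (simp add: card_cartesian_product power2_eq_square flip: of_nat_mult)
  have "measure_pmf.prob (gnp n p) {b. expanding n k c b \<and> card (far n b (Suc i)) \<ge> s} \<le>
     measure_pmf.prob (gnp n p) {b. real (card {z\<in>?Z. ?Q z b}) \<ge> s}"
  proof (rule prob_mono, elim conjE)
    fix b assume exp: "expanding n k c b" and s: "s \<le> real (card (far n b (Suc i)))"
    have "far n b (Suc i) \<subseteq> snd ` {z\<in>?Z. ?Q z b}"
    proof
      fix y assume "y \<in> far n b (Suc i)"
      then obtain x where x: "x \<in> {1..n}" "y \<in> {1..n}" and far: "\<not> graph_dist (graph_of n b) x y \<le> enat (Suc i)"
        by (auto simp: far_def)
      have "graph_dist (graph_of n b) x x \<le> enat (Suc i)" by (simp add: graph_dist_eq_0_iff[THEN iffD2])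
      then have xy: "x \<noteq> y" using far by auto
      have "\<not> b {z, y}" if z: "z \<in> dist_ball (graph_of n (remove_vertex y b)) {x} i" for z
      proof
        assume "b {z, y}"
        moreover have "z \<in> {1..n} - {y}" using z dist_ball_remove_vertex[OF x(1) xy] by blast
        ultimately have "(z, y) \<in> arcs (graph_of n b)" using x by (auto simp: arcs_graph_of)
        moreover have "z \<in> dist_ball (graph_of n b) {x} i"
        proof -
          have "arcs (graph_of n (remove_vertex y b)) \<subseteq> arcs (graph_of n b)"
            by (auto simp: arcs_graph_of remove_vertex_def)
          then show ?thesis using z dist_ball_mono_arcs by blast
        qed
        ultimately have "y \<in> dist_ball (graph_of n b) {x} (Suc i)" by auto
        then show False using far unfolding in_dist_ball_iff by simp
      qed
      then have "(x, y) \<in> {z\<in>?Z. ?Q z b}"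
        using x xy expanding_ball[OF exp x(1) xy k c] by auto
      then show "y \<in> snd ` {z\<in>?Z. ?Q z b}" by force
    qed
    moreover have fin: "finite {z\<in>?Z. ?Q z b}" using finZ by simp
    ultimately have "card (far n b (Suc i)) \<le> card {z\<in>?Z. ?Q z b}"
      by (meson card_image_le card_mono finite_imageI le_trans)
    then show "s \<le> real (card {z\<in>?Z. ?Q z b})" using s by linarith
  qed
  also have "\<dots> \<le> card ?Z * exp (- (p * ?\<beta>)) / s"
  proof (rule prob_many_le)
    fix z assume "z \<in> ?Z"
    then show "measure_pmf.prob (gnp n p) {b. ?Q z b} \<le> exp (- (p * ?\<beta>))"
      using prob_ball_avoids[OF p, of "fst z" n "snd z" ?\<beta> i] by (auto simp: case_prod_unfold)
  qed (use finZ s in auto)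
  also have "\<dots> \<le> (real n)\<^sup>2 * exp (- (p * ?\<beta>)) / s"
    using cZ s by (intro divide_right_mono mult_right_mono) auto
  finally show ?thesis .
qed

subsection \<open>Evasion in sparse random graphs\<close>

lemma card_dist_ball_le:
  fixes D :: real
  assumes deg: "\<And>v. v \<in> {1..n} \<Longrightarrow> card (arcs (graph_of n b) `` {v}) \<le> D"
    and S: "S \<subseteq> {1..n}" and D: "D \<ge> 0"
  shows "card (dist_ball (graph_of n b) S j) \<le> card S * (\<Sum>l\<le>j. D ^ l)"
proof (induction j)
  case 0
  then show ?case by simp
next
  case (Suc j)
  let ?G = "graph_of n b" and ?B = "dist_ball (graph_of n b) S j"
  have B: "?B \<subseteq> {1..n}" using dist_ball_subset[of S ?G j] S by simp
  have finB: "finite ?B" using B finite_subset by blast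
  have finS: "finite S" using S finite_subset by blast
  \<comment> \<open>Apart from \<open>S\<close>, already the ball of radius \<open>j\<close>
    consists of neighbours of that ball. The recursion is thus |S| + D |B|, which sums to a
    geometric series, and not (1 + D) |B|.\<close>
  have "dist_ball ?G S (Suc j) \<subseteq> S \<union> (\<Union>v\<in>?B. arcs ?G `` {v})"
  proof -
    have "dist_ball ?G S j \<subseteq> S \<union> arcs ?G `` dist_ball ?G S j" for j
      by (induction j) auto
    then show ?thesis by auto
  qed
  then have "card (dist_ball ?G S (Suc j)) \<le> card (S \<union> (\<Union>v\<in>?B. arcs ?G `` {v}))"
    by (rule card_mono[rotated]) (use finB finS finite_subset[OF nbhd_subset] in auto)
  also have "\<dots> \<le> card S + (\<Sum>v\<in>?B. card (arcs ?G `` {v}))"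
    using card_Un_le[of S "\<Union>v\<in>?B. arcs ?G `` {v}"] card_UN_le[OF finB, of "\<lambda>v. arcs ?G `` {v}"] by linarith
  finally have "real (card (dist_ball ?G S (Suc j))) \<le> card S + (\<Sum>v\<in>?B. real (card (arcs ?G `` {v})))"
    by (simp flip: of_nat_sum of_nat_add)
  also have "(\<Sum>v\<in>?B. real (card (arcs ?G `` {v}))) \<le> card ?B * D"
    using deg B by (intro sum_bounded_above) auto
  also have "card ?B * D \<le> card S * (\<Sum>l\<le>j. D ^ l) * D"
    using Suc.IH D by (rule mult_right_mono)
  also have "card S + card S * (\<Sum>l\<le>j. D ^ l) * D = card S * (\<Sum>l\<le>Suc j. D ^ l)"
    unfolding sum.atMost_Suc_shift by (simp add: sum_distrib_left sum_distrib_right algebra_simps)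
  finally show ?case by simp
qed

text \<open>All vertices at distance more than \<open>j + 1\<close> from the sensors, except the few in \<^term>\<open>far n b (j + 2)\<close>,
  look the same to the cops. There are at least \<open>2 r\<close> of them, and all but fewer than \<open>r\<close> are within
  reach of any \<open>r\<close> possible positions of the robber.\<close>

lemma sparse_evasion:
  fixes D u f :: real
  assumes deg: "\<And>v. v \<in> {1..n} \<Longrightarrow> card (arcs (graph_of n b) `` {v}) \<le> D" and D: "D \<ge> 0"
    and uncov: "\<And>A. A \<subseteq> {1..n} \<Longrightarrow> card A = m \<Longrightarrow> u < card ({1..n} - A - arcs (graph_of n b) `` A)"
    and joined: "\<And>A. A \<subseteq> {1..n} \<Longrightarrow> card A = r \<Longrightarrow> card ({1..n} - A - arcs (graph_of n b) `` A) < r"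
    and far: "card (far n b (Suc (Suc j))) < f" and r: "r \<ge> 1" "2 * r + f \<le> u"
    and m: "k * (\<Sum>l\<le>j. D ^ l) \<le> m" "m \<le> n"
  shows "\<not> cops_can_win (graph_of n b) k"
proof -
  let ?G = "graph_of n b" and ?V = "{1..n}" and ?F = "far n b (Suc (Suc j))"
  have finF: "finite ?F" unfolding far_def by simp
  \<comment> \<open>\<open>Suc r\<close> vertices contain r of them to which \<open>joined\<close>
    applies, and at least two candidates since r >= 1.\<close>
  define good where "good R \<longleftrightarrow> R \<subseteq> ?V \<and> card R \<ge> Suc r" for R
  have big: "\<exists>U. U \<subseteq> ?V - ?F \<and> card U \<ge> Suc (2 * r) \<and> (\<forall>x\<in>U. \<forall>s\<in>S. graph_dist ?G x s = enat (Suc (Suc j)))"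
    if S: "S \<subseteq> ?V" "card S = k" for S
  proof -
    let ?B = "dist_ball ?G S j"
    have B: "?B \<subseteq> ?V" using dist_ball_subset[of S ?G j] S by simp
    have "card ?B \<le> card S * (\<Sum>l\<le>j. D ^ l)"
      by (rule card_dist_ball_le) (use deg S D in auto)
    then have "card ?B \<le> m" using S(2) m(1) by simp
    \<comment> \<open>Padding to exactly \<open>m\<close> vertices makes \<open>uncov\<close>
      applicable. The closed neighbourhood of \<open>A\<close> contains the ball of radius
      \<open>Suc j\<close>, so vertices outside it have distance at least \<open>Suc (Suc j)\<close>
      from all sensors.\<close>
    then obtain A where A: "?B \<subseteq> A" "A \<subseteq> ?V" "card A = m"
      using obtain_subset_with_card_n exists_subset_between[of ?B m ?V] B m(2) by auto
    let ?U = "?V - A - arcs ?G `` A - ?F"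
    have "card (?V - A - arcs ?G `` A) \<le> card ?U + card ?F"
      using finF by (metis add.commute card_Diff_subset_Int diff_le_mono2 le_add_diff le_diff_conv card_mono inf_le2 finite_Int diff_card_le_card_Diff)
    then have "Suc (2 * r) \<le> card ?U" using uncov[OF A(2,3)] far r(2) by linarith
    moreover have "graph_dist ?G x s = enat (Suc (Suc j))" if x: "x \<in> ?U" and s: "s \<in> S" for x s
    proof -
      have "x \<notin> dist_ball ?G S (Suc j)" using x A(1) by auto
      then have "\<not> graph_dist ?G s x \<le> enat (Suc j)" using s unfolding in_dist_ball_iff by blast
      moreover have "graph_dist ?G s x \<le> enat (Suc (Suc j))"
        using x s S(1) unfolding far_def by blast
      ultimately have "graph_dist ?G s x = enat (Suc (Suc j))"
        by (cases "graph_dist ?G s x") auto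
      then show ?thesis by (simp add: graph_dist_sym)
    qed
    ultimately show ?thesis by (intro exI[of _ ?U]) auto
  qed
  show ?thesis
  proof (rule evasion[where good = good and ?R0.0 = ?V])
    show "finite (fst ?G)" by simp
    show "R \<subseteq> fst ?G \<and> (\<exists>x\<in>R. \<exists>y\<in>R. x \<noteq> y)" if "good R" for R
    proof -
      have "\<not> card R \<le> 1" using that r(1) by (simp add: good_def)
      then have "\<not> (\<forall>x\<in>R. \<forall>y\<in>R. x = y)" using card_le_Suc0_iff_eq[of R]
        by (metis One_nat_def card.infinite zero_le_one)
      then show ?thesis using that by (auto simp: good_def)
    qed
    have "\<exists>A\<subseteq>?V. card A = m" using m(2) by (metis card_atLeastAtMost diff_Suc_1 obtain_subset_with_card_n)
    then obtain A where A: "A \<subseteq> ?V" "card A = m" by blast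
    have "card (?V - A - arcs ?G `` A) \<le> card ?V" by (rule card_mono) auto
    then show "good ?V" using uncov[OF A] r far by (auto simp: good_def)
  next
    fix R S assume R: "good R" and S: "S \<subseteq> fst ?G" "card S = k"
    obtain U where U: "U \<subseteq> ?V - ?F" "card U \<ge> Suc (2 * r)"
      and same: "\<And>x s. x \<in> U \<Longrightarrow> s \<in> S \<Longrightarrow> graph_dist ?G x s = enat (Suc (Suc j))"
      using big[of S] S by (metis fst_graph_of)
    obtain R1 where R1: "R1 \<subseteq> R" "card R1 = r"
      using R obtain_subset_with_card_n[of r R] by (auto simp: good_def)
    let ?X = "?V - R1 - arcs ?G `` R1"
    have X: "card ?X < r" using joined[of R1] R1 R by (auto simp: good_def)
    have "card U \<le> card ?X + card (U - ?X)"
      by (metis add.commute card_Diff_subset_Int diff_card_le_card_Diff finite_Diff finite_atLeastAtMost le_diff_conv)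
    then have c: "card (U - ?X) \<ge> Suc r" using X U(2) by linarith
    have sub: "U - ?X \<subseteq> R \<union> arcs ?G `` R" using U(1) R1(1) by blast
    show "\<exists>R'. good R' \<and> R' \<subseteq> R \<union> arcs ?G `` R \<and>
        (\<forall>x\<in>R'. \<forall>y\<in>R'. \<forall>s\<in>S. graph_dist ?G x s = graph_dist ?G y s)"
    proof (intro exI[of _ "U - ?X"] conjI ballI sub)
      show "good (U - ?X)" using c U(1) by (auto simp: good_def)
    qed (simp add: same)
  qed
qed

text \<open>In the step, the sum so far is at most 2 D^j, and 2 <= D * (2/d) lets the correction of
  the next term absorb it.\<close>

lemma sum_powers_le:
  fixes D d :: real
  assumes "2 \<le> d" "d \<le> D"
  shows "(\<Sum>l\<le>j. D ^ l) \<le> D ^ j * (1 + 2 / d)"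
proof (induction j)
  case (Suc j)
  have "(1 + 2 / d) \<le> 2" using assms by simp
  then have "(1 + 2 / d) * d \<le> D * 2" using assms by (intro mult_mono[of "1 + 2 / d" 2 d D, THEN order_trans]) auto
  then have "1 + 2 / d \<le> D * (2 / d)" using assms by (simp add: field_simps)
  then have "D ^ j * (1 + 2 / d) \<le> D ^ j * (D * (2 / d))" using assms by (intro mult_left_mono) auto
  moreover have "D ^ Suc j * (1 + 2 / d) = D ^ Suc j + D ^ j * (D * (2 / d))" by (simp add: algebra_simps)
  ultimately have "D ^ j * (1 + 2 / d) + D ^ Suc j \<le> D ^ Suc j * (1 + 2 / d)" by linarith
  then show ?case using Suc.IH by simp
qed (use assms in simp)

section \<open>Relations between n, d, i and L\<close>

lemma exp_ge_power2:
  fixes x :: real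
  assumes "x \<ge> 0"
  shows "exp x \<ge> x\<^sup>2 / 2"
  using exp_lower_Taylor_quadratic[OF assms] assms by simp

text \<open>Below, \<open>ln L \<ge> 300\<close> is a convenient way of saying that \<open>n\<close> is large.\<close>

locale large_parameters =
  fixes n i :: nat and p d L :: real
  assumes p: "0 \<le> p" "p \<le> 1" and d: "d = p * n" and L: "L = ln n" and lnL: "ln L \<ge> 300"
    and dL: "d \<ge> L ^ 3" and i: "i \<ge> 1"
    and d_upper: "d ^ i \<le> n * L" and d_lower: "d ^ (i + 1) \<ge> 2 * L * n"
begin

lemma L_pos: "L > 0"
proof (rule ccontr)
  assume "\<not> L > 0"
  have "n \<noteq> 0" using lnL by (intro notI) (simp add: L)
  then have "L \<ge> 0" by (simp add: L)
  then have "L = 0" using \<open>\<not> L > 0\<close> by simp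
  then show False using lnL by simp
qed

lemma L_eq: "L = exp (ln L)" using L_pos by simp

lemma L_ge_sq: "L \<ge> (ln L)\<^sup>2 / 2"
  using exp_ge_power2[of "ln L"] lnL L_eq by simp

lemma L_ge_ln: "L \<ge> 150 * ln L"
proof -
  have "150 * ln L \<le> ln L / 2 * ln L" using lnL by (intro mult_right_mono) auto
  then show ?thesis using L_ge_sq by (simp add: power2_eq_square)
qed

lemma L_large: "L \<ge> 45000" using L_ge_ln lnL by simp

lemma n_pos: "n \<ge> 1" using L_large L by (cases "n = 0") auto

lemma n_eq: "real n = exp L" using n_pos L by simp

lemma n_ge_L: "real n \<ge> L"
  unfolding n_eq using exp_ge_add_one_self[of L] by linarith

lemma d_ge_L: "d \<ge> 45000\<^sup>2 * L"
proof -
  have "45000\<^sup>2 * L \<le> L\<^sup>2 * L" using L_large by (intro mult_right_mono power_mono) auto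
  then show ?thesis using dL by (simp add: power2_eq_square power3_eq_cube)
qed

lemma d_large: "d \<ge> 45000\<^sup>2 * 45000"
  using d_ge_L L_large by simp

lemma d_pos: "d > 0" using d_large by simp

lemma d_le_n: "d \<le> n"
  using mult_right_mono[OF p(2), of n] by (simp add: d)

lemma p_eq: "p = d / n" using n_pos d by simp

lemma ln_d_upper: "ln d \<le> L"
  using d_le_n d_pos n_pos by (simp add: L)

lemma ln_d_lower: "ln d \<ge> 3 * ln L"
proof -
  have "3 * ln L = ln (L ^ 3)" using L_pos by (simp add: ln_realpow)
  also have "\<dots> \<le> ln d" using dL L_pos d_pos by simp
  finally show ?thesis .
qed

lemma i_bound: "i * ln d \<le> L + ln L"
proof -
  have "i * ln d = ln (d ^ i)" using d_pos by (simp add: ln_realpow)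
  also have "\<dots> \<le> ln (n * L)" using d_upper d_pos n_pos L_pos by (subst ln_le_cancel_iff) auto
  also have "\<dots> = L + ln L" using n_pos L_pos by (simp add: ln_mult L)
  finally show ?thesis .
qed

text \<open>exp(28 i) is the price, in \<open>many_far_le\<close>, of balls growing by d (1 - 14/L)
  per step instead of d. If d <= sqrt n, then i is a small multiple of L and n/d >= exp(L/2);
  otherwise i <= 2 and exp 56 <= L.\<close>

lemma exp_i_le: "exp (28 * i) \<le> n / d * L"
proof (cases "2 * ln d \<le> L")
  case True
  have "real i * 300 \<le> i * (ln d / 3)" using ln_d_lower lnL by (intro mult_left_mono) auto
  then have "28 * i \<le> L / 2" using i_bound L_ge_ln by simp
  also have "\<dots> \<le> L - ln d" using True by simp
  also have "\<dots> = ln (n / d)" using n_pos d_pos by (simp add: ln_div L)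
  finally have "exp (28 * i) \<le> exp (ln (n / d))" by simp
  also have "\<dots> = n / d * 1" using n_pos d_pos by simp
  also have "\<dots> \<le> n / d * L" using L_large d_pos by (intro mult_left_mono) auto
  finally show ?thesis .
next
  case False
  have "i \<le> 2"
  proof (rule ccontr)
    assume "\<not> i \<le> 2"
    then have "3 * ln d \<le> i * ln d" using ln_d_lower lnL by (intro mult_right_mono) auto
    then show False using False i_bound L_ge_ln lnL by linarith
  qed
  then have "28 * real i \<le> ln L" using lnL by simp
  then have "exp (28 * i) \<le> exp (ln L)" by simp
  also have "\<dots> = 1 * L" using L_pos by simp
  also have "1 * L \<le> n / d * L" using d_le_n d_pos L_pos by (intro mult_right_mono) auto
  finally show ?thesis .
qed

end

section \<open>Parameters and failure probabilities of the sparse case\<close>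

locale sparse_parameters = large_parameters +
  assumes sparse: "p * L \<le> 20"
begin

text \<open>At most \<open>m\<close> vertices are within distance \<open>i - 1\<close> of the sensors, any two sets of \<open>r\<close> vertices are
  joined by an edge, sets of at most \<open>k0\<close> vertices expand by the factor \<open>c\<close>, and fewer than \<open>f\<close> vertices
  lie in a pair at distance more than \<open>i + 1\<close>.\<close>

definition "N = n / d"
definition "D = (1 + 4 / L) * d"
definition "m' = N * (ln d - 3 * ln L + 20)"
definition "m = nat \<lfloor>m'\<rfloor>"
definition "r = nat \<lceil>6 * N * L\<rceil>"
definition "k0 = nat \<lfloor>20 * N / L\<rfloor>"
definition "c = d * (1 - 14 / L)"
definition "f = N * L\<^sup>2"

lemma Nd: "N * d = n" and pN: "p * N = 1"
  using n_pos d_pos by (simp_all add: N_def p_eq)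

lemma N1: "N \<ge> 1"
  using d_le_n d_pos by (simp add: N_def)

lemma NL: "N \<ge> L / 20"
  using sparse n_pos d_pos by (simp add: p_eq N_def field_simps)

lemma D_ge: "D \<ge> d"
  using L_pos d_pos by (simp add: D_def)

lemma m'_ge: "m' \<ge> 20 * N"
  unfolding m'_def using ln_d_lower N1 by (subst mult.commute) (intro mult_left_mono, auto)

lemma m_le: "real m \<le> m'" unfolding m_def using m'_ge N1 by simp

lemma m_ge: "real m \<ge> m' - 1"
  unfolding m_def using m'_ge N1 by linarith

lemma m1: "m \<ge> 1" using m_ge m'_ge N1 by linarith

lemma m'_le: "m' \<le> N * (ln d + 20)"
  unfolding m'_def using lnL N1 by (intro mult_left_mono) auto

lemma m2L: "m \<le> 2 * N * L"
proof -
  have "m' \<le> N * (2 * L)" using m'_le ln_d_upper L_large N1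
    by (elim order_trans) (intro mult_left_mono, auto)
  also have "N * (2 * L) = 2 * N * L" by simp
  finally show ?thesis using m_le by linarith
qed

lemma m_half: "2 * m \<le> n"
proof -
  have "2 * real m \<le> N * (4 * L)" using m2L by (simp add: mult_ac)
  also have "\<dots> \<le> N * d" using d_ge_L L_pos N1 by (intro mult_left_mono) auto
  finally show ?thesis using Nd by simp
qed

lemma disconnected_le: "measure_pmf.prob (gnp n p) {b. \<not> graph_connected (graph_of n b)} \<le> 1 / n"
  using prob_disconnected[OF n_pos p] d_ge_L L_pos by (simp add: d L[symmetric])

text \<open>The excess 4/L is large enough for the tail bound, as (4/L)^2 d >= 16 L, and small
  enough for its i-th power to be harmless in \<open>sum_powers_le_m\<close>.\<close>

lemma degree_le: "measure_pmf.prob (gnp n p) {b. \<exists>v\<in>{1..n}. card (arcs (graph_of n b) `` {v}) \<ge> D} \<le> 1 / n"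
  unfolding D_def
proof (rule prob_large_degree[OF n_pos p, folded d])
  have "12 * L \<le> 16 / L\<^sup>2 * L ^ 3" using L_pos by (simp add: power2_eq_square power3_eq_cube)
  also have "\<dots> \<le> 16 / L\<^sup>2 * d" using dL by (intro mult_left_mono) auto
  finally show "12 * ln n \<le> (4 / L)\<^sup>2 * d" by (simp add: power_divide L[symmetric])
qed (use L_large in auto)

text \<open>By ln(1-p) >= -p - 2p^2, the quantity (1-p)^m is at least exp(-pm - 2p^2 m). Here pm <=
  ln d - 3 ln L + 20, and sparseness gives 2p^2 m <= 41, so (1-p)^m >= exp(-61) L^3/d. Two of the
  three factors L are those in 200 L^2/d; the third one swallows the constants.\<close>

lemma few_uncovered_le: "measure_pmf.prob (gnp n p) {b. \<exists>A\<subseteq>{1..n}. card A = m \<and>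
    card ({1..n} - A - arcs (graph_of n b) `` A) \<le> 20 * N * L\<^sup>2} \<le> 1 / n"
  unfolding N_def
proof (rule prob_few_uncovered[OF n_pos p d_pos L m2L[unfolded N_def] m_half _ m1])
  have p20: "p \<le> 20 / L" using sparse L_pos by (simp add: field_simps)
  have "20 / L \<le> 1 / 2" using L_large by simp
  then have p_half: "p \<le> 1 / 2" using p20 by linarith
  have pm: "p * m \<le> ln d - 3 * ln L + 20"
  proof -
    have "p * m \<le> p * m'" using m_le p by (intro mult_left_mono)
    also have "\<dots> = p * N * (ln d - 3 * ln L + 20)" by (simp add: m'_def)
    also have "\<dots> = ln d - 3 * ln L + 20" by (simp add: pN)
    finally show ?thesis .
  qed
  have "2 * p * (p * m) \<le> 2 * (20 / L) * (L + 20)"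
    using p20 pm ln_d_upper lnL p L_pos by (intro mult_mono) auto
  also have "\<dots> = 40 + 800 / L" using L_pos by (simp add: field_simps)
  also have "\<dots> \<le> 41" using L_large by simp
  finally have pm2: "2 * p * (p * m) \<le> 41" .
  have "200 * L\<^sup>2 / d \<le> exp (ln L - 61) * L\<^sup>2 / d"
  proof -
    have "200 \<le> exp (ln L - 61)" using exp_ge_add_one_self[of "ln L - 61"] lnL by linarith
    then show ?thesis using d_pos by (intro divide_right_mono mult_right_mono) auto
  qed
  also have "\<dots> = exp (ln L - 61) * exp (2 * ln L) / exp (ln d)"
    using L_pos d_pos exp_of_nat_mult[of 2 "ln L"] by simp
  also have "\<dots> = exp (- (ln d - 3 * ln L + 61))"
    by (simp flip: exp_add exp_diff)
  also have "\<dots> \<le> exp (m * (- p - 2 * p\<^sup>2))"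
    using pm pm2 by (simp add: algebra_simps power2_eq_square)
  also have "\<dots> \<le> exp (m * ln (1 - p))"
    using ln_one_minus_pos_lower_bound[of p] p p_half by (simp add: mult_left_mono)
  also have "\<dots> = (1 - p) ^ m" using p_half by (simp add: exp_of_nat_mult)
  finally show "200 * L\<^sup>2 / d \<le> (1 - p) ^ m" .
qed

lemma p_r_ge: "p * r \<ge> 6 * ln n"
proof -
  have "6 * L = p * N * (6 * L)" by (simp add: pN)
  also have "\<dots> = p * (6 * N * L)" by simp
  also have "\<dots> \<le> p * r" unfolding r_def using p by (intro mult_left_mono) linarith+
  finally show ?thesis by (simp add: L)
qed

lemma empty_pair_le: "measure_pmf.prob (gnp n p) {b. \<exists>A\<subseteq>{1..n}. card A = r \<and>
    card ({1..n} - A - arcs (graph_of n b) `` A) \<ge> r} \<le> 1 / n"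
  using prob_large_empty_pair[OF n_pos p _ p_r_ge] L_large L by simp

text \<open>Sparseness ensures that single vertices count as small sets, without which expansion
  could not start.\<close>

lemma k0_ge: "20 * N / L \<ge> 1"
  using NL L_pos by (simp add: field_simps)

lemma not_expanding_le: "measure_pmf.prob (gnp n p) {b. \<not> expanding n k0 c b} \<le> 1 / n"
proof -
  have "measure_pmf.prob (gnp n p) {b. \<not> expanding n k0 c b} \<le>
    measure_pmf.prob (gnp n p) {b. \<exists>A. A \<subseteq> {1..n} \<and> A \<noteq> {} \<and> card A \<le> 20 * N / L \<and>
      card (arcs (graph_of n b) `` A - A) < card A * (d * (1 - 14 / L))}"
  proof (rule prob_mono)
    fix b assume "\<not> expanding n k0 c b"
    then obtain A where A: "A \<subseteq> {1..n}" "A \<noteq> {}" "card A \<le> k0"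
        "\<not> real (card A) * c \<le> real (card (arcs (graph_of n b) `` A - A))"
      unfolding expanding_def by blast
    moreover have "real (card A) \<le> 20 * N / L" using A(3) k0_ge unfolding k0_def by linarith
    ultimately show "\<exists>A. A \<subseteq> {1..n} \<and> A \<noteq> {} \<and> card A \<le> 20 * N / L \<and>
      card (arcs (graph_of n b) `` A - A) < card A * (d * (1 - 14 / L))"
      unfolding c_def by (intro exI[of _ A]) auto
  qed
  also have "\<dots> \<le> 1 / n"
  proof (rule prob_not_expanding[OF n_pos p d L _ dL])
    have eq: "20 * N / L * p = p * N * 20 / L" by simp
    show "20 * N / L * p \<le> 20 / L" unfolding eq pN by simp
  qed (use L_large in simp)
  finally show ?thesis .
qed

lemma c1: "c \<ge> 1"
proof -
  have "1 \<le> d * (1 / 2)" using d_large by simp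
  also have "\<dots> \<le> c" unfolding c_def using L_large d_pos by (intro mult_left_mono) (auto simp: field_simps)
  finally show ?thesis .
qed

lemma k01: "k0 \<ge> 1" unfolding k0_def using k0_ge by linarith

lemma f0: "f > 0" unfolding f_def using N1 L_pos by simp

text \<open>The growth condition says p d^i >= 2L, so exp(-p d^i) <= n^(-2) cancels the number of
  pairs. Replacing d by c costs a factor exp(28 i) <= N L by Bernoulli's inequality, and dividing by
  f = N L^2 leaves 1/L.\<close>

lemma many_far_le: "measure_pmf.prob (gnp n p) {b. expanding n k0 c b \<and> card (far n b (Suc i)) \<ge> f} \<le> 1 / L"
proof -
  have "2 * L - 28 * i \<le> p * c ^ i"
  proof -
    have "2 * L - 28 * i = 2 * L * (1 + i * (- (14 / L)))" using L_pos by (simp add: field_simps)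
    also have "\<dots> \<le> 2 * L * (1 + - (14 / L)) ^ i"
      using Bernoulli_inequality[of "- (14 / L)" i] L_large by (intro mult_left_mono) auto
    also have "2 * L \<le> p * d ^ i" using d_lower n_pos by (simp add: p_eq field_simps)
    then have "2 * L * (1 + - (14 / L)) ^ i \<le> p * d ^ i * (1 + - (14 / L)) ^ i"
      using L_large by (intro mult_right_mono) auto
    also have "\<dots> = p * c ^ i" by (simp add: c_def power_mult_distrib)
    finally show ?thesis .
  qed
  \<comment> \<open>The capped term in \<open>expanding_ball\<close> is harmless: p c k0 is at least
    5 d/L, far above 2 L.\<close>
  moreover have "2 * L - 28 * i \<le> p * (c * k0)"
  proof -
    \<comment> \<open>Rounding down a number that is at least 1 loses at most half of it.\<close>
    have half: "real k0 \<ge> 10 * N / L" 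
    proof -
      have "real k0 > 20 * N / L - 1" unfolding k0_def using k0_ge by linarith
      moreover have "real k0 \<ge> 1" using k01 by simp
      ultimately have "2 * real k0 \<ge> 20 * N / L" by linarith
      then show ?thesis by simp
    qed
    have "2 * L \<le> d * (1 / 2) * (10 / L)"
    proof -
      have "L\<^sup>2 * 2 \<le> d * 5"
      proof -
        have "L\<^sup>2 * 1 \<le> L\<^sup>2 * L" using L_large by (intro mult_left_mono) auto
        then show ?thesis using dL d_pos by (simp add: power2_eq_square power3_eq_cube)
      qed
      then show ?thesis using L_pos by (simp add: field_simps power2_eq_square)
    qed
    also have "\<dots> \<le> d * (1 - 14 / L) * (10 / L)"
      using L_large d_pos by (intro mult_right_mono mult_left_mono) (auto simp: field_simps)
    also have "\<dots> = c * ((p * N) * 10 / L)" by (simp add: c_def pN)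
    also have "\<dots> = c * (p * (10 * N / L))" by simp
    also have "\<dots> \<le> c * (p * k0)" using half p c1 by (intro mult_left_mono) auto
    finally show ?thesis by (simp add: mult_ac)
  qed
  ultimately have "2 * L - 28 * i \<le> p * min (c ^ i) (c * k0)" by (simp add: min_def)
  then have "exp (- (p * min (c ^ i) (c * k0))) \<le> exp (28 * i) * exp (- (2 * L))"
    by (simp flip: exp_add)
  then have "(real n)\<^sup>2 * exp (- (p * min (c ^ i) (c * k0))) / f \<le> (real n)\<^sup>2 * (exp (28 * i) * exp (- (2 * L))) / f"
    using f0 by (intro divide_right_mono mult_left_mono) auto
  also have "\<dots> = exp (28 * i) / f"
    using exp_of_nat_mult[of 2 L] by (simp add: n_eq exp_minus field_simps)
  also have "\<dots> \<le> (N * L) / f" using exp_i_le f0 unfolding N_def[symmetric] by (intro divide_right_mono) auto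
  also have "\<dots> = 1 / L" using N1 L_pos by (simp add: f_def power2_eq_square)
  finally show ?thesis using prob_many_far[OF p k01 c1 f0, of n i] by linarith
qed

lemma failure_le: "measure_pmf.prob (gnp n p) {b. \<not> graph_connected (graph_of n b) \<or>
    (\<exists>v\<in>{1..n}. card (arcs (graph_of n b) `` {v}) \<ge> D) \<or>
    (\<exists>A\<subseteq>{1..n}. card A = m \<and> card ({1..n} - A - arcs (graph_of n b) `` A) \<le> 20 * N * L\<^sup>2) \<or>
    (\<exists>A\<subseteq>{1..n}. card A = r \<and> card ({1..n} - A - arcs (graph_of n b) `` A) \<ge> r) \<or>
    \<not> expanding n k0 c b \<or> (expanding n k0 c b \<and> card (far n b (Suc i)) \<ge> f)} \<le>
    1 / n + (1 / n + (1 / n + (1 / n + (1 / n + 1 / L))))"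
  by (intro prob_disj_le disconnected_le degree_le few_uncovered_le empty_pair_le not_expanding_le many_far_le)

lemma failure_sum_le: "1 / n + (1 / n + (1 / n + (1 / n + (1 / n + 1 / L)))) \<le> 6 / L"
proof -
  have "1 / n \<le> 1 / L" using n_ge_L L_pos by (simp add: frac_le)
  then show ?thesis by simp
qed

lemma two_r_le: "2 * r + f \<le> 20 * N * L\<^sup>2"
proof -
  have y1: "N * L \<ge> 1" using mult_mono[of 1 N 1 L] N1 L_large by simp
  have "real r \<le> 6 * N * L + 1" unfolding r_def using y1 by linarith
  then have "2 * r \<le> 14 * (N * L)" using y1 by (simp add: mult_ac)
  also have "\<dots> \<le> L * (N * L)" using y1 L_large by (intro mult_right_mono) auto
  finally have "2 * r \<le> f" by (simp add: f_def power2_eq_square mult_ac)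
  then show ?thesis using f0 by (simp add: f_def)
qed

lemma r1: "r \<ge> 1" using p_r_ge L_large L by (cases "r = 0") auto

text \<open>This is where the 20 in \<open>m'\<close> is spent. As j ln d <= 2 L, the factor (1 +
  4/L)^j is at most 1 + 16/ln d; multiplied with ln d - 3 ln L it adds at most 16. The lower powers,
  through 1 + 2/d, add at most 1, and the remaining 3 N exceed the rounding in
  \<open>m\<close>.\<close>

lemma sum_powers_le_m:
  fixes k
  assumes k: "real k < (ln d - 3 * ln L) * (n / d ^ i)" and j: "i = Suc j"
  shows "k * (\<Sum>l\<le>j. D ^ l) \<le> m"
proof -
  let ?y = "ln d - 3 * ln L"
  have lnd: "ln d \<ge> 900" using ln_d_lower lnL by simp
  have "(1 + 4 / L) ^ j \<le> exp (4 / L) ^ j"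
    using exp_ge_add_one_self[of "4 / L"] L_pos by (intro power_mono) auto
  also have "\<dots> = exp (j * (4 / L))" by (rule exp_of_nat_mult[symmetric])
  also have "\<dots> \<le> exp (8 / ln d)"
  proof -
    have "real j * ln d \<le> i * ln d" using lnd j by (intro mult_right_mono) auto
    then have "real j * ln d \<le> 2 * L" using i_bound L_ge_ln lnL by simp
    then show ?thesis using lnd L_pos by (simp add: field_simps)
  qed
  also have "\<dots> \<le> 1 + 8 / ln d + (8 / ln d)\<^sup>2" using lnd by (intro exp_bound) auto
  also have "\<dots> \<le> 1 + 16 / ln d"
  proof -
    have "8 / ln d \<le> 1" using lnd by simp
    then have "8 / ln d * (8 / ln d) \<le> 8 / ln d * 1" using lnd by (intro mult_left_mono) auto
    then have "(8 / ln d)\<^sup>2 \<le> 8 / ln d" unfolding power2_eq_square by simp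
    then show ?thesis by simp
  qed
  finally have e: "(1 + 4 / L) ^ j \<le> 1 + 16 / ln d" .
  have y0: "?y \<ge> 0" using ln_d_lower by simp
  have "(\<Sum>l\<le>j. D ^ l) \<le> D ^ j * (1 + 2 / d)"
    using d_large D_ge by (intro sum_powers_le) auto
  also have "\<dots> = d ^ j * ((1 + 4 / L) ^ j * (1 + 2 / d))"
    by (simp add: D_def power_mult_distrib)
  also have "\<dots> \<le> d ^ j * ((1 + 16 / ln d) * (1 + 2 / d))"
    using e d_pos by (intro mult_left_mono mult_right_mono) auto
  finally have s: "(\<Sum>l\<le>j. D ^ l) \<le> d ^ j * ((1 + 16 / ln d) * (1 + 2 / d))" .
  have "k * (\<Sum>l\<le>j. D ^ l) \<le> ?y * (n / d ^ i) * (d ^ j * ((1 + 16 / ln d) * (1 + 2 / d)))"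
    using k s y0 d_pos D_ge by (intro mult_mono sum_nonneg) auto
  also have "\<dots> = N * ((?y * (1 + 16 / ln d)) * (1 + 2 / d))"
    using d_pos by (simp add: j N_def)
  also have "\<dots> \<le> N * ((?y + 16) * (1 + 2 / d))"
  proof -
    have "?y * (16 / ln d) \<le> ln d * (16 / ln d)"
      using lnd lnL by (intro mult_right_mono) auto
    then have "?y * (1 + 16 / ln d) \<le> ?y + 16" using lnd by (simp add: algebra_simps)
    then show ?thesis using N1 d_pos by (intro mult_left_mono mult_right_mono) auto
  qed
  also have "\<dots> \<le> N * (?y + 17)"
  proof -
    have "(?y + 16) * 2 \<le> d"
      using ln_d_upper lnL L_large d_ge_L by simp
    then have "(?y + 16) * (2 / d) \<le> 1" using d_pos by simp
    then have "(?y + 16) * (1 + 2 / d) \<le> ?y + 17" by (simp add: algebra_simps)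
    then show ?thesis using N1 by (intro mult_left_mono) auto
  qed
  also have "\<dots> = m' - 3 * N" by (simp add: m'_def algebra_simps)
  also have "\<dots> \<le> m" using m_ge N1 by simp
  finally show ?thesis .
qed

lemma sparse_case:
  "measure_pmf.prob (gnp n p) {b. \<not> (graph_connected (graph_of n b) \<and>
     (\<forall>k. real k < (ln d - 3 * ln L) * (n / d ^ i) \<longrightarrow> \<not> cops_can_win (graph_of n b) k))} \<le> 6 / L"
proof -
  obtain j where j: "i = Suc j" using i by (cases i) auto
  show ?thesis
  proof (rule order_trans[OF order_trans[OF prob_mono failure_le] failure_sum_le], rule ccontr)
    fix b
    assume no: "\<not> (graph_connected (graph_of n b) \<and>
      (\<forall>k. real k < (ln d - 3 * ln L) * (n / d ^ i) \<longrightarrow> \<not> cops_can_win (graph_of n b) k))"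
    assume ok: "\<not> (\<not> graph_connected (graph_of n b) \<or>
      (\<exists>v\<in>{1..n}. card (arcs (graph_of n b) `` {v}) \<ge> D) \<or>
      (\<exists>A\<subseteq>{1..n}. card A = m \<and> card ({1..n} - A - arcs (graph_of n b) `` A) \<le> 20 * N * L\<^sup>2) \<or>
      (\<exists>A\<subseteq>{1..n}. card A = r \<and> card ({1..n} - A - arcs (graph_of n b) `` A) \<ge> r) \<or>
      \<not> expanding n k0 c b \<or> (expanding n k0 c b \<and> card (far n b (Suc i)) \<ge> f))"
    note ok' = ok[unfolded de_Morgan_disj not_not]
    have "\<not> cops_can_win (graph_of n b) k" if "real k < (ln d - 3 * ln L) * (n / d ^ i)" for k
    proof (rule sparse_evasion[where D = D and m = m and u = "20 * N * L\<^sup>2" and r = r and f = f and j = j])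
      show "real (card (arcs (graph_of n b) `` {v})) \<le> D" if "v \<in> {1..n}" for v
        using ok'[THEN conjunct2, THEN conjunct1] that by (meson less_imp_le not_le)
      show "20 * N * L\<^sup>2 < card ({1..n} - A - arcs (graph_of n b) `` A)" if "A \<subseteq> {1..n}" "card A = m" for A
        using ok'[THEN conjunct2, THEN conjunct2, THEN conjunct1] that by (meson not_le)
      show "card ({1..n} - A - arcs (graph_of n b) `` A) < r" if "A \<subseteq> {1..n}" "card A = r" for A
        using ok'[THEN conjunct2, THEN conjunct2, THEN conjunct2, THEN conjunct1] that by (meson not_le)
      show "card (far n b (Suc (Suc j))) < f"
        using ok'[THEN conjunct2, THEN conjunct2, THEN conjunct2, THEN conjunct2, THEN conjunct1] ok'[THEN conjunct2, THEN conjunct2, THEN conjunct2, THEN conjunct2, THEN conjunct2] unfolding j by (meson not_le)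
      show "m \<le> n" using m_half by simp
      show "D \<ge> 0" using D_ge d_pos by simp
    qed (use r1 two_r_le sum_powers_le_m[OF that j] in auto)
    then show False using no ok'[THEN conjunct1] by blast
  qed
qed

end

subsection \<open>Dense random graphs\<close>

definition adj_in :: "nat set \<Rightarrow> (nat set \<Rightarrow> bool) \<Rightarrow> nat \<Rightarrow> nat set" where
  "adj_in S b u = {s\<in>S. b {s, u}}"

text \<open>What a robber at \<open>v\<close> needs in diameter two, where adjacency determines the
  distance between distinct vertices. A sensor at \<open>v\<close> itself does not help, since both
  options are adjacent to it. Leaving out \<open>insert v S\<close> keeps the relevant coins in
  disjoint stars.\<close>

definition collision :: "nat \<Rightarrow> nat set \<Rightarrow> nat \<Rightarrow> (nat set \<Rightarrow> bool) \<Rightarrow> bool" where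
  "collision n S v b \<longleftrightarrow> (\<exists>u\<in>{1..n} - insert v S. \<exists>u'\<in>{1..n} - insert v S.
     u \<noteq> u' \<and> b {v, u} \<and> b {v, u'} \<and> adj_in S b u = adj_in S b u')"

lemma adj_in_cong: "(\<And>e. e \<in> star (insert v S) u \<Longrightarrow> b e = b' e) \<Longrightarrow> adj_in S b u = adj_in S b' u \<and> b {v, u} = b' {v, u}"
  by (auto simp: adj_in_def star_def)

lemma prob_adj_in_eq:
  assumes S: "S \<subseteq> {1..n}" and v: "v \<in> {1..n}" "v \<notin> S" and u: "u \<in> {1..n} - insert v S"
    and X: "X \<subseteq> S" "card X = w" and p: "0 \<le> p" "p \<le> 1"
  shows "measure_pmf.prob (gnp n p) {b. b {v, u} \<and> adj_in S b u = X} = p * (p ^ w * (1 - p) ^ (card S - w))"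
proof -
  have finS: "finite S" using S finite_subset by blast
  have finX: "finite X" using X finS finite_subset by blast
  have "v \<notin> X" using v X by blast
  then have c: "card (insert v X) = Suc w" using finX X by simp
  have c': "card (S - X) = card S - w" using finX X by (simp add: card_Diff_subset)
  have "{b. b {v, u} \<and> adj_in S b u = X} = {b. (\<forall>e\<in>star (insert v X) u. b e) \<and> (\<forall>e\<in>star (S - X) u. \<not> b e)}"
    using X(1) by (auto simp: adj_in_def star_def)
  moreover have "measure_pmf.prob (gnp n p) {b. (\<forall>e\<in>star (insert v X) u. b e) \<and> (\<forall>e\<in>star (S - X) u. \<not> b e)} =
      p ^ card (star (insert v X) u) * (1 - p) ^ card (star (S - X) u)"
  proof (rule prob_bern_pattern)
    show "star (insert v X) u \<subseteq> vertex_pairs n"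
      by (rule star_subset) (use S v u X in auto)
    show "star (S - X) u \<subseteq> vertex_pairs n"
      by (rule star_subset) (use S v u X in auto)
    show "star (insert v X) u \<inter> star (S - X) u = {}"
      using v u X by (auto simp: star_def doubleton_eq_iff)
  qed (use p in auto)
  moreover have "card (star (insert v X) u) = Suc w" using card_star[of u "insert v X"] c u X by auto
  moreover have "card (star (S - X) u) = card S - w" using card_star[of u "S - X"] c' u by auto
  ultimately show ?thesis by simp
qed

lemma prob_adj_in_mem:
  fixes p :: real
  assumes S: "S \<subseteq> {1..n}" and v: "v \<in> {1..n}" "v \<notin> S" and u: "u \<in> {1..n} - insert v S"
    and \<T>: "\<And>X. X \<in> \<T> \<Longrightarrow> X \<subseteq> S \<and> card X = w" and p: "0 \<le> p" "p \<le> 1"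
  shows "measure_pmf.prob (gnp n p) {b. b {v, u} \<and> adj_in S b u \<in> \<T>} = card \<T> * (p * (p ^ w * (1 - p) ^ (card S - w)))"
proof -
  have "\<T> \<subseteq> Pow S" using \<T> by blast
  moreover have "finite S" using S finite_subset by blast
  ultimately have fin: "finite \<T>" using finite_subset by blast
  have "{b. b {v, u} \<and> adj_in S b u \<in> \<T>} = (\<Union>X\<in>\<T>. {b. b {v, u} \<and> adj_in S b u = X})" by auto
  then have "measure_pmf.prob (gnp n p) {b. b {v, u} \<and> adj_in S b u \<in> \<T>} =
     (\<Sum>X\<in>\<T>. measure_pmf.prob (gnp n p) {b. b {v, u} \<and> adj_in S b u = X})"
    using fin by (simp only:) (subst measure_pmf.finite_measure_finite_Union, auto simp: disjoint_family_on_def)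
  also have "\<dots> = (\<Sum>X\<in>\<T>. p * (p ^ w * (1 - p) ^ (card S - w)))"
    using \<T> by (intro sum.cong refl prob_adj_in_eq[OF S v u _ _ p]) auto
  finally show ?thesis by simp
qed

text \<open>If the \<open>Z\<close> vertices of \<open>W1\<close> that are adjacent to \<open>v\<close> and have exactly \<open>w\<close> neighbours in \<open>S\<close> have
  distinct neighbourhoods there, then each vertex of \<open>W2\<close> must avoid \<open>Z\<close> neighbourhoods.\<close>

lemma prob_no_collision:
  fixes p q :: real
  assumes S: "S \<subseteq> {1..n}" and v: "v \<in> {1..n}" "v \<notin> S" and p: "0 \<le> p" "p \<le> 1"
    and W: "W1 \<subseteq> {1..n} - insert v S" "W2 \<subseteq> {1..n} - insert v S" "W1 \<inter> W2 = {}"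
    and q: "q = p * (p ^ w * (1 - p) ^ (card S - w))"
  shows "measure_pmf.prob (gnp n p) {b. \<not> collision n S v b} \<le>
    exp (card W1 * ((card S choose w) * q) * (exp (- (q * card W2)) - 1))"
proof -
  let ?A = "insert v S" and ?F = "\<Union>u\<in>W1. star (insert v S) u"
  have finS: "finite S" using S finite_subset by blast
  have finW: "finite W1" "finite W2" using W finite_subset by blast+
  \<comment> \<open>Fixing the number \<open>w\<close> of neighbours makes all possible
    neighbourhoods equally likely, with probability \<open>q\<close> each once adjacency to
    \<open>v\<close> is included.\<close>
  define H where "H b = {u\<in>W1. b {v, u} \<and> card (adj_in S b u) = w}" for b
  have q0: "q \<ge> 0" using p q by simp
  have "measure_pmf.prob (gnp n p) {b. \<not> collision n S v b} \<le>
     measure_pmf.expectation (gnp n p) (\<lambda>b. exp (- (q * card W2) * card (H b)))"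
  proof (rule prob_resample_le_expectation[where F = ?F])
    fix b :: "nat set \<Rightarrow> bool"
    define m where "m b' = (\<lambda>e. if e \<in> ?F then b e else b' e)" for b'
    define \<T> where "\<T> = adj_in S b ` H b"
    have m1: "adj_in S (m b') u = adj_in S b u \<and> m b' {v, u} = b {v, u}" if "u \<in> W1" for u b'
      by (rule adj_in_cong) (use that in \<open>auto simp: m_def\<close>)
    have m2: "adj_in S (m b') u = adj_in S b' u \<and> m b' {v, u} = b' {v, u}" if "u \<in> W2" for u b'
    proof (rule adj_in_cong)
      fix e assume e: "e \<in> star (insert v S) u"
      have "star (insert v S) u \<inter> star (insert v S) u1 = {}" if "u1 \<in> W1" for u1
        using that \<open>u \<in> W2\<close> W by (auto simp: star_def doubleton_eq_iff)
      then have "e \<notin> ?F" using e by blast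
      then show "m b' e = b' e" by (simp add: m_def)
    qed
    have T: "X \<subseteq> S \<and> card X = w" if "X \<in> \<T>" for X
      using that by (auto simp: \<T>_def H_def adj_in_def)
    show "measure_pmf.prob (gnp n p) {b'. \<not> collision n S v (\<lambda>e. if e \<in> ?F then b e else b' e)} \<le>
       exp (- (q * card W2) * card (H b))"
      unfolding m_def[symmetric]
    \<comment> \<open>The coins at \<open>W1\<close> are exposed first. A repetition there is a
      collision whatever \<open>W2\<close> does; otherwise the forbidden neighbourhoods are as many
      as the vertices of \<open>H b\<close>.\<close>
    proof (cases "inj_on (adj_in S b) (H b)")
      case False
      then obtain u u' where u: "u \<in> H b" "u' \<in> H b" "u \<noteq> u'" "adj_in S b u = adj_in S b u'"
        by (auto simp: inj_on_def)
      have "u \<in> W1" "u' \<in> W1" "b {v, u}" "b {v, u'}" using u by (auto simp: H_def)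
      have "collision n S v (m b')" for b'
      proof -
        have "adj_in S (m b') u = adj_in S (m b') u'" "m b' {v, u}" "m b' {v, u'}"
          using m1[OF \<open>u \<in> W1\<close>, of b'] m1[OF \<open>u' \<in> W1\<close>, of b'] u(4) \<open>b {v, u}\<close> \<open>b {v, u'}\<close> by simp_all
        moreover have "u \<in> {1..n} - insert v S" "u' \<in> {1..n} - insert v S"
          using \<open>u \<in> W1\<close> \<open>u' \<in> W1\<close> W(1) by blast+
        ultimately show ?thesis unfolding collision_def using u(3) by blast
      qed
      then show "measure_pmf.prob (gnp n p) {b'. \<not> collision n S v (m b')} \<le> exp (- (q * card W2) * card (H b))"
        by simp
    next
      case True
      then have cH: "card \<T> = card (H b)" unfolding \<T>_def by (rule card_image)
      have "measure_pmf.prob (gnp n p) {b'. \<not> collision n S v (m b')} \<le>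
        measure_pmf.prob (gnp n p) {b'. \<forall>u\<in>W2. \<not> (b' {v, u} \<and> adj_in S b' u \<in> \<T>)}"
      proof (rule prob_mono, intro ballI notI, elim conjE)
        fix b' u assume no: "\<not> collision n S v (m b')" and u: "u \<in> W2" "b' {v, u}" "adj_in S b' u \<in> \<T>"
        then obtain u1 where u1: "u1 \<in> H b" "adj_in S b u1 = adj_in S b' u" by (auto simp: \<T>_def)
        have u1': "u1 \<in> W1" "b {v, u1}" using u1 by (auto simp: H_def)
        have "adj_in S (m b') u = adj_in S (m b') u1" "m b' {v, u}" "m b' {v, u1}"
          using m1[OF u1'(1), of b'] m2[OF u(1), of b'] u1(2) u1'(2) u(2) by simp_all
        moreover have "u \<in> {1..n} - insert v S" "u1 \<in> {1..n} - insert v S" "u \<noteq> u1"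
          using u(1) u1'(1) W by blast+
        ultimately have "collision n S v (m b')" unfolding collision_def by blast
        then show False using no by blast
      qed
      also have "\<dots> = (\<Prod>u\<in>W2. measure_pmf.prob (gnp n p) {b'. \<not> (b' {v, u} \<and> adj_in S b' u \<in> \<T>)})"
      proof (rule prob_all_indep[where B = "star ?A"])
        show "disjoint_family_on (star ?A) W2" using W(2) by (intro disjoint_star) auto
        show "depends_on (star ?A u) (\<lambda>b'. \<not> (b' {v, u} \<and> adj_in S b' u \<in> \<T>))" for u
        proof (rule depends_onI)
          fix b b' :: "nat set \<Rightarrow> bool" assume "\<And>e. e \<in> star ?A u \<Longrightarrow> b e = b' e"
          then have "adj_in S b u = adj_in S b' u \<and> b {v, u} = b' {v, u}" by (rule adj_in_cong)
          then show "(\<not> (b {v, u} \<and> adj_in S b u \<in> \<T>)) = (\<not> (b' {v, u} \<and> adj_in S b' u \<in> \<T>))" by simp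
        qed
      qed (use finW in auto)
      also have "\<dots> \<le> (\<Prod>u\<in>W2. exp (- (card \<T> * q)))"
      proof (rule prod_mono, intro conjI)
        fix u assume u: "u \<in> W2"
        have "u \<in> {1..n} - insert v S" using u W(2) by blast
        then have "measure_pmf.prob (gnp n p) {b'. \<not> (b' {v, u} \<and> adj_in S b' u \<in> \<T>)} = 1 - card \<T> * q"
          unfolding prob_not q using prob_adj_in_mem[OF S v _ T p, of u] by simp
        then show "measure_pmf.prob (gnp n p) {b'. \<not> (b' {v, u} \<and> adj_in S b' u \<in> \<T>)} \<le> exp (- (card \<T> * q))"
          using exp_ge_add_one_self[of "- (card \<T> * q)"] by linarith
      qed simp
      also have "\<dots> = exp (- (q * card W2) * card (H b))"
        by (simp add: cH flip: exp_of_nat_mult)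
      finally show "measure_pmf.prob (gnp n p) {b'. \<not> collision n S v (m b')} \<le> exp (- (q * card W2) * card (H b))" .
    qed
  qed simp
  \<comment> \<open>It remains to average over the size of \<open>H b\<close>, a sum of independent
    indicators, at the negative weight t = - q |W2|.\<close>
  also have "\<dots> \<le> exp (card W1 * ((card S choose w) * q) * (exp (- (q * card W2)) - 1))"
    unfolding H_def
  proof (rule expectation_exp_card[where B = "star ?A"])
    show "disjoint_family_on (star ?A) W1" using W(1) by (intro disjoint_star) auto
    show "depends_on (star ?A u) (\<lambda>b. b {v, u} \<and> card (adj_in S b u) = w)" for u
    proof (rule depends_onI)
      fix b b' :: "nat set \<Rightarrow> bool" assume "\<And>e. e \<in> star ?A u \<Longrightarrow> b e = b' e"
      then have "adj_in S b u = adj_in S b' u \<and> b {v, u} = b' {v, u}" by (rule adj_in_cong)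
      then show "(b {v, u} \<and> card (adj_in S b u) = w) = (b' {v, u} \<and> card (adj_in S b' u) = w)" by simp
    qed
    show "measure_pmf.prob (gnp n p) {b. b {v, u} \<and> card (adj_in S b u) = w} = (card S choose w) * q" if "u \<in> W1" for u
    proof -
      let ?T = "{X. X \<subseteq> S \<and> card X = w}"
      have "{b. b {v, u} \<and> card (adj_in S b u) = w} = {b. b {v, u} \<and> adj_in S b u \<in> ?T}"
        by (auto simp: adj_in_def)
      moreover have "u \<in> {1..n} - insert v S" using that W(1) by blast
      ultimately show ?thesis
        using prob_adj_in_mem[OF S v _ _ p, of u ?T w] n_subsets[OF finS, of w] q by simp
    qed
  qed (use finW in auto)
  finally show ?thesis .
qed

section \<open>The game in diameter two\<close>

lemma graph_dist_diam2:
  assumes xy: "x \<noteq> y" and path: "(x, z) \<in> arcs G" "(z, y) \<in> arcs G"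
  shows "graph_dist G x y = (if (x, y) \<in> arcs G then 1 else 2)"
proof -
  have 2: "graph_dist G x y \<le> enat 2"
    unfolding graph_dist_le_iff using path by (intro exI[of _ "Suc (Suc 0)"]) auto
  have 0: "\<not> graph_dist G x y \<le> enat 0"
    unfolding graph_dist_le_iff using xy by auto
  have 1: "graph_dist G x y \<le> enat 1 \<longleftrightarrow> (x, y) \<in> arcs G"
    unfolding graph_dist_le_iff using xy by (auto simp: le_Suc_eq intro: exI[of _ "Suc 0"])
  obtain l where l: "graph_dist G x y = enat l" "l \<le> 2" "l \<noteq> 0"
    using 2 0 by (cases "graph_dist G x y") auto
  then have "l = 1 \<or> l = 2" by auto
  then show ?thesis using 1 l(1) by (auto simp: one_enat_def numeral_eq_enat)
qed

text \<open>Two candidates suffice as the invariant: from any one of them, a collision provides the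
  next two.\<close>

lemma dense_evasion:
  assumes diam: "\<And>x y. x \<in> {1..n} \<Longrightarrow> y \<in> {1..n} \<Longrightarrow> x \<noteq> y \<Longrightarrow>
      \<exists>z. (x, z) \<in> arcs (graph_of n b) \<and> (z, y) \<in> arcs (graph_of n b)"
    and coll: "\<And>S v. S \<subseteq> {1..n} \<Longrightarrow> card S = K \<Longrightarrow> v \<in> {1..n} - S \<Longrightarrow> collision n S v b"
    and K: "K + 1 < n" and k: "k \<le> K"
  shows "\<not> cops_can_win (graph_of n b) k"
proof -
  let ?G = "graph_of n b" and ?V = "{1..n}"
  define good where "good R \<longleftrightarrow> R \<subseteq> ?V \<and> (\<exists>x\<in>R. \<exists>y\<in>R. x \<noteq> y)" for R
  show ?thesis
  proof (rule evasion[where good = good and ?R0.0 = ?V])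
    have "1 \<in> ?V" "2 \<in> ?V" using K by auto
    then show "good ?V" unfolding good_def by (metis order_refl one_eq_numeral_iff num.distinct(1))
  next
    fix R S assume R: "good R" and S: "S \<subseteq> fst ?G" "card S = k"
    obtain v where v: "v \<in> R" using R by (auto simp: good_def)
    then have vV: "v \<in> ?V" using R by (auto simp: good_def)
    \<comment> \<open>The sensors other than \<open>v\<close> are padded to exactly \<open>K\<close>
      vertices avoiding \<open>v\<close>, as \<open>coll\<close> requires. More sensors only make
      agreement harder.\<close>
    have "card (S - {v}) \<le> K" using S(2) k card_Diff1_le[of S v] by linarith
    moreover have "card (?V - {v}) \<ge> K" using K vV by simp
    ultimately obtain S0 where S0: "S - {v} \<subseteq> S0" "S0 \<subseteq> ?V - {v}" "card S0 = K"
      using exists_subset_between[of "S - {v}" K "?V - {v}"] S by auto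
    have S0V: "S0 \<subseteq> ?V" "v \<in> ?V - S0" using S0 vV by auto
    obtain u u' where u: "u \<in> ?V - insert v S0" "u' \<in> ?V - insert v S0" "u \<noteq> u'"
      "b {v, u}" "b {v, u'}" and same: "adj_in S0 b u = adj_in S0 b u'"
      using coll[OF S0V(1) S0(3) S0V(2)] unfolding collision_def by blast
    have arcs: "(v, u) \<in> arcs ?G" "(v, u') \<in> arcs ?G"
      using u vV by (auto simp: arcs_graph_of)
    have eq: "graph_dist ?G u s = graph_dist ?G u' s" if s: "s \<in> S" for s
    proof -
      have sV: "s \<in> ?V" using s S by auto
      have s0: "s = v \<or> s \<in> S0" using s S0 by blast
      have us: "u \<noteq> s" "u' \<noteq> s" using s0 u by auto
      have "(u, s) \<in> arcs ?G \<longleftrightarrow> (u', s) \<in> arcs ?G"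
      proof (cases "s = v")
        case True
        then show ?thesis using arcs arcs_sym by metis
      next
        case False
        then have "b {s, u} = b {s, u'}" using same s0 by (auto simp: adj_in_def)
        then show ?thesis using us u sV by (simp add: arcs_graph_of insert_commute)
      qed
      moreover obtain z where "(u, z) \<in> arcs ?G" "(z, s) \<in> arcs ?G" using diam[of u s] u sV us by blast
      moreover obtain z' where "(u', z') \<in> arcs ?G" "(z', s) \<in> arcs ?G" using diam[of u' s] u sV us by blast
      ultimately show ?thesis using graph_dist_diam2[OF us(1)] graph_dist_diam2[OF us(2)] by simp
    qed
    show "\<exists>R'. good R' \<and> R' \<subseteq> R \<union> arcs ?G `` R \<and>
        (\<forall>x\<in>R'. \<forall>y\<in>R'. \<forall>s\<in>S. graph_dist ?G x s = graph_dist ?G y s)"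
      using u arcs v eq by (intro exI[of _ "{u, u'}"]) (auto simp: good_def)
  qed (auto simp: good_def)
qed

text \<open>A pair has no common neighbour with probability at most exp(-p^2 n/2) <= n^(-3), and
  there are at most n^2 pairs; n >= 4 gives n - 2 >= n/2.\<close>

lemma prob_diam_gt_2:
  fixes p :: real
  assumes n: "n \<ge> 4" and p: "0 \<le> p" "p \<le> 1" and pn: "p\<^sup>2 * n \<ge> 6 * ln n"
  shows "measure_pmf.prob (gnp n p) {b. \<not> (\<forall>x\<in>{1..n}. \<forall>y\<in>{1..n}. x \<noteq> y \<longrightarrow>
      (\<exists>z. (x, z) \<in> arcs (graph_of n b) \<and> (z, y) \<in> arcs (graph_of n b)))} \<le> 1 / n"
proof -
  let ?Z = "{(x, y). x \<in> {1..n} \<and> y \<in> {1..n} \<and> x \<noteq> y}"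
  let ?Q = "\<lambda>(x, y) b. \<forall>z\<in>{1..n} - {x, y}. \<not> (b {x, z} \<and> b {y, z})"
  have sub: "?Z \<subseteq> {1..n} \<times> {1..n}" by auto
  then have finZ: "finite ?Z" by (rule finite_subset) auto
  have "card ?Z \<le> card ({1..n} \<times> {1..n})" using sub by (rule card_mono[rotated]) auto
  then have cZ: "real (card ?Z) \<le> real n ^ 2"
    by (simp add: card_cartesian_product power2_eq_square flip: of_nat_mult)
  have "measure_pmf.prob (gnp n p) {b. \<not> (\<forall>x\<in>{1..n}. \<forall>y\<in>{1..n}. x \<noteq> y \<longrightarrow>
      (\<exists>z. (x, z) \<in> arcs (graph_of n b) \<and> (z, y) \<in> arcs (graph_of n b)))} \<le>
     measure_pmf.prob (gnp n p) {b. real (card {z\<in>?Z. ?Q z b}) \<ge> 1}"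
  proof (rule prob_mono)
    fix b assume "\<not> (\<forall>x\<in>{1..n}. \<forall>y\<in>{1..n}. x \<noteq> y \<longrightarrow>
      (\<exists>z. (x, z) \<in> arcs (graph_of n b) \<and> (z, y) \<in> arcs (graph_of n b)))"
    then obtain x y where xy: "x \<in> {1..n}" "y \<in> {1..n}" "x \<noteq> y"
      and no: "\<not> (\<exists>z. (x, z) \<in> arcs (graph_of n b) \<and> (z, y) \<in> arcs (graph_of n b))" by blast
    have "\<not> (b {x, z} \<and> b {y, z})" if z: "z \<in> {1..n} - {x, y}" for z
    proof
      assume "b {x, z} \<and> b {y, z}"
      then have "(x, z) \<in> arcs (graph_of n b) \<and> (y, z) \<in> arcs (graph_of n b)"
        using xy z by (auto simp: arcs_graph_of)
      then show False using no arcs_sym by metis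
    qed
    then have "(x, y) \<in> {z\<in>?Z. ?Q z b}" using xy by simp
    then have "{z\<in>?Z. ?Q z b} \<noteq> {}" by blast
    moreover have "finite {z\<in>?Z. ?Q z b}" using finZ by (rule finite_subset[rotated]) blast
    ultimately have "card {z\<in>?Z. ?Q z b} > 0" unfolding card_gt_0_iff by (rule conjI)
    then show "real (card {z\<in>?Z. ?Q z b}) \<ge> 1" by linarith
  qed
  also have "\<dots> \<le> card ?Z * exp (- 3 * ln n) / 1"
  proof (rule prob_many_le)
    fix z assume z: "z \<in> ?Z"
    then obtain x y where z_eq: "z = (x, y)" and xy: "x \<in> {1..n}" "y \<in> {1..n}" "x \<noteq> y" by auto
    let ?W = "{1..n} - {x, y}"
    have "measure_pmf.prob (gnp n p) {b. ?Q z b} =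
       (\<Prod>w\<in>?W. measure_pmf.prob (gnp n p) {b. \<not> (b {x, w} \<and> b {y, w})})"
      unfolding z_eq prod.case
    proof (rule prob_all_indep[where B = "star {x, y}"])
      show "disjoint_family_on (star {x, y}) ?W" by (rule disjoint_star) auto
      show "depends_on (star {x, y} w) (\<lambda>b. \<not> (b {x, w} \<and> b {y, w}))" for w
        by (rule depends_onI) (auto simp: star_def)
    qed auto
    also have "\<dots> = (\<Prod>w\<in>?W. 1 - p\<^sup>2)"
    proof (rule prod.cong[OF refl])
      fix w assume w: "w \<in> ?W"
      have "card {{x, w}, {y, w}} = 2" using xy w by (auto simp: card_insert_if doubleton_eq_iff)
      moreover have "{{x, w}, {y, w}} \<subseteq> vertex_pairs n" using xy w by (auto simp: pair_in_vertex_pairs)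
      ultimately show "measure_pmf.prob (gnp n p) {b. \<not> (b {x, w} \<and> b {y, w})} = 1 - p\<^sup>2"
        unfolding prob_not using prob_bern_pattern[of "vertex_pairs n" "{{x, w}, {y, w}}" "{}" p] p by simp
    qed
    also have "\<dots> = (1 - p\<^sup>2) ^ (n - 2)" using xy by (simp add: card_Diff_subset numeral_2_eq_2)
    also have "\<dots> \<le> exp (- p\<^sup>2) ^ (n - 2)"
      using exp_ge_add_one_self[of "- p\<^sup>2"] p by (intro power_mono) (auto simp: power_le_one)
    also have "\<dots> = exp (- (real (n - 2) * p\<^sup>2))" by (simp flip: exp_of_nat_mult)
    also have "\<dots> \<le> exp (- 3 * ln n)"
    proof -
      have "real (n - 2) * p\<^sup>2 \<ge> n / 2 * p\<^sup>2" using n by (intro mult_right_mono) auto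
      then show ?thesis using pn by (simp add: mult.commute)
    qed
    finally show "measure_pmf.prob (gnp n p) {b. ?Q z b} \<le> exp (- 3 * ln n)" .
  qed (use finZ in auto)
  also have "\<dots> \<le> (real n)\<^sup>2 * exp (- 3 * ln n)" using cZ by simp
  also have "\<dots> = exp (2 * ln n) * exp (- 3 * ln n)" using n exp_of_nat_mult[of 2 "ln n"] by simp
  also have "\<dots> = exp (- ln n)" by (simp flip: exp_add)
  also have "\<dots> = 1 / n" using n by (simp add: exp_minus inverse_eq_divide)
  finally show ?thesis .
qed

section \<open>Parameters and collision estimates of the dense case\<close>

locale dense_parameters = large_parameters +
  assumes dense: "p * L \<ge> 20" and p_small: "p \<le> 1 / 100" and i1: "i = 1"
begin

definition "K = nat \<lfloor>(ln d - 3 * ln L) / p\<rfloor>"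
text \<open>The probability that two given vertices outside a set of \<open>K\<close> vertices have
  the same neighbourhood there, with \<open>w\<close> elements; also a term of the expansion of (p^2
  + (1-p)^2)^K.\<close>

definition "T w = real (K choose w) * p ^ (2 * w) * (1 - p) ^ (2 * (K - w))"

lemma p_pos: "p > 0"
  using dense L_pos by (metis less_eq_real_def mult_zero_left not_numeral_le_zero p(1))

lemma ln_d_ge: "ln d \<ge> L - ln L"
proof -
  have "1 \<le> L * p" using dense by (simp add: mult.commute)
  then have "0 \<le> ln (L * p)" by simp
  also have "\<dots> = ln L + ln p" using L_pos p_pos by (simp add: ln_mult)
  also have "ln p = ln d - L" using n_pos p_pos by (simp add: d ln_mult L)
  finally show ?thesis by simp
qed

lemma K_upper: "p * K \<le> ln d - 3 * ln L" and K_lower: "p * K \<ge> ln d - 3 * ln L - p"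
proof -
  let ?y = "(ln d - 3 * ln L) / p"
  have y: "?y \<ge> 0" using ln_d_lower p_pos by simp
  have y_eq: "p * ?y = ln d - 3 * ln L" using p_pos by simp
  have "real K \<le> ?y" unfolding K_def using y by simp
  then have "p * K \<le> p * ?y" using p_pos by (intro mult_left_mono) auto
  then show "p * K \<le> ln d - 3 * ln L" unfolding y_eq .
  have "real K \<ge> ?y - 1" unfolding K_def using y by linarith
  then have "p * (?y - 1) \<le> p * K" using p_pos by (intro mult_left_mono) auto
  then show "p * K \<ge> ln d - 3 * ln L - p" unfolding right_diff_distrib y_eq by simp
qed

lemma pK_ge: "p * K \<ge> 9 / 10 * L"
  using K_lower ln_d_ge L_ge_ln p_small lnL by linarith

lemma pK_le: "p * K \<le> L"
  using K_upper ln_d_upper lnL by linarith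

lemma K_ge: "real K \<ge> 90 * L"
proof -
  have "p * K \<le> 1 / 100 * K" using p_small by (intro mult_right_mono) auto
  then show ?thesis using pK_ge by linarith
qed

lemma K_le: "20 * real K \<le> L\<^sup>2"
proof -
  have "20 * real K \<le> p * L * K" using dense by (intro mult_right_mono) auto
  also have "\<dots> = p * K * L" by simp
  also have "\<dots> \<le> L * L" using pK_le L_pos by (intro mult_right_mono) auto
  finally show ?thesis by (simp add: power2_eq_square)
qed

lemma p2K: "K * p\<^sup>2 \<ge> 18"
proof -
  have "18 = 20 * (9 / 10 :: real)" by simp
  also have "\<dots> \<le> p * L * (9 / 10)" using dense by (intro mult_right_mono) auto
  also have "\<dots> = p * (9 / 10 * L)" by simp
  also have "\<dots> \<le> p * (p * K)" using pK_ge p_pos by (intro mult_left_mono) auto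
  finally show ?thesis by (simp add: power2_eq_square mult_ac)
qed

lemma n_ge_pow4: "real n \<ge> L ^ 4 / 64"
proof -
  have "(L\<^sup>2 / 8)\<^sup>2 \<le> (exp (L / 2))\<^sup>2"
    using exp_ge_power2[of "L / 2"] L_pos by (intro power_mono) (auto simp: power_divide)
  also have "\<dots> = real n" unfolding n_eq by (simp flip: exp_double)
  finally show ?thesis by (simp add: power_divide)
qed

lemma n_ge_cube: "real n \<ge> 100 * L ^ 3"
proof -
  have "100 * L ^ 3 \<le> L / 64 * L ^ 3" using L_large by (intro mult_right_mono) auto
  then show ?thesis using n_ge_pow4 by (simp add: power_Suc[symmetric] eval_nat_numeral)
qed

lemma n_ge_square: "real n \<ge> L\<^sup>2"
proof -
  have "L\<^sup>2 * 1 \<le> L\<^sup>2 * (100 * L)" using L_large by (intro mult_left_mono) auto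
  then show ?thesis using n_ge_cube by (simp add: power2_eq_square power3_eq_cube)
qed

text \<open>Since exp(-2p) <= 1 - 2p + 2p^2 = p^2 + (1-p)^2, no error of order p^2 K arises. The
  doubled exponent turns the 3 ln L of the theorem into L^6.\<close>

lemma sum_T: "(\<Sum>w\<le>K. T w) \<ge> L ^ 6 / d\<^sup>2"
proof -
  have "L ^ 6 / d\<^sup>2 = exp (6 * ln L) / exp (2 * ln d)"
    using exp_of_nat_mult[of 6 "ln L"] exp_of_nat_mult[of 2 "ln d"] L_pos d_pos by simp
  also have "\<dots> = exp (- (2 * (ln d - 3 * ln L)))" by (simp flip: exp_diff)
  also have "\<dots> \<le> exp (- (2 * (p * K)))" using K_upper by simp
  also have "\<dots> = exp (- (2 * p)) ^ K" by (simp flip: exp_of_nat_mult add: mult_ac)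
  also have "\<dots> \<le> (p\<^sup>2 + (1 - p)\<^sup>2) ^ K"
    using exp_minus_le_quadratic[of "2 * p"] p
    by (intro power_mono) (auto simp: power2_eq_square algebra_simps)
  also have "\<dots> = (\<Sum>w\<le>K. T w)"
    unfolding binomial_ring T_def by (simp add: power_mult)
  finally show ?thesis .
qed

text \<open>The weights \<open>0\<close> and \<open>1\<close> contribute little since \<open>K p\<^sup>2\<close> is large.\<close>

lemma sum_T_ge_2: "(\<Sum>w\<in>{2..K}. T w) \<ge> L ^ 6 / (2 * d\<^sup>2)"
proof -
  have K2: "K \<ge> 2" using K_ge L_large by simp
  let ?y = "(1 - p) ^ (2 * (K - 2))"
  have y0: "?y \<ge> 0" using p by simp
  have q: "0 \<le> 1 - p" "(1 - p)\<^sup>2 \<le> 1" using p by (simp_all add: power_le_one)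
  have T2: "T 2 = K * p\<^sup>2 * ((real K - 1) * p\<^sup>2 / 2) * ?y"
  proof -
    have "real (K choose 2) = K * (real K - 1) / 2"
      using K2 by (simp add: choose_two real_of_nat_div of_nat_diff)
    then show ?thesis by (simp add: T_def power2_eq_square eval_nat_numeral)
  qed
  have T1: "T 1 = K * p\<^sup>2 * (1 - p)\<^sup>2 * ?y"
  proof -
    have "2 * (K - 1) = 2 + 2 * (K - 2)" using K2 by simp
    then show ?thesis by (simp add: T_def power2_eq_square)
  qed
  have T0: "T 0 = (1 - p)\<^sup>2 * (1 - p)\<^sup>2 * ?y"
  proof -
    have "T 0 = (1 - p) ^ (2 * K)" by (simp add: T_def)
    also have "2 * K = 2 + (2 + 2 * (K - 2))" using K2 by simp
    finally show ?thesis by (simp only: power_add mult.assoc)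
  qed
  have "T 1 \<le> K * p\<^sup>2 * 1 * ?y" unfolding T1 using q y0 by (intro mult_right_mono mult_left_mono) auto
  moreover have "T 0 \<le> 1 * 1 * ?y" unfolding T0 using q y0 by (intro mult_right_mono mult_mono) auto
  moreover have "1 * 1 * ?y \<le> K * p\<^sup>2 * 1 * ?y" using p2K y0 by (intro mult_right_mono) auto
  moreover have "K * p\<^sup>2 * 2 * ?y \<le> T 2"
  proof -
    have "p\<^sup>2 \<le> 1" using p by (simp add: power_le_one)
    then have "(real K - 1) * p\<^sup>2 \<ge> 17" using p2K by (simp add: left_diff_distrib)
    then show ?thesis unfolding T2 using y0 by (intro mult_right_mono mult_left_mono) auto
  qed
  \<comment> \<open>Both terms are at most K p^2 times \<open>?y\<close>, and \<open>T 2\<close> is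
    at least twice that.\<close>
  ultimately have "T 0 + T 1 \<le> T 2" by linarith
  also have "\<dots> \<le> (\<Sum>w\<in>{2..K}. T w)"
    using K2 p by (intro member_le_sum) (auto simp: T_def)
  finally have "T 0 + T 1 \<le> (\<Sum>w\<in>{2..K}. T w)" .
  moreover have "(\<Sum>w\<le>K. T w) = T 0 + T 1 + (\<Sum>w\<in>{2..K}. T w)"
  proof -
    have "{..K} = insert 0 (insert 1 {2..K})" using K2 by auto
    then show ?thesis by (simp add: add_ac)
  qed
  ultimately show ?thesis using sum_T by (simp add: field_simps)
qed

text \<open>Pigeonhole over fewer than K <= L^2/20 weights. Having w >= 2 guarantees at least about
  K^2/2 possible neighbourhoods when collisions saturate in
  \<open>no_collision_bound\<close>.\<close>

lemma good_weight:
  obtains w where "2 \<le> w" "w \<le> K" "d\<^sup>2 * T w \<ge> 10 * L ^ 4"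
proof -
  have "\<exists>w\<in>{2..K}. T w \<ge> L ^ 6 / (2 * d\<^sup>2) / K"
  proof (rule ccontr)
    have K2: "K \<ge> 2" using K_ge L_large by simp
    assume "\<not> ?thesis"
    then have lt: "\<And>w. w \<in> {2..K} \<Longrightarrow> T w < L ^ 6 / (2 * d\<^sup>2) / K" by (auto simp: not_le)
    have "(\<Sum>w\<in>{2..K}. T w) < (\<Sum>w\<in>{2..K}. L ^ 6 / (2 * d\<^sup>2) / K)"
      using lt K2 by (intro sum_strict_mono) auto
    also have "\<dots> = real (K - 1) * (L ^ 6 / (2 * d\<^sup>2) / K)" by simp
    also have "\<dots> \<le> real K * (L ^ 6 / (2 * d\<^sup>2) / K)" using L_pos by (intro mult_right_mono) auto
    also have "\<dots> = L ^ 6 / (2 * d\<^sup>2)" using K2 by simp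
    finally show False using sum_T_ge_2 by simp
  qed
  then obtain w where w: "w \<in> {2..K}" "T w \<ge> L ^ 6 / (2 * d\<^sup>2) / K" by blast
  have K0: "real K > 0" using K_ge L_pos by linarith
  have "10 * L ^ 4 * (2 * K) \<le> L ^ 4 * L\<^sup>2"
    using mult_left_mono[OF K_le, of "L ^ 4"] by simp
  also have "L ^ 4 * L\<^sup>2 = L ^ 6" by (simp flip: power_add)
  finally have "10 * L ^ 4 \<le> L ^ 6 / (2 * K)" using K0 by (simp add: field_simps)
  also have "\<dots> = d\<^sup>2 * (L ^ 6 / (2 * d\<^sup>2) / K)" using d_pos by simp
  also have "\<dots> \<le> d\<^sup>2 * T w" using w(2) by (intro mult_left_mono) auto
  finally show ?thesis using that w(1) by auto
qed

lemma KL_le: "4 * (K * L) \<le> L ^ 3 / 5"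
  using mult_right_mono[OF K_le, of L] L_pos by (simp add: power2_eq_square power3_eq_cube)

text \<open>The number \<theta> = q n/5 bounds from below the expected number of vertices of
  \<open>W2\<close> with a given neighbourhood. If \<theta> <= 1, the exponent is at least n^2 M
  q^2/50 = d^2 T(w)/50 >= L^4/5. If \<theta> > 1, it is at least M/2, which w >= 2 makes of order
  K^2. The target 4 K L consists of 3 K L for the choice of S and K L >= L for the choice of
  v.\<close>

lemma no_collision_bound:
  assumes S: "S \<subseteq> {1..n}" "card S = K" and v: "v \<in> {1..n}" "v \<notin> S"
  shows "measure_pmf.prob (gnp n p) {b. \<not> collision n S v b} \<le> exp (- (4 * (K * L)))"
proof -
  obtain w where w: "2 \<le> w" "w \<le> K" and Tw: "d\<^sup>2 * T w \<ge> 10 * L ^ 4" by (rule good_weight)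
  define q where "q = p * (p ^ w * (1 - p) ^ (K - w))"
  define M where "M = real (K choose w)"
  have q0: "q \<ge> 0" using p by (simp add: q_def)
  have finS: "finite S" using S(1) finite_subset by blast
  let ?W = "{1..n} - insert v S"
  have cW: "card ?W = n - Suc K" using S v finS by (simp add: card_Diff_subset)
  \<comment> \<open>The available vertices are halved; as K is small compared with n, both halves
    keep at least n/5 vertices.\<close>
  obtain W1 where W1: "W1 \<subseteq> ?W" "card W1 = card ?W div 2"
    by (meson div_le_dividend obtain_subset_with_card_n)
  let ?W2 = "?W - W1"
  have finW1: "finite W1" using W1(1) finite_subset by blast
  have cW2: "card ?W2 = card ?W - card W1" using W1(1) finW1 by (rule card_Diff_subset[rotated])
  have n100: "real n \<ge> 100" using n_ge_L L_large by linarith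
  have "20 * K \<le> n" using K_le n_ge_square by (simp flip: of_nat_le_iff)
  then have five: "5 * card W1 \<ge> n" "5 * card ?W2 \<ge> n"
    unfolding cW2 W1(2) cW using n100 by linarith+
  have d2: "d\<^sup>2 = p\<^sup>2 * n\<^sup>2" by (simp add: d power_mult_distrib)
  have Mq: "n\<^sup>2 * M * q\<^sup>2 = d\<^sup>2 * T w"
    unfolding d2 M_def q_def T_def by (simp add: power_mult_distrib mult_ac flip: power_mult)
  let ?\<theta> = "q * n / 5"
  have \<theta>0: "?\<theta> \<ge> 0" using q0 by simp
  have key: "n / 5 * (M * q) * (1 - exp (- ?\<theta>)) \<ge> 4 * (K * L)"
  proof (cases "?\<theta> \<le> 1")
    case True
    have "exp (- ?\<theta>) \<le> 1 - ?\<theta> + ?\<theta>\<^sup>2 / 2" using \<theta>0 by (rule exp_minus_le_quadratic)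
    also have "?\<theta>\<^sup>2 \<le> ?\<theta>" using \<theta>0 True mult_left_mono[of ?\<theta> 1 ?\<theta>] by (simp only: power2_eq_square mult_1_right)
    finally have "1 - exp (- ?\<theta>) \<ge> ?\<theta> / 2" by simp
    then have "n / 5 * (M * q) * (1 - exp (- ?\<theta>)) \<ge> n / 5 * (M * q) * (?\<theta> / 2)"
      using q0 by (intro mult_left_mono) (auto simp: M_def)
    also have "n / 5 * (M * q) * (?\<theta> / 2) = n\<^sup>2 * M * q\<^sup>2 / 50" by (simp add: power2_eq_square)
    also have "\<dots> \<ge> L ^ 4 / 5" unfolding Mq using Tw by simp
    also have "L ^ 4 / 5 \<ge> L ^ 3 / 5"
      using L_large by (simp add: power_increasing)
    finally show ?thesis using KL_le by linarith
  next
    case False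
    have "exp (- ?\<theta>) \<le> exp (- 1)" using False by simp
    also have "\<dots> \<le> 1 / 2" using exp_minus_le_quadratic[of 1] by simp
    finally have e: "1 - exp (- ?\<theta>) \<ge> 1 / 2" by simp
    \<comment> \<open>A neighbourhood of size w has probability at most p^w <= exp(-w), so q n > 1
      forces w < L. Then 2 w <= K, and binomial coefficients increase up to w.\<close>
    have wL: "real w < L"
    proof -
      have "1 < q * n" using False by simp
      also have "q \<le> p ^ w"
      proof -
        have "p * (p ^ w * (1 - p) ^ (K - w)) \<le> 1 * (p ^ w * 1)"
          using p by (intro mult_mono) (auto intro: power_le_one)
        then show ?thesis by (simp add: q_def)
      qed
      then have "q * n \<le> p ^ w * n" by (intro mult_right_mono) auto
      also have "p ^ w \<le> exp (- 1) ^ w"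
      proof (rule power_mono)
        have "(1::real) / 100 \<le> exp (- 1)" using exp_le by (simp add: exp_minus field_simps)
        then show "p \<le> exp (- 1)" using p_small by linarith
      qed (rule p)
      then have "p ^ w * n \<le> exp (- 1) ^ w * n" by (intro mult_right_mono) auto
      also have "\<dots> = exp (L - w)" unfolding n_eq by (simp flip: exp_of_nat_mult exp_add)
      finally have "exp 0 < exp (L - w)" by simp
      then show ?thesis by (simp only: exp_less_cancel_iff)
    qed
    have "2 * w \<le> K" using wL K_ge L_pos by (simp flip: of_nat_le_iff)
    then have "K choose 2 \<le> K choose w" using w by (intro binomial_mono)
    then have "M \<ge> real (K choose 2)" by (simp add: M_def)
    also have "real (K choose 2) = K * (real K - 1) / 2"
      using w by (simp add: choose_two real_of_nat_div of_nat_diff)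
    finally have M: "M \<ge> K * (real K - 1) / 2" .
    have "4 * (K * L) = K * (16 * L) / 4" by simp
    also have "\<dots> \<le> K * (real K - 1) / 4"
      using K_ge L_large by (intro divide_right_mono mult_left_mono) auto
    also have "\<dots> \<le> M * 1 * (1 / 2)" using M by simp
    also have "\<dots> \<le> M * ?\<theta> * (1 - exp (- ?\<theta>))"
      using False e by (intro mult_mono mult_left_mono) (auto simp: M_def)
    finally show ?thesis by (simp add: mult_ac)
  qed
  have "measure_pmf.prob (gnp n p) {b. \<not> collision n S v b} \<le>
      exp (card W1 * ((card S choose w) * q) * (exp (- (q * card ?W2)) - 1))"
    by (rule prob_no_collision[OF S(1) v p]) (use W1(1) S(2) in \<open>auto simp: q_def\<close>)
  also have "\<dots> \<le> exp (- (4 * (K * L)))"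
  proof -
    have "q * card ?W2 \<ge> ?\<theta>" using five(2) q0 mult_left_mono[of "n / 5" "card ?W2" q] by simp
    then have "1 - exp (- (q * card ?W2)) \<ge> 1 - exp (- ?\<theta>)" by simp
    moreover have "1 - exp (- ?\<theta>) \<ge> 0" using \<theta>0 by simp
    ultimately have "card W1 * (M * q) * (1 - exp (- (q * card ?W2))) \<ge> n / 5 * (M * q) * (1 - exp (- ?\<theta>))"
      using five(1) q0 by (intro mult_mono) (auto simp: M_def)
    with key have le: "4 * (K * L) \<le> card W1 * (M * q) * (1 - exp (- (q * card ?W2)))" by (rule order_trans)
    have eq: "card W1 * ((card S choose w) * q) * (exp (- (q * card ?W2)) - 1) =
        - (card W1 * (M * q) * (1 - exp (- (q * card ?W2))))"
      by (simp add: S(2) M_def algebra_simps)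
    show ?thesis unfolding eq using le by (simp only: exp_le_cancel_iff neg_le_iff_le)
  qed
  finally show ?thesis .
qed

lemma prob_all_collide:
  "measure_pmf.prob (gnp n p) {b. \<exists>S\<subseteq>{1..n}. card S = K \<and> (\<exists>v\<in>{1..n} - S. \<not> collision n S v b)} \<le> 1 / n"
proof (rule union_over_sets_card)
  have K1: "real K \<ge> 1" using K_ge L_large by linarith
  then show "K \<ge> 1" by simp
  fix S assume S: "S \<subseteq> {1..n}" "card S = K"
  have "{b. \<exists>v\<in>{1..n} - S. \<not> collision n S v b} = (\<Union>v\<in>{1..n} - S. {b. \<not> collision n S v b})" by auto
  then have "measure_pmf.prob (gnp n p) {b. \<exists>v\<in>{1..n} - S. \<not> collision n S v b} \<le>
     (\<Sum>v\<in>{1..n} - S. measure_pmf.prob (gnp n p) {b. \<not> collision n S v b})"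
    using measure_pmf.finite_measure_subadditive_finite[of "{1..n} - S" "\<lambda>v. {b. \<not> collision n S v b}" "gnp n p"] by simp
  also have "\<dots> \<le> card ({1..n} - S) * exp (- (4 * (K * L)))"
    by (rule sum_bounded_above) (use no_collision_bound[OF S] in auto)
  also have "\<dots> \<le> exp L * exp (- (4 * (K * L)))"
  proof (rule mult_right_mono)
    show "real (card ({1..n} - S)) \<le> exp L"
      using card_mono[of "{1..n}" "{1..n} - S"] unfolding n_eq[symmetric] by simp
  qed simp
  also have "\<dots> \<le> exp (- 3 * real K * ln n)"
    using K1 L_pos mult_right_mono[of 1 "real K" L] by (simp add: L[symmetric] flip: exp_add)
  finally show "measure_pmf.prob (gnp n p) {b. \<exists>v\<in>{1..n} - S. \<not> collision n S v b} \<le> exp (- 3 * real K * ln n)" .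
qed (rule n_pos)

lemma dense_case:
  "measure_pmf.prob (gnp n p) {b. \<not> (graph_connected (graph_of n b) \<and>
     (\<forall>k. real k < (ln d - 3 * ln L) * (n / d ^ i) \<longrightarrow> \<not> cops_can_win (graph_of n b) k))} \<le> 6 / L"
proof -
  let ?diam = "\<lambda>b. \<forall>x\<in>{1..n}. \<forall>y\<in>{1..n}. x \<noteq> y \<longrightarrow>
      (\<exists>z. (x, z) \<in> arcs (graph_of n b) \<and> (z, y) \<in> arcs (graph_of n b))"
  have n4: "n \<ge> 4" using n_ge_L L_large by linarith
  have pn: "p\<^sup>2 * n \<ge> 6 * ln n"
  proof -
    have "6 * L \<le> 400 / L\<^sup>2 * (100 * L ^ 3)"
      using L_pos by (simp add: power2_eq_square power3_eq_cube)
    also have "\<dots> \<le> p\<^sup>2 * n"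
    proof (rule mult_mono)
      have "20 / L \<le> p" using dense L_pos by (simp add: field_simps)
      then have "(20 / L)\<^sup>2 \<le> p\<^sup>2" using L_pos by (intro power_mono) auto
      then show "400 / L\<^sup>2 \<le> p\<^sup>2" by (simp add: power_divide)
    qed (use n_ge_cube L_pos in auto)
    finally show ?thesis by (simp add: L)
  qed
  have disc: "measure_pmf.prob (gnp n p) {b. \<not> graph_connected (graph_of n b)} \<le> 1 / n"
    using prob_disconnected[OF n_pos p] d_ge_L L_pos by (simp add: d L[symmetric])
  have total: "measure_pmf.prob (gnp n p) {b. \<not> graph_connected (graph_of n b) \<or> \<not> ?diam b \<or>
      (\<exists>S\<subseteq>{1..n}. card S = K \<and> (\<exists>v\<in>{1..n} - S. \<not> collision n S v b))} \<le> 1 / n + (1 / n + 1 / n)"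
    by (intro prob_disj_le disc prob_diam_gt_2[OF n4 p pn] prob_all_collide)
  have "1 / n \<le> 1 / L" using n_ge_L L_pos by (simp add: frac_le)
  then have "1 / n + (1 / n + 1 / n) \<le> 3 * (1 / L)" by linarith
  also have "\<dots> \<le> 6 * (1 / L)" using L_pos by (intro mult_right_mono) auto
  also have "\<dots> = 6 / L" by simp
  finally have six: "1 / n + (1 / n + 1 / n) \<le> 6 / L" .
  have Kn: "K + 1 < n"
  proof -
    have "20 * real K \<le> n" using K_le n_ge_square by linarith
    moreover have "real n \<ge> 100" using n_ge_L L_large by linarith
    ultimately show ?thesis by linarith
  qed
  have kK: "k \<le> K" if "real k < (ln d - 3 * ln L) * (n / d ^ i)" for k
  proof -
    have "n / d ^ i = 1 / p" using n_pos by (simp add: i1 d)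
    then have "real k < (ln d - 3 * ln L) / p" using that by simp
    then show ?thesis unfolding K_def by linarith
  qed
  show ?thesis
  proof (rule order_trans[OF order_trans[OF prob_mono total] six], rule ccontr)
    fix b
    assume no: "\<not> (graph_connected (graph_of n b) \<and>
      (\<forall>k. real k < (ln d - 3 * ln L) * (n / d ^ i) \<longrightarrow> \<not> cops_can_win (graph_of n b) k))"
    assume ok: "\<not> (\<not> graph_connected (graph_of n b) \<or> \<not> ?diam b \<or>
      (\<exists>S\<subseteq>{1..n}. card S = K \<and> (\<exists>v\<in>{1..n} - S. \<not> collision n S v b)))"
    note ok' = ok[unfolded de_Morgan_disj not_not]
    have "\<not> cops_can_win (graph_of n b) k" if "real k < (ln d - 3 * ln L) * (n / d ^ i)" for k
    proof (rule dense_evasion[OF _ _ Kn kK[OF that]])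
      show "\<exists>z. (x, z) \<in> arcs (graph_of n b) \<and> (z, y) \<in> arcs (graph_of n b)"
        if "x \<in> {1..n}" "y \<in> {1..n}" "x \<noteq> y" for x y
        using ok'[THEN conjunct2, THEN conjunct1] that by blast
      show "collision n S v b" if "S \<subseteq> {1..n}" "card S = K" "v \<in> {1..n} - S" for S v
        using ok'[THEN conjunct2, THEN conjunct2] that by blast
    qed
    then show False using no ok'[THEN conjunct1] by blast
  qed
qed

end

section \<open>Combination of the regimes and the limit\<close>

text \<open>The asymptotic hypotheses enter as inequalities at a single n, so that the limit only
  has to collect eventual facts.\<close>

lemma good_probability:
  fixes n i :: nat and p d L :: real
  assumes p: "0 \<le> p" "p \<le> 1" and small: "p \<le> 1 / 100" and d: "d = p * n" and L: "L = ln n" and lnL: "ln L \<ge> 300"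
    and d6: "d \<ge> 6 * L" and i: "i \<ge> 1" and di: "d ^ i \<le> n * ln L" and di1: "d ^ (i + 1) \<ge> 2 * L * n"
    and large: "400 * real n > L\<^sup>2 * ln L"
  shows "measure_pmf.prob (binomial_random_graph n p) {G. \<not> (graph_connected G \<and>
     real (localization_number G) \<ge> (ln d - 3 * ln L) * (n / d ^ i))} \<le> 6 / L"
proof -
  let ?x = "(ln d - 3 * ln L) * (n / d ^ i)"
  let ?Q = "\<lambda>b. graph_connected (graph_of n b) \<and> (\<forall>k. real k < ?x \<longrightarrow> \<not> cops_can_win (graph_of n b) k)"
  have n1: "n \<ge> 1" using lnL L by (cases "n = 0") auto
  have L0: "L > 0"
  proof (rule ccontr)
    assume "\<not> L > 0"
    moreover have "L \<ge> 0" using n1 by (simp add: L)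
    ultimately have "L = 0" by simp
    then show False using lnL by simp
  qed
  have lnL_le: "ln L \<le> L" using ln_le_minus_one[OF L0] by simp
  have n_ge: "real n \<ge> L" using n1 exp_ge_add_one_self[of L] by (simp add: L)
  have d0: "d > 0" using d6 L0 by linarith
  have "measure_pmf.prob (gnp n p) {b. \<not> ?Q b} \<le> 6 / L"
  proof (cases "d \<ge> L ^ 3")
    \<comment> \<open>Here ln d < 3 ln L, so no k lies below the bound and the claim is
      connectedness.\<close>
    case False
    have "ln d \<le> ln (L ^ 3)" using False d0 L0 by simp
    also have "\<dots> = 3 * ln L" using L0 by (simp add: ln_realpow)
    finally have "?x \<le> 0" using d0 by (intro mult_nonpos_nonneg) auto
    then have "?Q b \<longleftrightarrow> graph_connected (graph_of n b)" for b
      by (auto dest: less_le_trans)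
    then have "measure_pmf.prob (gnp n p) {b. \<not> ?Q b} \<le> 1 / n"
      using prob_disconnected[OF n1 p] d6 by (simp add: d L)
    also have "\<dots> \<le> 1 / L" using n_ge L0 by (simp add: frac_le)
    also have "\<dots> \<le> 6 / L" using L0 by (simp add: divide_right_mono)
    finally show ?thesis .
  next
    case True
    have "d ^ i \<le> n * L" using di lnL_le by (meson mult_left_mono of_nat_0_le_iff order_trans)
    then interpret large_parameters n i p d L
      using p d L lnL True i di1 by unfold_locales auto
    show ?thesis
    proof (cases "p * L \<le> 20")
      case True
      then interpret sparse_parameters n i p d L by unfold_locales
      show ?thesis by (rule sparse_case)
    next
      case False
      \<comment> \<open>Otherwise d^2 <= n ln L, whereas d > 20 n/L in this case;
        \<open>large\<close> excludes this.\<close>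
      have "i = 1"
      proof (rule ccontr)
        assume "i \<noteq> 1"
        then have "d\<^sup>2 \<le> d ^ i" using i d_large by (intro power_increasing) auto
        then have "d\<^sup>2 \<le> n * ln L" using di by linarith
        moreover have "(20 * real n / L)\<^sup>2 \<le> d\<^sup>2"
        proof (rule power_mono)
          have "20 * real n \<le> p * L * n" using False by (intro mult_right_mono) auto
          then show "20 * real n / L \<le> d" using L0 by (simp add: d field_simps)
        qed (use L0 in auto)
        ultimately have "(20 * real n / L)\<^sup>2 \<le> n * ln L" by linarith
        then have "400 * real n * n \<le> n * (L\<^sup>2 * ln L)"
          using L0 by (simp add: power_divide power_mult_distrib field_simps power2_eq_square)
        then show False using large n1 by (simp add: mult.commute)
      qed
      then interpret dense_parameters n i p d L using False small by unfold_locales auto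
      show ?thesis by (rule dense_case)
    qed
  qed
  moreover have "measure_pmf.prob (gnp n p) {b. \<not> (graph_connected (graph_of n b) \<and> real (localization_number (graph_of n b)) \<ge> ?x)} \<le>
      measure_pmf.prob (gnp n p) {b. \<not> ?Q b}"
    by (intro prob_mono) (auto intro: le_localization_number)
  ultimately show ?thesis
    unfolding prob_binomial_random_graph by linarith
qed

theorem theorem5p1:
  fixes p d :: "nat \<Rightarrow> real" and i :: "nat \<Rightarrow> nat"
  assumes p_range: "\<And>n. 0 \<le> p n \<and> p n \<le> 1"
    and d_def: "\<And>n. d n = p n * real n"
    and d_lower: "(\<lambda>n. ln (real n)) \<in> o(d)"
    and d_upper: "d \<in> o(\<lambda>n. real n)"
    and i_largest: "largest_exponent d (\<lambda>n. real n * ln (ln (real n))) i"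
    and growth: "filterlim (\<lambda>n. d n ^ (i n + 1) / real n - 2 * ln (real n)) at_top sequentially"
  shows "asymptotically_almost_surely (\<lambda>n. binomial_random_graph n (p n))
    (\<lambda>n G. graph_connected G \<and>
       real (localization_number G) \<ge>
         (ln (d n) - 3 * ln (ln (real n))) * (real n / d n ^ i n))"
proof -
  let ?P = "\<lambda>n G. graph_connected G \<and> real (localization_number G) \<ge>
         (ln (d n) - 3 * ln (ln (real n))) * (real n / d n ^ i n)"
  have d_nonneg: "d n \<ge> 0" for n using p_range by (simp add: d_def)
  have ev_n: "\<forall>\<^sub>F n in sequentially. ln (ln (real n)) \<ge> 300" by real_asymp
  have ev_large: "\<forall>\<^sub>F n in sequentially. 400 * real n > (ln (real n))\<^sup>2 * ln (ln (real n))" by real_asymp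
  have ev_p: "\<forall>\<^sub>F n in sequentially. norm (d n) \<le> 1 / 100 * norm (real n)"
    using landau_o.smallD[OF d_upper, of "1 / 100"] by simp
  have ev_d6: "\<forall>\<^sub>F n in sequentially. norm (ln (real n)) \<le> 1 / 6 * norm (d n)"
    using landau_o.smallD[OF d_lower, of "1 / 6"] by simp
  have ev_di: "\<forall>\<^sub>F n in sequentially. norm (d n ^ i n) \<le> 1 * norm (real n * ln (ln (real n)))"
    using i_largest landau_o.smallD[of "\<lambda>n. d n ^ i n" _ _ 1] by (simp add: largest_exponent_def)
  have ev_growth: "\<forall>\<^sub>F n in sequentially. d n ^ (i n + 1) / real n - 2 * ln (real n) \<ge> 0"
    by (rule growth[unfolded filterlim_at_top, rule_format])
  \<comment> \<open>The constant exponent 1 is admissible, since d << n and ln (ln n) is eventually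
    bounded below by a positive constant; maximality of \<open>i\<close> does the rest.\<close>
  have ev_i: "\<forall>\<^sub>F n in sequentially. i n \<ge> 1"
  proof -
    have "(\<lambda>n. d n ^ 1) \<in> o(\<lambda>n. real n * ln (ln (real n)))"
    proof -
      have "(\<lambda>n::nat. real n) \<in> O(\<lambda>n. real n * ln (ln (real n)))" by real_asymp
      then show ?thesis using landau_o.small_big_trans[OF d_upper] by simp
    qed
    then show ?thesis using i_largest unfolding largest_exponent_def
      by (elim conjE allE[of _ "\<lambda>_. 1"] impE) simp_all
  qed
  have fail: "\<forall>\<^sub>F n in sequentially.
      measure_pmf.prob (binomial_random_graph n (p n)) {G. \<not> ?P n G} \<le> 6 / ln (real n)"
    using ev_n ev_large ev_p ev_d6 ev_di ev_growth ev_i eventually_gt_at_top[of 0]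
  proof eventually_elim
    case (elim n)
    have n0: "real n > 0" using elim(8) by simp
    show ?case
    proof (rule good_probability[OF _ _ _ d_def refl elim(1) _ elim(7) _ _ elim(2)])
      have "p n * real n \<le> 1 / 100 * real n" using elim(3) d_nonneg[of n] by (simp add: d_def)
      then show "p n \<le> 1 / 100" using n0 by (simp add: mult_le_cancel_right)
      show "6 * ln (real n) \<le> d n" using elim(4) d_nonneg[of n] by (simp add: abs_le_iff)
      show "d n ^ i n \<le> real n * ln (ln (real n))"
        using elim(1,5) d_nonneg[of n] by (simp add: abs_mult)
      show "2 * ln (real n) * real n \<le> d n ^ (i n + 1)" using elim(6) n0 by (simp add: field_simps)
    qed (use p_range in auto)
  qed
  have lim: "(\<lambda>n. 1 - 6 / ln (real n)) \<longlonglongrightarrow> 1" by real_asymp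
  show ?thesis
    unfolding asymptotically_almost_surely_def
  proof (rule tendsto_sandwich[OF _ _ lim tendsto_const])
    show "\<forall>\<^sub>F n in sequentially. 1 - 6 / ln (real n) \<le>
        measure_pmf.prob (binomial_random_graph n (p n)) {G. ?P n G}"
      using fail
    proof eventually_elim
      case (elim n)
      then show ?case unfolding prob_not by linarith
    qed
    show "\<forall>\<^sub>F n in sequentially. measure_pmf.prob (binomial_random_graph n (p n)) {G. ?P n G} \<le> 1"
      by simp
  qed
qed

end
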